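(* Let $T$ be a Leibniz triple system with solvable radical $R(T)$, and let $Rad(U(T))$ be the solvable radical of its universal Leibniz envelope $U(T)$. Then $R(T)=Rad(U(T))\cap T$ and $Rad(U(T))=\mathcal{I}(R(T))+K(T)=\mathcal{J}(R(T))$.
   Context: All vector spaces are finite-dimensional over a fixed field $\mathbb{K}$ of characteristic $0$. Products such as $\{ABC\}$, $[A,B]$, $A\otimes B$ of subspaces denote linear spans. A Leibniz triple system is a vector space $T$ with a trilinear operation $\{\cdot,\cdot,\cdot\}:T\times T\times T\to T$ satisfying, for all $a,b,c,d,e\in T$, $\{a\{bcd\}e\}=\{\{abc\}de\}-\{\{acb\}de\}-\{\{adb\}ce\}+\{\{adc\}be\}$ and $\{ab\{cde\}\}=\{\{abc\}de\}-\{\{abd\}ce\}-\{\{abe\}cd\}+\{\{abe\}dc\}$. An ideal of $T$ is a subspace $I$ with $\{ITT\}+\{TIT\}+\{TTI\}\subseteq I$. A (right) Leibniz algebra is a vector space with a bilinear bracket satisfying $[[x,y],z]=[[x,z],y]+[x,[y,z]]$; ideals are two-sided. The universal Leibniz envelope of $T$ is the Leibniz algebra $U(T)=T\oplus(T\otimes T)$ with bracket $[a,b]=a\otimes b$, $[a\otimes b,c]=\{abc\}$, $[a,b\otimes c]=\{abc\}-\{acb\}$, $[a\otimes b,c\otimes d]=\{abc\}\otimes d-\{abd\}\otimes c$. $T$ is identified with the first summand. For an ideal $I$ of $T$: $i(I)=I\otimes T+T\otimes I$; $j(I)=\{w\in T\otimes T\mid [w,T]+[T,w]\subseteq I\}$;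 $\mathcal{I}(I)=I+i(I)$; $\mathcal{J}(I)=I+j(I)$. Also $K(T)=\{w\in T\otimes T\mid [w,T]=[T,w]=0\}=j(0)$. Solvability: for an ideal $I$ of $T$, $I^{[0]}=I$ and $I^{[n+1]}=\{TI^{[n]}I^{[n]}\}+\{I^{[n]}TI^{[n]}\}+\{I^{[n]}I^{[n]}T\}$ for $n\ge 0$; $I$ is solvable if $I^{[k]}=0$ for some positive integer $k$. $R(T)$, the solvable radical, is the sum of all solvable ideals of $T$ (it is the unique maximal solvable ideal). For an ideal $V$ of a Leibniz algebra, $V^{(0)}=V$, $V^{(n+1)}=[V^{(n)},V^{(n)}]$, and $V$ is solvable if $V^{(k)}=0$ for some $k$; $Rad(L)$ is the largest solvable ideal of the Leibniz algebra $L$. *)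

theory Defs
  imports "HOL-Analysis.Product_Vector" "HOL-Library.Set_Algebras"
begin

section \<open>Multilinear maps\<close>

definition bilinear_map ::
  "('k::field \<Rightarrow> 'a::ab_group_add \<Rightarrow> 'a) \<Rightarrow> ('k \<Rightarrow> 'b::ab_group_add \<Rightarrow> 'b) \<Rightarrow>
   ('k \<Rightarrow> 'c::ab_group_add \<Rightarrow> 'c) \<Rightarrow> ('a \<Rightarrow> 'b \<Rightarrow> 'c) \<Rightarrow> bool" where
  "bilinear_map sA sB sC f \<longleftrightarrow>
     (\<forall>x. Vector_Spaces.linear sB sC (\<lambda>y. f x y)) \<and>
     (\<forall>y. Vector_Spaces.linear sA sC (\<lambda>x. f x y))"

definition trilinear_op ::
  "('k::field \<Rightarrow> 'a::ab_group_add \<Rightarrow> 'a) \<Rightarrow> ('a \<Rightarrow> 'a \<Rightarrow> 'a \<Rightarrow> 'a) \<Rightarrow> bool" where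
  "trilinear_op s f \<longleftrightarrow>
     (\<forall>y z. Vector_Spaces.linear s s (\<lambda>x. f x y z)) \<and>
     (\<forall>x z. Vector_Spaces.linear s s (\<lambda>y. f x y z)) \<and>
     (\<forall>x y. Vector_Spaces.linear s s (\<lambda>z. f x y z))"


section \<open>Leibniz triple systems\<close>

locale leibniz_triple_system = finite_dimensional_vector_space scale Basis
  for scale :: "'k::field_char_0 \<Rightarrow> 'v::ab_group_add \<Rightarrow> 'v" and Basis :: "'v set" +
  fixes triple :: "'v \<Rightarrow> 'v \<Rightarrow> 'v \<Rightarrow> 'v" (\<open>\<lbrace>_,/ _,/ _\<rbrace>\<close>)
  assumes trilinear: "trilinear_op scale triple"
    and triple_middle: "\<lbrace>a, \<lbrace>b, c, d\<rbrace>, e\<rbrace> =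
      \<lbrace>\<lbrace>a, b, c\<rbrace>, d, e\<rbrace> - \<lbrace>\<lbrace>a, c, b\<rbrace>, d, e\<rbrace> - \<lbrace>\<lbrace>a, d, b\<rbrace>, c, e\<rbrace> + \<lbrace>\<lbrace>a, d, c\<rbrace>, b, e\<rbrace>"
    and triple_right: "\<lbrace>a, b, \<lbrace>c, d, e\<rbrace>\<rbrace> =
      \<lbrace>\<lbrace>a, b, c\<rbrace>, d, e\<rbrace> - \<lbrace>\<lbrace>a, b, d\<rbrace>, c, e\<rbrace> - \<lbrace>\<lbrace>a, b, e\<rbrace>, c, d\<rbrace> + \<lbrace>\<lbrace>a, b, e\<rbrace>, d, c\<rbrace>"
begin

definition triple_prod :: "'v set \<Rightarrow> 'v set \<Rightarrow> 'v set \<Rightarrow> 'v set" where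
  "triple_prod A B C = span {\<lbrace>a, b, c\<rbrace> | a b c. a \<in> A \<and> b \<in> B \<and> c \<in> C}"

definition ideal :: "'v set \<Rightarrow> bool" where
  "ideal I \<longleftrightarrow> subspace I \<and>
     triple_prod I UNIV UNIV + triple_prod UNIV I UNIV + triple_prod UNIV UNIV I \<subseteq> I"

primrec derived :: "nat \<Rightarrow> 'v set \<Rightarrow> 'v set" where
  "derived 0 I = I"
| "derived (Suc n) I =
     triple_prod UNIV (derived n I) (derived n I) +
     triple_prod (derived n I) UNIV (derived n I) +
     triple_prod (derived n I) (derived n I) UNIV"

definition solvable :: "'v set \<Rightarrow> bool" where
  "solvable I \<longleftrightarrow> (\<exists>k>0. derived k I = {0})"

text \<open>The sum of a family of subspaces is the span of its union.\<close>

definition solvable_radical :: "'v set" where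
  "solvable_radical = span (\<Union>{I. ideal I \<and> solvable I})"

end


section \<open>Ideals and radical of an algebra with a bracket\<close>

text \<open>
  The notions below are those of (right) Leibniz algebras, but none of them uses the Leibniz
  identity, so it is not assumed; see the remark at \<open>ubracket\<close>.
\<close>

locale bracket_algebra = vector_space scale
  for scale :: "'k::field \<Rightarrow> 'l::ab_group_add \<Rightarrow> 'l" +
  fixes bracket :: "'l \<Rightarrow> 'l \<Rightarrow> 'l"
  assumes bilinear_bracket: "bilinear_map scale scale scale bracket"
begin

definition bracket_prod :: "'l set \<Rightarrow> 'l set \<Rightarrow> 'l set" where
  "bracket_prod A B = span {bracket x y | x y. x \<in> A \<and> y \<in> B}"

definition ideal :: "'l set \<Rightarrow> bool" where
  "ideal V \<longleftrightarrow> subspace V \<and> bracket_prod V UNIV + bracket_prod UNIV V \<subseteq> V"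

primrec derived :: "nat \<Rightarrow> 'l set \<Rightarrow> 'l set" where
  "derived 0 V = V"
| "derived (Suc n) V = bracket_prod (derived n V) (derived n V)"

definition solvable :: "'l set \<Rightarrow> bool" where
  "solvable V \<longleftrightarrow> (\<exists>k. derived k V = {0})"

text \<open>The largest (with respect to inclusion) solvable ideal; it exists in finite dimension,
  the only case in which this constant is used.\<close>

definition solvable_radical :: "'l set" where
  "solvable_radical = (GREATEST V. ideal V \<and> solvable V)"

end


section \<open>Tensor squares\<close>

text \<open>
  HOL types cannot depend on the term \<open>scale\<close>, so the tensor product of a vector space with itself
  is any space \<open>'w\<close> with a bilinear map having the universal property.  The locale can only
  quantify over bilinear maps into one type; bilinear forms already suffice, and \<open>tensor_universal\<close>
  below derives the universal property for every target space.
\<close>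

locale tensor_square = V: vector_space scale + W: vector_space tscale
  for scale :: "'k::field \<Rightarrow> 'v::ab_group_add \<Rightarrow> 'v"
    and tscale :: "'k \<Rightarrow> 'w::ab_group_add \<Rightarrow> 'w" +
  fixes tensor :: "'v \<Rightarrow> 'v \<Rightarrow> 'w" (infixl \<open>\<otimes>\<close> 72)
  assumes tensor_bilinear: "bilinear_map scale scale tscale (\<otimes>)"
    and tensor_universal_form: "bilinear_map scale scale (*) f \<Longrightarrow>
      \<exists>!g. Vector_Spaces.linear tscale (*) g \<and> (\<forall>a b. g (a \<otimes> b) = f a b)"
begin

definition tensor_lift :: "('k \<Rightarrow> 'z::ab_group_add \<Rightarrow> 'z) \<Rightarrow> ('v \<Rightarrow> 'v \<Rightarrow> 'z) \<Rightarrow> 'w \<Rightarrow> 'z" where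
  "tensor_lift sZ f = (THE g. Vector_Spaces.linear tscale sZ g \<and> (\<forall>a b. g (a \<otimes> b) = f a b))"

definition tensor_prod :: "'v set \<Rightarrow> 'v set \<Rightarrow> 'w set" where
  "tensor_prod A B = W.span {a \<otimes> b | a b. a \<in> A \<and> b \<in> B}"

lemma span_tensors: "W.span {a \<otimes> b | a b. True} = UNIV"
proof (rule ccontr)
  assume ne: "W.span {a \<otimes> b | a b. True} \<noteq> UNIV"
  interpret p: vector_space_pair tscale "(*) :: 'k \<Rightarrow> 'k \<Rightarrow> 'k"
    by unfold_locales (auto simp: algebra_simps)
  obtain B where B: "B \<subseteq> {a \<otimes> b | a b. True}" "W.independent B"
    "{a \<otimes> b | a b. True} \<subseteq> W.span B"
    using W.maximal_independent_subset by blast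
  have sp: "W.span B = W.span {a \<otimes> b | a b. True}"
    using B by (meson W.span_mono W.span_minimal W.subspace_span subset_antisym)
  then obtain x where x: "x \<notin> W.span B" using ne by blast
  then have ind: "W.independent (insert x B)" using B by (simp add: W.independent_insertI)
  obtain g where g: "Vector_Spaces.linear tscale (*) g"
    "\<forall>y\<in>insert x B. g y = (if y = x then 1 else 0)"
    using p.linear_independent_extend[OF ind, of "\<lambda>y. if y = x then 1 else 0"] by blast
  have xB: "x \<notin> B" using x W.span_base by blast
  have g0: "g y = 0" if "y \<in> W.span B" for y
  proof -
    have "g b = 0" if "b \<in> B" for b using g(2) xB that by auto
    then show ?thesis using p.linear_eq_0_on_span[OF g(1), of B y] \<open>y \<in> W.span B\<close> by blast
  qed
  have gt: "\<forall>a b. g (a \<otimes> b) = 0"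
    using g0 B(3) by blast
  have l0: "Vector_Spaces.linear tscale (*) (\<lambda>_. 0 :: 'k)" by (rule p.linear_zero)
  have "bilinear_map scale scale (*) (\<lambda>_ _. 0 :: 'k)"
  proof -
    interpret q: vector_space_pair scale "(*) :: 'k \<Rightarrow> 'k \<Rightarrow> 'k"
      by unfold_locales (auto simp: algebra_simps)
    show ?thesis unfolding bilinear_map_def by (simp add: q.linear_zero)
  qed
  from tensor_universal_form[OF this] have "g = (\<lambda>_. 0)"
    using g(1) gt l0 by auto
  then show False using g(2) by auto
qed

theorem tensor_universal:
  fixes sZ :: "'k \<Rightarrow> 'z::ab_group_add \<Rightarrow> 'z"
  assumes Z: "vector_space sZ" and f: "bilinear_map scale scale sZ f"
  shows "\<exists>!g. Vector_Spaces.linear tscale sZ g \<and> (\<forall>a b. g (a \<otimes> b) = f a b)"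
proof -
  interpret Z: vector_space sZ by (fact Z)
  interpret p: vector_space_pair tscale sZ ..
  interpret q: vector_space_pair scale sZ ..
  interpret r: vector_space_pair scale "(*) :: 'k \<Rightarrow> 'k \<Rightarrow> 'k"
    by unfold_locales (auto simp: algebra_simps)
  interpret s: vector_space_pair scale tscale ..
  obtain B where B: "V.independent B" "V.span B = UNIV"
  proof (rule V.maximal_independent_subset[of UNIV])
    fix B assume "V.independent B" "UNIV \<subseteq> V.span B"
    then show thesis by (intro that[of B]) auto
  qed
  define \<pi> where "\<pi> i = (\<lambda>x. V.representation B x i)" for i
  have lin\<pi>: "Vector_Spaces.linear scale (*) (\<pi> i)" for i
    unfolding \<pi>_def using B
    by unfold_locales (auto simp: V.representation_add V.representation_scale algebra_simps)
  have \<pi>B: "\<pi> i j = (if j = i then 1 else 0)" if "i \<in> B" "j \<in> B" for i j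
    unfolding \<pi>_def using V.representation_basis[OF B(1) that(2)] by auto
  have bil: "bilinear_map scale scale (*) (\<lambda>x y. \<pi> i x * \<pi> j y)" for i j
    unfolding bilinear_map_def
  proof (intro conjI allI)
    fix x show "Vector_Spaces.linear scale (*) (\<lambda>y. \<pi> i x * \<pi> j y)"
      using r.linear_compose_scale_right[OF lin\<pi>] by simp
  next
    fix y show "Vector_Spaces.linear scale (*) (\<lambda>x. \<pi> i x * \<pi> j y)"
      using r.linear_compose_scale_right[OF lin\<pi>, of "\<pi> j y" i] by (simp add: mult.commute)
  qed
  have coord: "\<exists>g. Vector_Spaces.linear tscale (*) g \<and> (\<forall>a b. g (a \<otimes> b) = \<pi> i a * \<pi> j b)" for i j
    using tensor_universal_form[OF bil] by blast
  have inj: "inj_on (\<lambda>(a, b). a \<otimes> b) (B \<times> B)"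
  proof (rule inj_onI, clarify)
    fix a b c d assume h: "a \<in> B" "b \<in> B" "c \<in> B" "d \<in> B" "a \<otimes> b = c \<otimes> d"
    obtain g where g: "\<forall>x y. g (x \<otimes> y) = \<pi> a x * \<pi> b y" using coord by blast
    have "\<pi> a a * \<pi> b b = \<pi> a c * \<pi> b d" using g h(5) by metis
    then show "a = c \<and> b = d" using h by (auto simp: \<pi>B split: if_splits)
  qed
  define E where "E = (\<lambda>(a, b). a \<otimes> b) ` (B \<times> B)"
  have indE: "W.independent E"
  proof
    assume "W.dependent E"
    then obtain S u v where S: "finite S" "S \<subseteq> E" "(\<Sum>v\<in>S. tscale (u v) v) = 0" "v \<in> S" "u v \<noteq> 0"
      unfolding W.dependent_explicit by blast
    from S obtain a b where ab: "a \<in> B" "b \<in> B" "v = a \<otimes> b" unfolding E_def by auto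
    obtain g where gl: "Vector_Spaces.linear tscale (*) g"
      and g: "\<forall>x y. g (x \<otimes> y) = \<pi> a x * \<pi> b y" using coord by blast
    interpret g: Vector_Spaces.linear tscale "(*)" g by (fact gl)
    have "0 = g (\<Sum>v\<in>S. tscale (u v) v)" using S by (simp add: g.zero)
    also have "\<dots> = (\<Sum>w\<in>S. u w * g w)" by (simp add: g.sum g.scale)
    also have "\<dots> = (\<Sum>w\<in>S. if w = v then u v else 0)"
    proof (rule sum.cong[OF refl])
      fix w assume "w \<in> S"
      then have "w \<in> E" using S(2) by blast
      then obtain c d where cd: "c \<in> B" "d \<in> B" "w = c \<otimes> d" unfolding E_def by auto
      have "w = v \<longleftrightarrow> c = a \<and> d = b"
        using inj_on_eq_iff[OF inj, of "(c, d)" "(a, b)"] ab cd by simp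
      then show "u w * g w = (if w = v then u v else 0)"
        using cd ab(3) by (simp add: g \<pi>B[OF ab(1) cd(1)] \<pi>B[OF ab(2) cd(2)] split: if_splits)
    qed
    also have "\<dots> = u v" using S by simp
    finally show False using S by simp
  qed
  define h where "h w = (case the_inv_into (B \<times> B) (\<lambda>(a, b). a \<otimes> b) w of (a, b) \<Rightarrow> f a b)" for w
  have h: "h (a \<otimes> b) = f a b" if "a \<in> B" "b \<in> B" for a b
    using the_inv_into_f_f[OF inj, of "(a,b)"] that by (simp add: h_def)
  obtain g where g: "Vector_Spaces.linear tscale sZ g" "\<forall>w\<in>E. g w = h w"
    using p.linear_independent_extend[OF indE, of h] by blast
  have gB: "g (a \<otimes> b) = f a b" if "a \<in> B" "b \<in> B" for a b
    using g(2) h that unfolding E_def by auto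
  have tl: "Vector_Spaces.linear scale tscale (\<lambda>b. a \<otimes> b)"
    "Vector_Spaces.linear scale tscale (\<lambda>b. b \<otimes> a)" for a
    using tensor_bilinear unfolding bilinear_map_def by auto
  have fl: "Vector_Spaces.linear scale sZ (\<lambda>b. f a b)"
    "Vector_Spaces.linear scale sZ (\<lambda>b. f b a)" for a
    using f unfolding bilinear_map_def by auto
  have g1: "g (a \<otimes> y) = f a y" if "a \<in> B" for a y
  proof (rule q.linear_eq_on[of "\<lambda>y. g (a \<otimes> y)" "\<lambda>y. f a y"])
    show "Vector_Spaces.linear scale sZ (\<lambda>y. g (a \<otimes> y))"
      using Vector_Spaces.linear_compose[OF tl(1) g(1)] by (simp add: o_def)
    show "Vector_Spaces.linear scale sZ (\<lambda>y. f a y)" by (rule fl)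
    show "y \<in> V.span B" using B(2) by simp
  qed (use gB that in blast)
  have g2: "g (x \<otimes> y) = f x y" for x y
  proof (rule q.linear_eq_on[of "\<lambda>x. g (x \<otimes> y)" "\<lambda>x. f x y"])
    show "Vector_Spaces.linear scale sZ (\<lambda>x. g (x \<otimes> y))"
      using Vector_Spaces.linear_compose[OF tl(2) g(1)] by (simp add: o_def)
    show "Vector_Spaces.linear scale sZ (\<lambda>x. f x y)" by (rule fl)
    show "x \<in> V.span B" using B(2) by simp
  qed (use g1 in blast)
  show ?thesis
  proof (rule ex1I[of _ g])
    show "Vector_Spaces.linear tscale sZ g \<and> (\<forall>a b. g (a \<otimes> b) = f a b)" using g g2 by blast
    fix g' assume g': "Vector_Spaces.linear tscale sZ g' \<and> (\<forall>a b. g' (a \<otimes> b) = f a b)"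
    show "g' = g"
    proof
      fix w have "w \<in> W.span {a \<otimes> b | a b. True}" using span_tensors by simp
      then show "g' w = g w"
      proof (rule p.linear_eq_on[rotated 2])
        show "Vector_Spaces.linear tscale sZ g'" "Vector_Spaces.linear tscale sZ g"
          using g g' by blast+
      qed (use g2 g' in auto)
    qed
  qed
qed

lemma
  assumes "vector_space sZ" "bilinear_map scale scale sZ f"
  shows linear_tensor_lift: "Vector_Spaces.linear tscale sZ (tensor_lift sZ f)"
    and tensor_lift_tensor: "tensor_lift sZ f (a \<otimes> b) = f a b"
  using theI'[OF tensor_universal[OF assms]] unfolding tensor_lift_def by auto

lemma tensor_ext:
  fixes sZ :: "'k \<Rightarrow> 'z::ab_group_add \<Rightarrow> 'z"
  assumes "Vector_Spaces.linear tscale sZ g" "Vector_Spaces.linear tscale sZ h"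
    and "\<And>a b. g (a \<otimes> b) = h (a \<otimes> b)"
  shows "g w = h w"
proof -
  interpret g: Vector_Spaces.linear tscale sZ g by fact
  interpret p: vector_space_pair tscale sZ ..
  show ?thesis
  proof (rule p.linear_eq_on[OF assms(1,2)])
    show "w \<in> W.span {a \<otimes> b | a b. True}" using span_tensors by simp
  qed (use assms(3) in auto)
qed

lemma linear_tensor_lift_param:
  fixes sC :: "'k \<Rightarrow> 'c::ab_group_add \<Rightarrow> 'c" and sZ :: "'k \<Rightarrow> 'z::ab_group_add \<Rightarrow> 'z"
  assumes C: "vector_space sC" and Z: "vector_space sZ"
    and F: "\<And>c. bilinear_map scale scale sZ (F c)"
    and lin: "\<And>a b. Vector_Spaces.linear sC sZ (\<lambda>c. F c a b)"
  shows "Vector_Spaces.linear sC sZ (\<lambda>c. tensor_lift sZ (F c) w)"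
proof -
  interpret C: vector_space sC by (fact C)
  interpret Z: vector_space sZ by (fact Z)
  interpret p: vector_space_pair tscale sZ ..
  interpret q: vector_space_pair sC sZ ..
  note L = linear_tensor_lift[OF Z F] and E = tensor_lift_tensor[OF Z F]
  show ?thesis
  proof
    fix c d
    show "tensor_lift sZ (F (c + d)) w = tensor_lift sZ (F c) w + tensor_lift sZ (F d) w"
    proof (rule tensor_ext[OF L p.linear_compose_add[OF L L]])
      fix a b
      interpret l: Vector_Spaces.linear sC sZ "\<lambda>c. F c a b" by (rule lin)
      show "tensor_lift sZ (F (c + d)) (a \<otimes> b) =
        tensor_lift sZ (F c) (a \<otimes> b) + tensor_lift sZ (F d) (a \<otimes> b)"
        unfolding E by (rule l.add)
    qed
  next
    fix r c
    show "tensor_lift sZ (F (sC r c)) w = sZ r (tensor_lift sZ (F c) w)"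
    proof (rule tensor_ext[OF L p.linear_compose_scale_right[OF L]])
      fix a b
      interpret l: Vector_Spaces.linear sC sZ "\<lambda>c. F c a b" by (rule lin)
      show "tensor_lift sZ (F (sC r c)) (a \<otimes> b) = sZ r (tensor_lift sZ (F c) (a \<otimes> b))"
        unfolding E by (rule l.scale)
    qed
  qed
qed

end


section \<open>The universal Leibniz envelope\<close>

locale universal_leibniz_envelope =
  leibniz_triple_system scale Basis triple + tensor_square scale tscale tensor
  for scale :: "'k::field_char_0 \<Rightarrow> 'v::ab_group_add \<Rightarrow> 'v"
    and Basis :: "'v set"
    and triple :: "'v \<Rightarrow> 'v \<Rightarrow> 'v \<Rightarrow> 'v" (\<open>\<lbrace>_,/ _,/ _\<rbrace>\<close>)
    and tscale :: "'k \<Rightarrow> 'w::ab_group_add \<Rightarrow> 'w"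
    and tensor :: "'v \<Rightarrow> 'v \<Rightarrow> 'w" (infixl \<open>\<otimes>\<close> 72)
begin

definition uscale :: "'k \<Rightarrow> 'v \<times> 'w \<Rightarrow> 'v \<times> 'w" where
  "uscale = module_prod.scale scale tscale"

definition inT :: "'v \<Rightarrow> 'v \<times> 'w" where "inT a = (a, 0)"

definition inTT :: "'w \<Rightarrow> 'v \<times> 'w" where "inTT w = (0, w)"

text \<open>
  The bilinear extensions of \<open>[a \<otimes> b, c]\<close>, \<open>[a, b \<otimes> c]\<close> and \<open>[a \<otimes> b, c \<otimes> d]\<close>; the lemma
  \<open>ubracket_simps\<close> below gives the values on pure tensors.

  When \<open>T \<otimes> T\<close> is the full tensor square, as here, the Leibniz identity for this bracket can fail:
  for \<open>x = a\<close>, \<open>y = b\<close>, \<open>z = c \<otimes> d\<close> it asks for a relation between \<open>\<lbrace>a, b, c\<rbrace> \<otimes> d\<close>,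
  \<open>a \<otimes> \<lbrace>b, c, d\<rbrace>\<close> and their permutations.  The defects of such relations have
  zero bracket with \<open>T\<close> on both sides, that is, they lie in \<open>K(T)\<close>.
\<close>

definition bracket_TT_T :: "'w \<Rightarrow> 'v \<Rightarrow> 'v" where
  "bracket_TT_T w c = tensor_lift scale (\<lambda>a b. \<lbrace>a, b, c\<rbrace>) w"

definition bracket_T_TT :: "'v \<Rightarrow> 'w \<Rightarrow> 'v" where
  "bracket_T_TT a w = tensor_lift scale (\<lambda>b c. \<lbrace>a, b, c\<rbrace> - \<lbrace>a, c, b\<rbrace>) w"

definition bracket_TT_TT :: "'w \<Rightarrow> 'w \<Rightarrow> 'w" where
  "bracket_TT_TT w w' =
     tensor_lift tscale (\<lambda>c d. tensor_lift tscale (\<lambda>a b. \<lbrace>a, b, c\<rbrace> \<otimes> d - \<lbrace>a, b, d\<rbrace> \<otimes> c) w) w'"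

definition ubracket :: "'v \<times> 'w \<Rightarrow> 'v \<times> 'w \<Rightarrow> 'v \<times> 'w" where
  "ubracket x y = (case (x, y) of ((a, w), (b, w')) \<Rightarrow>
     (bracket_TT_T w b + bracket_T_TT a w', a \<otimes> b + bracket_TT_TT w w'))"

lemma triple_linear:
  "Vector_Spaces.linear scale scale (\<lambda>x. \<lbrace>x, y, z\<rbrace>)"
  "Vector_Spaces.linear scale scale (\<lambda>y. \<lbrace>x, y, z\<rbrace>)"
  "Vector_Spaces.linear scale scale (\<lambda>z. \<lbrace>x, y, z\<rbrace>)"
  using trilinear unfolding trilinear_op_def by blast+

lemma tensor_linear:
  "Vector_Spaces.linear scale tscale (\<lambda>a. a \<otimes> b)" "Vector_Spaces.linear scale tscale (\<lambda>b. a \<otimes> b)"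
  using tensor_bilinear unfolding bilinear_map_def by blast+

lemma bilinear_TT_T: "bilinear_map tscale scale scale bracket_TT_T"
  and bilinear_T_TT: "bilinear_map scale tscale scale bracket_T_TT"
  and bilinear_TT_TT: "bilinear_map tscale tscale tscale bracket_TT_TT"
  and bracket_TT_T_tensor: "bracket_TT_T (a \<otimes> b) c = \<lbrace>a, b, c\<rbrace>"
  and bracket_T_TT_tensor: "bracket_T_TT a (b \<otimes> c) = \<lbrace>a, b, c\<rbrace> - \<lbrace>a, c, b\<rbrace>"
  and bracket_TT_TT_tensor:
    "bracket_TT_TT (a \<otimes> b) (c \<otimes> d) = \<lbrace>a, b, c\<rbrace> \<otimes> d - \<lbrace>a, b, d\<rbrace> \<otimes> c"
proof -
  interpret p: vector_space_pair scale scale ..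
  interpret q: vector_space_pair scale tscale ..
  have V: "vector_space scale" and W: "vector_space tscale" by unfold_locales
  note tl = triple_linear tensor_linear
  have 1: "bilinear_map scale scale scale (\<lambda>a b. \<lbrace>a, b, c\<rbrace>)" for c
    unfolding bilinear_map_def using tl by blast
  have 2: "bilinear_map scale scale scale (\<lambda>b c. \<lbrace>a, b, c\<rbrace> - \<lbrace>a, c, b\<rbrace>)" for a
    unfolding bilinear_map_def by (intro conjI allI p.linear_compose_sub tl)
  have tt: "Vector_Spaces.linear scale tscale (\<lambda>x. \<lbrace>x, y, z\<rbrace> \<otimes> d)"
    "Vector_Spaces.linear scale tscale (\<lambda>x. \<lbrace>y, x, z\<rbrace> \<otimes> d)"
    "Vector_Spaces.linear scale tscale (\<lambda>x. \<lbrace>y, z, x\<rbrace> \<otimes> d)" for y z d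
    using triple_linear[THEN Vector_Spaces.linear_compose, OF tensor_linear(1)[of d]]
    by (simp_all add: o_def)
  have 3: "bilinear_map scale scale tscale (\<lambda>a b. \<lbrace>a, b, c\<rbrace> \<otimes> d - \<lbrace>a, b, d\<rbrace> \<otimes> c)" for c d
    unfolding bilinear_map_def by (intro conjI allI q.linear_compose_sub tl tt)
  have 4: "bilinear_map scale scale tscale
      (\<lambda>c d. tensor_lift tscale (\<lambda>a b. \<lbrace>a, b, c\<rbrace> \<otimes> d - \<lbrace>a, b, d\<rbrace> \<otimes> c) w)" for w
    unfolding bilinear_map_def
    by (intro conjI allI linear_tensor_lift_param V W 3 q.linear_compose_sub tl tt)
  show "bilinear_map tscale scale scale bracket_TT_T"
    unfolding bilinear_map_def bracket_TT_T_def
    by (intro conjI allI linear_tensor_lift_param linear_tensor_lift V W 1 tl)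
  show "bilinear_map scale tscale scale bracket_T_TT"
    unfolding bilinear_map_def bracket_T_TT_def
    by (intro conjI allI linear_tensor_lift_param linear_tensor_lift V W 2 p.linear_compose_sub tl)
  show "bilinear_map tscale tscale tscale bracket_TT_TT"
    unfolding bilinear_map_def bracket_TT_TT_def
    by (intro conjI allI linear_tensor_lift[OF W 4]
        linear_tensor_lift_param[OF W W 4 linear_tensor_lift[OF W 3]])
  show "bracket_TT_T (a \<otimes> b) c = \<lbrace>a, b, c\<rbrace>"
    unfolding bracket_TT_T_def by (rule tensor_lift_tensor[OF V 1])
  show "bracket_T_TT a (b \<otimes> c) = \<lbrace>a, b, c\<rbrace> - \<lbrace>a, c, b\<rbrace>"
    unfolding bracket_T_TT_def by (rule tensor_lift_tensor[OF V 2])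
  show "bracket_TT_TT (a \<otimes> b) (c \<otimes> d) = \<lbrace>a, b, c\<rbrace> \<otimes> d - \<lbrace>a, b, d\<rbrace> \<otimes> c"
    unfolding bracket_TT_TT_def tensor_lift_tensor[OF W 4] by (rule tensor_lift_tensor[OF W 3])
qed

lemma bilinear_zero:
  assumes "bilinear_map sA sB sC f" shows "f 0 y = 0" "f x 0 = 0"
proof -
  interpret l: Vector_Spaces.linear sB sC "\<lambda>y. f x y"
    using assms unfolding bilinear_map_def by blast
  interpret r: Vector_Spaces.linear sA sC "\<lambda>x. f x y"
    using assms unfolding bilinear_map_def by blast
  show "f 0 y = 0" "f x 0 = 0" by (rule r.zero, rule l.zero)
qed

lemma bilinear_add_scale:
  assumes "bilinear_map sA sB sC f"
  shows "f (x + x') y = f x y + f x' y" "f x (y + y') = f x y + f x y'"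
    "f (sA r x) y = sC r (f x y)" "f x (sB r y) = sC r (f x y)"
proof -
  interpret l: Vector_Spaces.linear sB sC "\<lambda>y. f x y"
    using assms unfolding bilinear_map_def by blast
  interpret r: Vector_Spaces.linear sA sC "\<lambda>x. f x y"
    using assms unfolding bilinear_map_def by blast
  show "f (x + x') y = f x y + f x' y" "f x (y + y') = f x y + f x y'"
    "f (sA r x) y = sC r (f x y)" "f x (sB r y) = sC r (f x y)"
    by (rule r.add, rule l.add, rule r.scale, rule l.scale)
qed

lemma triple_zero: "\<lbrace>0, b, c\<rbrace> = 0" "\<lbrace>a, 0, c\<rbrace> = 0" "\<lbrace>a, b, 0\<rbrace> = 0"
  using triple_linear[THEN module_hom.zero[OF module_hom_iff_linear[THEN iffD2]]] by blast+

lemmas bracket_zero = triple_zero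
  bilinear_zero[OF bilinear_TT_T] bilinear_zero[OF bilinear_T_TT]
  bilinear_zero[OF bilinear_TT_TT] bilinear_zero[OF tensor_bilinear]

lemma ubracket_simps:
  "ubracket (inT a) (inT b) = inTT (a \<otimes> b)"
  "ubracket (inTT (a \<otimes> b)) (inT c) = inT \<lbrace>a, b, c\<rbrace>"
  "ubracket (inT a) (inTT (b \<otimes> c)) = inT (\<lbrace>a, b, c\<rbrace> - \<lbrace>a, c, b\<rbrace>)"
  "ubracket (inTT (a \<otimes> b)) (inTT (c \<otimes> d)) = inTT (\<lbrace>a, b, c\<rbrace> \<otimes> d - \<lbrace>a, b, d\<rbrace> \<otimes> c)"
  by (simp_all add: ubracket_def inT_def inTT_def bracket_zero bracket_TT_T_tensor
      bracket_T_TT_tensor bracket_TT_TT_tensor)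

sublocale U: bracket_algebra uscale ubracket
proof -
  interpret P: vector_space_prod scale tscale ..
  interpret UU: vector_space_pair uscale uscale
    unfolding uscale_def ..
  note ba = bilinear_add_scale[OF bilinear_TT_T] bilinear_add_scale[OF bilinear_T_TT]
    bilinear_add_scale[OF bilinear_TT_TT] bilinear_add_scale[OF tensor_bilinear]
  show "bracket_algebra uscale ubracket"
  proof (unfold_locales, unfold bilinear_map_def, intro conjI allI)
    fix x show "Vector_Spaces.linear uscale uscale (\<lambda>y. ubracket x y)"
      by unfold_locales
        (auto simp: ubracket_def uscale_def P.scale_def ba algebra_simps
          scale_right_distrib W.scale_right_distrib split: prod.splits)
  next
    fix y show "Vector_Spaces.linear uscale uscale (\<lambda>x. ubracket x y)"
      by unfold_locales
        (auto simp: ubracket_def uscale_def P.scale_def ba algebra_simps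
          scale_right_distrib W.scale_right_distrib split: prod.splits)
  qed
qed

text \<open>\<open>i(I)\<close>, \<open>j(I)\<close> and \<open>K(T)\<close> are subsets of \<open>T \<otimes> T\<close>, the two envelopes subsets of \<open>U(T)\<close>.\<close>

definition i_ideal :: "'v set \<Rightarrow> 'w set" where
  "i_ideal I = tensor_prod I UNIV + tensor_prod UNIV I"

definition j_ideal :: "'v set \<Rightarrow> 'w set" where
  "j_ideal I = {w. U.bracket_prod {inTT w} (range inT) + U.bracket_prod (range inT) {inTT w}
     \<subseteq> inT ` I}"

definition I_envelope :: "'v set \<Rightarrow> ('v \<times> 'w) set" where
  "I_envelope I = inT ` I + inTT ` i_ideal I"

definition J_envelope :: "'v set \<Rightarrow> ('v \<times> 'w) set" where
  "J_envelope I = inT ` I + inTT ` j_ideal I"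

definition K_kernel :: "'w set" where
  "K_kernel = {w. \<forall>a. ubracket (inTT w) (inT a) = 0 \<and> ubracket (inT a) (inTT w) = 0}"

end

end

theory Submission
  imports Defs "Jordan_Normal_Form.Jordan_Normal_Form_Existence" "HOL-Algebra.Algebraic_Closure_Type"
begin

text \<open>
  Write \<open>R\<close> for the radical of \<open>T\<close> and \<open>J = R + j(R)\<close>.  The bracket of \<open>U(T)\<close> satisfies the
  Leibniz identity modulo \<open>K(T)\<close>.  The derived series of \<open>J\<close> is controlled by that of \<open>R\<close>, so \<open>J\<close> is a
  solvable ideal.  Conversely let \<open>A\<close> be an ideal which is abelian modulo \<open>J\<close>.  If \<open>A\<close> is invariant under the
  automorphism \<open>\<sigma>\<close> that is \<open>-1\<close> on \<open>T\<close> and \<open>1\<close> on \<open>T \<otimes> T\<close>, its odd part is a solvable ideal of \<open>T\<close>, hence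
  \<open>A \<subseteq> J\<close>; in general apply this to \<open>A \<inter> \<sigma> A\<close> and \<open>A + \<sigma> A\<close>.  Thus \<open>J\<close> is the radical of \<open>U(T)\<close>.

  The remaining inclusion \<open>j(R) \<subseteq> i(R) + K(T)\<close> says that the central extension \<open>U(T) / I\<close> of the
  semisimple Lie algebra \<open>U(T) / J\<close>, where \<open>I = R + i(R) + K(T)\<close>, is trivial on brackets.  By Cartan's
  criterion the Killing form of \<open>U(T) / J\<close> is nondegenerate.  With dual bases \<open>e\<^sub>i, d\<^sub>i\<close> the Casimir operator
  \<open>C x = \<Sum>\<^sub>i [[x, e\<^sub>i], d\<^sub>i]\<close> is the identity modulo \<open>J\<close>, commutes with right multiplications modulo \<open>I\<close> and maps
  \<open>J\<close> into \<open>I\<close>.  Hence \<open>C [a, b] \<equiv> [C a, b] \<equiv> [a, b]\<close> modulo \<open>I\<close>, and every \<open>x \<in> J\<close> in the span of the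
  brackets satisfies \<open>x \<equiv> C x \<equiv> 0\<close>.
\<close>

section \<open>Triangularisation\<close>

text \<open>Triviality on brackets is enough because every tensor is a sum of brackets
  \<open>[a, b]\<close> of elements of \<open>T\<close>: all of \<open>j(R)\<close> lies in the span
  of the brackets. Two obstacles shape the proof. With the full tensor square \<open>U(T)\<close> is
  not a Leibniz algebra, so facts about Leibniz or Lie algebras cannot be applied to it as they
  stand; they are proved as congruences modulo \<open>I\<close> or \<open>J\<close>, and this is why
  \<open>K(T)\<close> has to be part of \<open>I\<close>. The Casimir operator does the work of
  Whitehead's second lemma (vanishing of the second cohomology of a semisimple Lie algebra): its
  errors are brackets with \<open>J\<close>, and these fall into \<open>I\<close>. The other
  obstacle is Cartan's criterion over a field that need not be algebraically closed. Nilpotency is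
  detected by a linear form on matrices with values in the algebraic closure, obtained from a Jordan
  form. A linear map from the closure to the rationals plays the role that complex conjugation of
  eigenvalues has in the classical argument.\<close>

lemma invertible_with_first_column:
  fixes v :: "'a::field vec"
  assumes v: "v \<in> carrier_vec (Suc n)" and v0: "v \<noteq> 0\<^sub>v (Suc n)"
  obtains P Q where "P \<in> carrier_mat (Suc n) (Suc n)" "Q \<in> carrier_mat (Suc n) (Suc n)"
    "P * Q = 1\<^sub>m (Suc n)" "Q * P = 1\<^sub>m (Suc n)" "col P 0 = v"
proof -
  obtain k where k: "k < Suc n" "v $ k \<noteq> 0"
    using v v0 by (metis carrier_vecD eq_vecI index_zero_vec)
  \<comment> \<open>The columns after the first are the unit vectors with index other than
    \<open>k\<close>: column \<open>k\<close>, if it is not the first, takes index \<open>0\<close>.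
    Row \<open>k\<close> of a kernel equation then gives \<open>x $ 0 = 0\<close> at once.\<close>
  define e where "e j = (if j = k then 0 else j)" for j
  define P where "P = mat (Suc n) (Suc n) (\<lambda>(i, j). if j = 0 then v $ i else if i = e j then 1 else 0)"
  have P: "P \<in> carrier_mat (Suc n) (Suc n)" by (simp add: P_def)
  have "det P \<noteq> 0"
  proof
    assume "det P = 0"
    then obtain x where x: "x \<in> carrier_vec (Suc n)" "x \<noteq> 0\<^sub>v (Suc n)" "P *\<^sub>v x = 0\<^sub>v (Suc n)"
      using det_0_iff_vec_prod_zero_field[OF P] by blast
    have eq: "(\<Sum>j<Suc n. (if j = 0 then v $ i else if i = e j then 1 else 0) * x $ j) = 0"
      if "i < Suc n" for i
      using arg_cong[OF x(3), of "\<lambda>w::'a vec. w $ i"] that x(1) P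
      by (simp add: P_def scalar_prod_def atLeast0LessThan)
    have "(\<Sum>j<Suc n. (if j = 0 then v $ k else if k = e j then 1 else 0) * x $ j)
        = (\<Sum>j<Suc n. if j = 0 then v $ k * x $ 0 else 0)"
      by (rule sum.cong) (auto simp: e_def)
    also have "\<dots> = v $ k * x $ 0" by (subst sum.delta) auto
    finally have x0: "x $ 0 = 0" using eq[OF k(1)] k(2) by simp
    have "x $ j = 0" if j: "j < Suc n" for j
    proof (cases "j = 0")
      case False
      have ej: "e j < Suc n" using j by (simp add: e_def)
      have "(\<Sum>l<Suc n. (if l = 0 then v $ (e j) else if e j = e l then 1 else 0) * x $ l)
        = (\<Sum>l<Suc n. if l = j then x $ j else 0)"
        using False x0 by (intro sum.cong) (auto simp: e_def split: if_splits)
      also have "\<dots> = x $ j" using j by (subst sum.delta) auto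
      finally show ?thesis using eq[OF ej] by simp
    qed (use x0 in simp)
    then show False using x by (metis carrier_vecD eq_vecI index_zero_vec)
  qed
  from det_non_zero_imp_unit[OF P this, of "()"] obtain Q where
    "Q \<in> carrier_mat (Suc n) (Suc n)" "P * Q = 1\<^sub>m (Suc n)" "Q * P = 1\<^sub>m (Suc n)"
    unfolding Units_def by (auto simp: ring_mat_def)
  moreover have "col P 0 = v"
    using v by (intro eq_vecI) (auto simp: P_def)
  ultimately show thesis using that P by blast
qed

text \<open>Deflation: an eigenvector as first column of the change of basis leaves a block of size
  \<open>n\<close> for the induction hypothesis. Algebraic closedness supplies the
  eigenvalue.\<close>

lemma similar_upper_triangular:
  fixes A :: "'a::alg_closed_field mat"
  assumes "A \<in> carrier_mat n n"
  shows "\<exists>B \<in> carrier_mat n n. upper_triangular B \<and> similar_mat A B"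
  using assms
proof (induction n arbitrary: A)
  case 0
  then show ?case using similar_mat_refl by (intro bexI[of _ A]) auto
next
  case (Suc n)
  note A = Suc.prems
  have "Polynomial.degree (char_poly A) > 0" using degree_monic_char_poly[OF A] by simp
  then obtain e where e: "poly (char_poly A) e = 0" using alg_closed_imp_poly_has_root by blast
  then obtain v where v: "eigenvector A v e"
    using eigenvalue_root_char_poly[OF A] unfolding eigenvalue_def by blast
  then have vc: "v \<in> carrier_vec (Suc n)" "v \<noteq> 0\<^sub>v (Suc n)" "A *\<^sub>v v = e \<cdot>\<^sub>v v"
    using A unfolding eigenvector_def by auto
  obtain P Q where PQ: "P \<in> carrier_mat (Suc n) (Suc n)" "Q \<in> carrier_mat (Suc n) (Suc n)"
    "P * Q = 1\<^sub>m (Suc n)" "Q * P = 1\<^sub>m (Suc n)" "col P 0 = v"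
    using invertible_with_first_column[OF vc(1,2)] .
  define A' where "A' = Q * A * P"
  have A': "A' \<in> carrier_mat (Suc n) (Suc n)" using PQ A by (simp add: A'_def)
  have "P * A' * Q = P * Q * A * (P * Q)"
    unfolding A'_def using PQ(1,2) A by (simp add: assoc_mult_mat[of _ "Suc n" "Suc n" _ "Suc n" _ "Suc n"])
  then have AA': "A = P * A' * Q" using PQ A by simp
  have sim: "similar_mat A A'"
    by (rule similar_matI[of _ _ P Q "Suc n"]) (use PQ A A' AA' in auto)
  have "col A' 0 = Q *\<^sub>v (A *\<^sub>v col P 0)"
    unfolding A'_def using PQ(1,2) A
    by (metis assoc_mult_mat_vec col_carrier_vec col_mult2 mult_carrier_mat zero_less_Suc)
  also have "\<dots> = e \<cdot>\<^sub>v (Q *\<^sub>v col P 0)" using PQ vc by (simp add: mult_mat_vec)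
  also have "Q *\<^sub>v col P 0 = col (Q * P) 0" using PQ by (metis col_mult2 zero_less_Suc)
  finally have col0: "col A' 0 = e \<cdot>\<^sub>v unit_vec (Suc n) 0" using PQ by simp
  have c0: "A' $$ (i, 0) = (if i = 0 then e else 0)" if "i < Suc n" for i
    using arg_cong[OF col0, of "\<lambda>w::'a vec. w $ i"] that A' by (simp add: col_def)
  define A1 where "A1 = mat 1 1 (\<lambda>_. e)"
  define A2 where "A2 = mat 1 n (\<lambda>(i, j). A' $$ (0, Suc j))"
  define A3 where "A3 = mat n n (\<lambda>(i, j). A' $$ (Suc i, Suc j))"
  have car: "A1 \<in> carrier_mat 1 1" "A2 \<in> carrier_mat 1 n" "A3 \<in> carrier_mat n n"
    by (simp_all add: A1_def A2_def A3_def)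
  have block: "A' = four_block_mat A1 A2 (0\<^sub>m n 1) A3"
    by (rule eq_matI) (use A' c0 in \<open>auto simp: A1_def A2_def A3_def four_block_mat_def Let_def\<close>)
  obtain B where B: "B \<in> carrier_mat n n" "upper_triangular B" "similar_mat A3 B"
    using Suc.IH[OF car(3)] by blast
  then obtain P' Q' where w: "similar_mat_wit A3 B P' Q'" unfolding similar_mat_def by blast
  have w': "P' \<in> carrier_mat n n" "Q' \<in> carrier_mat n n" "P' * Q' = 1\<^sub>m n"
    using similar_mat_witD2[OF car(3) w] by auto
  \<comment> \<open>The upper right block after conjugation by \<open>diag(1, P')\<close>.\<close>
  define U where "U = A2 * P'"
  have U: "U \<in> carrier_mat 1 n" using w' car by (simp add: U_def)
  have "similar_mat_wit (four_block_mat A1 A2 (0\<^sub>m n 1) A3) (four_block_mat A1 U (0\<^sub>m n 1) B)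
    (four_block_mat (1\<^sub>m 1) (0\<^sub>m 1 n) (0\<^sub>m n 1) P') (four_block_mat (1\<^sub>m 1) (0\<^sub>m 1 n) (0\<^sub>m n 1) Q')"
  proof (rule similar_mat_wit_four_block[OF similar_mat_wit_refl[OF car(1)] w])
    have "A2 * (P' * Q') = A2 * P' * Q'"
      using w' car by (metis assoc_mult_mat)
    then show "A2 = 1\<^sub>m 1 * U * Q'"
      using w' car U by (simp add: U_def)
    show "0\<^sub>m n 1 = P' * 0\<^sub>m n 1 * 1\<^sub>m 1" using w' by simp
  qed (use car U in auto)
  then have "similar_mat A' (four_block_mat A1 U (0\<^sub>m n 1) B)"
    unfolding similar_mat_def block by blast
  moreover have "upper_triangular (four_block_mat A1 U (0\<^sub>m n 1) B)"
    by (rule upper_triangular_four_block) (use car B in \<open>auto simp: A1_def\<close>)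
  moreover have "four_block_mat A1 U (0\<^sub>m n 1) B \<in> carrier_mat (Suc n) (Suc n)"
    using car B by (metis One_nat_def add.commute four_block_carrier_mat plus_1_eq_Suc)
  ultimately show ?case using similar_mat_trans[OF sim] by blast
qed

text \<open>A nonzero entry lies inside one Jordan block, where the diagonal is constant. In this
  form the fact says that the diagonal part commutes with the whole matrix.\<close>

lemma jordan_matrix_diag_eq:
  assumes "i < sum_list (map fst n_as)" "j < sum_list (map fst n_as)"
    "jordan_matrix n_as $$ (i, j) \<noteq> (0::'a::field)"
  shows "jordan_matrix n_as $$ (i, i) = jordan_matrix n_as $$ (j, j)"
  using assms
proof (induction n_as arbitrary: i j)
  case (Cons na n_as)
  obtain n a where na: "na = (n, a)" by force
  show ?case
    using Cons.prems Cons.IH[of "i - n" "j - n"]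
    unfolding na jordan_matrix_Cons by (auto split: if_splits)
qed simp

lemma similar_jordan_matrix:
  fixes A :: "'a::alg_closed_field mat"
  assumes A: "A \<in> carrier_mat n n"
  obtains J P Q where "similar_mat_wit A J P Q" "J \<in> carrier_mat n n" "upper_triangular J"
    "\<And>i j. i < n \<Longrightarrow> j < n \<Longrightarrow> J $$ (i, j) \<noteq> 0 \<Longrightarrow> J $$ (i, i) = J $$ (j, j)"
proof -
  obtain B where B: "B \<in> carrier_mat n n" "upper_triangular B" "similar_mat A B"
    using similar_upper_triangular[OF A] by blast
  define n_as where "n_as = triangular_to_jnf_vector B"
  have "jordan_nf B n_as" unfolding n_as_def by (rule triangular_to_jnf_vector[OF B(1,2)])
  then have sim: "similar_mat A (jordan_matrix n_as)"
    using similar_mat_trans[OF B(3)] unfolding jordan_nf_def by blast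
  then obtain P Q where w: "similar_mat_wit A (jordan_matrix n_as) P Q"
    unfolding similar_mat_def by blast
  then have c: "jordan_matrix n_as \<in> carrier_mat n n" using similar_mat_witD2[OF A] by blast
  then have n: "n = sum_list (map fst n_as)" by (metis carrier_matD(1) jordan_matrix_dim(1))
  show thesis
  proof (rule that[OF w c])
    show "upper_triangular (jordan_matrix n_as)"
      by (rule upper_triangularI) (simp add: jordan_matrix_upper_triangular)
  qed (use jordan_matrix_diag_eq n in blast)
qed

section \<open>Interpolation and a sequence functional\<close>

text \<open>\<open>s\<close> inverts \<open>g\<close> modulo a power of \<open>X - \<nu>\<close>:
  after normalising \<open>g\<close> to the value 1 at \<open>\<nu>\<close>,
  \<open>h = 1 - g'\<close> vanishes there, and a truncated geometric series in \<open>h\<close>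
  gives the inverse.\<close>

lemma local_unit:
  fixes g :: "'a::field poly"
  assumes "poly g \<nu> \<noteq> 0"
  obtains s where "[:- \<nu>, 1:] ^ r dvd 1 - s * g"
proof -
  define g' where "g' = Polynomial.smult (inverse (poly g \<nu>)) g"
  define h where "h = 1 - g'"
  have "poly h \<nu> = 0" using assms by (simp add: h_def g'_def)
  then have "[:- \<nu>, 1:] ^ r dvd h ^ r" by (simp add: poly_eq_0_iff_dvd dvd_power_same)
  moreover have "1 - h ^ r = (1 - h) * (\<Sum>i<r. h ^ i)" by (rule one_diff_power_eq)
  then have "1 - h ^ r = Polynomial.smult (inverse (poly g \<nu>)) (\<Sum>i<r. h ^ i) * g"
    by (simp add: h_def g'_def mult.commute)
  then have "h ^ r = 1 - Polynomial.smult (inverse (poly g \<nu>)) (\<Sum>i<r. h ^ i) * g"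
    by (metis diff_eq_eq diff_add_cancel add.commute)
  ultimately show thesis using that by metis
qed

text \<open>Chinese remainders for the coprime powers \<open>(X - \<mu>) ^ r\<close>. The correction
  is a multiple of \<open>g\<close>, which vanishes to order \<open>r\<close> at the old nodes, and
  \<open>s * g\<close> is congruent to 1 at the new one.\<close>

lemma hermite_interpolation:
  fixes c :: "'a::field \<Rightarrow> 'a"
  assumes "finite M"
  shows "\<exists>q. \<forall>\<mu>\<in>M. [:- \<mu>, 1:] ^ r dvd q - [:c \<mu>:]"
  using assms
proof (induction M)
  case (insert \<nu> M)
  then obtain q where q: "\<forall>\<mu>\<in>M. [:- \<mu>, 1:] ^ r dvd q - [:c \<mu>:]" by blast
  define g where "g = (\<Prod>\<mu>\<in>M. [:- \<mu>, 1:] ^ r)"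
  have "poly g \<nu> \<noteq> 0" using insert by (auto simp: g_def poly_prod)
  then obtain s where s: "[:- \<nu>, 1:] ^ r dvd 1 - s * g" using local_unit by blast
  define q' where "q' = q + ([:c \<nu>:] - q) * s * g"
  have "[:- \<nu>, 1:] ^ r dvd q' - [:c \<nu>:]"
  proof -
    have "q' - [:c \<nu>:] = (q - [:c \<nu>:]) * (1 - s * g)" by (simp add: q'_def algebra_simps)
    then show ?thesis using s by simp
  qed
  moreover have "[:- \<mu>, 1:] ^ r dvd q' - [:c \<mu>:]" if "\<mu> \<in> M" for \<mu>
  proof -
    have "[:- \<mu>, 1:] ^ r dvd g" unfolding g_def using insert(1) that by (rule dvd_prodI)
    then have "[:- \<mu>, 1:] ^ r dvd (q - [:c \<mu>:]) + ([:c \<nu>:] - q) * s * g"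
      using q that by (intro dvd_add) auto
    then show ?thesis by (simp add: q'_def algebra_simps)
  qed
  ultimately show ?case by blast
qed simp

text \<open>The linear form sending \<open>X^k\<close> to \<open>s k\<close>. With
  \<open>s k\<close> the trace of \<open>ad^k a\<close> times \<open>b\<close>, it stands for the
  trace of \<open>q(ad) a\<close> times \<open>b\<close>, without forming polynomials in an
  operator.\<close>

definition seq_functional :: "(nat \<Rightarrow> 'a::field) \<Rightarrow> 'a poly \<Rightarrow> 'a" where
  "seq_functional s q = (\<Sum>k\<le>Polynomial.degree q. Polynomial.coeff q k * s k)"

lemma seq_functional_eq:
  assumes "Polynomial.degree q \<le> N"
  shows "seq_functional s q = (\<Sum>k\<le>N. Polynomial.coeff q k * s k)"
  unfolding seq_functional_def
  by (rule sum.mono_neutral_left) (use assms in \<open>auto simp: Polynomial.coeff_eq_0 not_le\<close>)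

lemma seq_functional_add: "seq_functional s (p + q) = seq_functional s p + seq_functional s q"
proof -
  define N where "N = max (Polynomial.degree p) (Polynomial.degree q)"
  have "Polynomial.degree (p + q) \<le> N" "Polynomial.degree p \<le> N" "Polynomial.degree q \<le> N"
    using Polynomial.degree_add_le_max[of p q] by (auto simp: N_def)
  then show ?thesis
    by (simp add: seq_functional_eq[of _ N] sum.distrib algebra_simps)
qed

text \<open>Multiplication by \<open>X\<close> shifts the sequence, so a factor
  \<open>X - \<mu>\<close> can be traded for one application of \<open>ad J - \<mu>\<close>.\<close>

lemma seq_functional_linear_factor:
  "seq_functional s ([:- \<mu>, 1:] * q) = seq_functional (\<lambda>k. s (Suc k) - \<mu> * s k) q"
proof -
  define N where "N = Polynomial.degree q"
  have c0: "Polynomial.coeff q (Suc N) = 0" by (simp add: N_def Polynomial.coeff_eq_0)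
  have d: "Polynomial.degree ([:- \<mu>, 1:] * q) \<le> Suc N"
    using degree_mult_le[of "[:- \<mu>, 1:]" q] by (simp add: N_def)
  have "seq_functional s ([:- \<mu>, 1:] * q)
      = (\<Sum>k\<le>Suc N. Polynomial.coeff (pCons 0 q) k * s k - \<mu> * (Polynomial.coeff q k * s k))"
    unfolding seq_functional_eq[OF d] by (rule sum.cong) (auto simp: algebra_simps)
  also have "\<dots> = (\<Sum>k\<le>Suc N. Polynomial.coeff (pCons 0 q) k * s k)
      - \<mu> * (\<Sum>k\<le>Suc N. Polynomial.coeff q k * s k)"
    by (simp only: sum_subtractf sum_distrib_left)
  also have "(\<Sum>k\<le>Suc N. Polynomial.coeff (pCons 0 q) k * s k)
      = (\<Sum>k\<le>N. Polynomial.coeff q k * s (Suc k))"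
    unfolding sum.atMost_Suc_shift by simp
  also have "(\<Sum>k\<le>Suc N. Polynomial.coeff q k * s k) = (\<Sum>k\<le>N. Polynomial.coeff q k * s k)"
    using c0 by simp
  finally show ?thesis
    by (simp add: seq_functional_eq[of q N] N_def sum_subtractf sum_distrib_left algebra_simps)
qed

section \<open>A rational functional\<close>

text \<open>The field is a vector space over the rationals, and a nonzero \<open>c\<close> extends
  to a basis. Sums of squares of rational values are positive, which has no meaning in the field
  itself.\<close>

lemma rational_functional:
  fixes c :: "'a::field_char_0"
  assumes "c \<noteq> 0"
  obtains \<phi> :: "'a \<Rightarrow> rat" where "\<And>x y. \<phi> (x + y) = \<phi> x + \<phi> y"
    "\<And>q x. \<phi> (of_rat q * x) = q * \<phi> x" "\<phi> c \<noteq> 0"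
proof -
  interpret F: vector_space "\<lambda>q (x::'a). of_rat q * x"
    by unfold_locales (auto simp: algebra_simps of_rat_add of_rat_mult)
  interpret p: vector_space_pair "\<lambda>q (x::'a). of_rat q * x" "(*) :: rat \<Rightarrow> rat \<Rightarrow> rat"
    by unfold_locales (auto simp: algebra_simps)
  have "F.independent {c}" using assms by (simp add: F.dependent_single)
  then obtain g where g: "Vector_Spaces.linear (\<lambda>q (x::'a). of_rat q * x) (*) g" "g c = 1"
    using p.linear_independent_extend[of "{c}" "\<lambda>_. 1"] by auto
  interpret g: Vector_Spaces.linear "\<lambda>q (x::'a). of_rat q * x" "(*)" g by (fact g(1))
  show thesis by (rule that[of g]) (use g.add g.scale g(2) in auto)
qed

section \<open>The adjoint action of a Jordan matrix\<close>

text \<open>Matrices are plain index functions here, so that weight components can be cut out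
  entrywise; only indices below \<open>n\<close> matter, whence
  \<open>comm_fun_cong\<close>.\<close>

definition comm_fun :: "nat \<Rightarrow> (nat \<Rightarrow> nat \<Rightarrow> 'a::comm_ring) \<Rightarrow> (nat \<Rightarrow> nat \<Rightarrow> 'a) \<Rightarrow> nat \<Rightarrow> nat \<Rightarrow> 'a" where
  "comm_fun n J a = (\<lambda>i j. \<Sum>k<n. J i k * a k j - a i k * J k j)"

definition trace_pair :: "nat \<Rightarrow> (nat \<Rightarrow> nat \<Rightarrow> 'a::comm_ring) \<Rightarrow> (nat \<Rightarrow> nat \<Rightarrow> 'a) \<Rightarrow> 'a" where
  "trace_pair n a b = (\<Sum>i<n. \<Sum>k<n. a i k * b k i)"

lemma comm_fun_sum:
  "comm_fun n J (\<lambda>i j. \<Sum>\<mu>\<in>M. a \<mu> i j) = (\<lambda>i j. \<Sum>\<mu>\<in>M. comm_fun n J (a \<mu>) i j)"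
proof (intro ext)
  fix i j
  have "comm_fun n J (\<lambda>i j. \<Sum>\<mu>\<in>M. a \<mu> i j) i j
      = (\<Sum>k<n. \<Sum>\<mu>\<in>M. J i k * a \<mu> k j - a \<mu> i k * J k j)"
    by (simp add: comm_fun_def sum_distrib_left sum_distrib_right sum_subtractf)
  also have "\<dots> = (\<Sum>\<mu>\<in>M. comm_fun n J (a \<mu>) i j)"
    unfolding comm_fun_def by (rule sum.swap)
  finally show "comm_fun n J (\<lambda>i j. \<Sum>\<mu>\<in>M. a \<mu> i j) i j = (\<Sum>\<mu>\<in>M. comm_fun n J (a \<mu>) i j)" .
qed

lemma comm_fun_pow_sum:
  "(comm_fun n J ^^ k) (\<lambda>i j. \<Sum>\<mu>\<in>M. a \<mu> i j) = (\<lambda>i j. \<Sum>\<mu>\<in>M. (comm_fun n J ^^ k) (a \<mu>) i j)"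
  by (induction k) (simp_all add: comm_fun_sum)

lemma comm_fun_diff:
  "comm_fun n J (\<lambda>i j. a i j - \<mu> * b i j) = (\<lambda>i j. comm_fun n J a i j - \<mu> * comm_fun n J b i j)"
proof (intro ext)
  fix i j
  have "comm_fun n J (\<lambda>i j. a i j - \<mu> * b i j) i j
      = (\<Sum>k<n. (J i k * a k j - a i k * J k j) - \<mu> * (J i k * b k j - b i k * J k j))"
    unfolding comm_fun_def by (rule sum.cong) (auto simp: algebra_simps)
  then show "comm_fun n J (\<lambda>i j. a i j - \<mu> * b i j) i j = comm_fun n J a i j - \<mu> * comm_fun n J b i j"
    unfolding comm_fun_def by (subst (asm) (2) sum_subtractf) (simp only: sum_distrib_left)
qed

lemma comm_fun_pow_diff:
  "(comm_fun n J ^^ k) (\<lambda>i j. a i j - \<mu> * b i j)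
    = (\<lambda>i j. (comm_fun n J ^^ k) a i j - \<mu> * (comm_fun n J ^^ k) b i j)"
  by (induction k) (simp_all add: comm_fun_diff)

lemma comm_fun_cong:
  assumes "\<And>i j. i < n \<Longrightarrow> j < n \<Longrightarrow> a i j = b i j" "i < n" "j < n"
  shows "(comm_fun n J ^^ k) a i j = (comm_fun n J ^^ k) b i j"
  using assms(2,3)
proof (induction k arbitrary: i j)
  case (Suc k)
  then show ?case by (auto simp: comm_fun_def intro!: sum.cong)
qed (use assms(1) in simp)

lemma trace_pair_cong:
  assumes "\<And>i j. i < n \<Longrightarrow> j < n \<Longrightarrow> a i j = b i j"
  shows "trace_pair n a c = trace_pair n b c"
  unfolding trace_pair_def by (intro sum.cong) (auto simp: assms)

lemma trace_pair_sum: "trace_pair n (\<lambda>i j. \<Sum>\<mu>\<in>M. a \<mu> i j) b = (\<Sum>\<mu>\<in>M. trace_pair n (a \<mu>) b)"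
proof -
  have "trace_pair n (\<lambda>i j. \<Sum>\<mu>\<in>M. a \<mu> i j) b = (\<Sum>i<n. \<Sum>\<mu>\<in>M. \<Sum>k<n. a \<mu> i k * b k i)"
    unfolding trace_pair_def sum_distrib_right by (intro sum.cong refl) (rule sum.swap)
  also have "\<dots> = (\<Sum>\<mu>\<in>M. trace_pair n (a \<mu>) b)"
    unfolding trace_pair_def by (rule sum.swap)
  finally show ?thesis .
qed

lemma trace_pair_diff:
  "trace_pair n (\<lambda>i j. a i j - \<mu> * c i j) b = trace_pair n a b - \<mu> * trace_pair n c b"
  by (simp add: trace_pair_def sum_subtractf algebra_simps sum_distrib_left)

locale jordan_fun =
  fixes n :: nat and J :: "nat \<Rightarrow> nat \<Rightarrow> 'a::field_char_0"
  assumes upper: "i < n \<Longrightarrow> j < i \<Longrightarrow> J i j = 0"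
    and diag_eq: "i < n \<Longrightarrow> j < n \<Longrightarrow> J i j \<noteq> 0 \<Longrightarrow> J i i = J j j"
begin

text \<open>The operator \<open>ad J - \<mu>\<close> preserves the \<open>\<mu>\<close>-weight space of the diagonal part of \<open>J\<close> and
  raises \<open>c\<close>; nothing is left at \<open>c = 2 n\<close>.\<close>

definition weight :: "'a \<Rightarrow> nat \<Rightarrow> (nat \<Rightarrow> nat \<Rightarrow> 'a) \<Rightarrow> bool" where
  "weight \<mu> c a \<longleftrightarrow> (\<forall>i<n. \<forall>j<n. a i j \<noteq> 0 \<longrightarrow> J i i - J j j = \<mu> \<and> i + c \<le> j + n)"

lemma weight_step:
  assumes a: "weight \<mu> c a"
  shows "weight \<mu> (Suc c) (\<lambda>i j. comm_fun n J a i j - \<mu> * a i j)"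
  unfolding weight_def
proof (intro allI impI, rule ccontr)
  fix i j assume ij: "i < n" "j < n" and ne: "comm_fun n J a i j - \<mu> * a i j \<noteq> 0"
    and neg: "\<not> (J i i - J j j = \<mu> \<and> i + Suc c \<le> j + n)"
  have split: "comm_fun n J a i j - \<mu> * a i j
      = (\<Sum>k<n. J i k * a k j) - (\<Sum>k<n. a i k * J k j) - \<mu> * a i j"
    by (simp add: comm_fun_def sum_subtractf)
  have w: "J i' i' - J j' j' = \<mu>" "i' + c \<le> j' + n" if "i' < n" "j' < n" "a i' j' \<noteq> 0" for i' j'
    using a that unfolding weight_def by blast+
  show False
  proof (cases "J i i - J j j = \<mu>")
    case False
    \<comment> \<open>Diagonal entries of \<open>J\<close> agree along its nonzero entries, so a
      nonzero product would give \<open>(i, j)\<close> the weight \<open>\<mu>\<close>.\<close>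
    have A: "J i k * a k j = 0" if "k < n" for k
      using False diag_eq[of i k] w(1)[of k j] ij that
      by (cases "J i k = 0"; cases "a k j = 0") auto
    have B: "a i k * J k j = 0" if "k < n" for k
      using False diag_eq[of k j] w(1)[of i k] ij that
      by (cases "J k j = 0"; cases "a i k = 0") auto
    have "(\<Sum>k<n. J i k * a k j) = 0" by (rule sum.neutral) (use A in blast)
    moreover have "(\<Sum>k<n. a i k * J k j) = 0" by (rule sum.neutral) (use B in blast)
    moreover have "a i j = 0" using False w(1) ij by blast
    ultimately show False using ne unfolding split by simp
  next
    case True
    \<comment> \<open>At this height a term with \<open>J i k\<close> and \<open>k > i\<close> needs
      an entry of \<open>a\<close> outside its band, and one with \<open>k < i\<close> an entry of
      \<open>J\<close> below the diagonal. Only the diagonal of \<open>J\<close> contributes;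
      likewise for the other sum.\<close>
    then have lev: "j + n < i + Suc c" using neg by simp
    have "(\<Sum>k<n. J i k * a k j) = (\<Sum>k<n. if k = i then J i i * a i j else 0)"
    proof (rule sum.cong[OF refl])
      fix k assume "k \<in> {..<n}"
      then show "J i k * a k j = (if k = i then J i i * a i j else 0)"
        using upper[of i k] w(2)[of k j] ij lev by (cases k i rule: linorder_cases) auto
    qed
    moreover have "(\<Sum>k<n. a i k * J k j) = (\<Sum>k<n. if k = j then a i j * J j j else 0)"
    proof (rule sum.cong[OF refl])
      fix k assume "k \<in> {..<n}"
      then show "a i k * J k j = (if k = j then a i j * J j j else 0)"
        using upper[of k j] w(2)[of i k] ij lev by (cases k j rule: linorder_cases) auto
    qed
    ultimately have "comm_fun n J a i j - \<mu> * a i j = (J i i - J j j - \<mu>) * a i j"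
      unfolding split using ij by (simp add: algebra_simps)
    then show False using True ne by simp
  qed
qed

text \<open>Each factor \<open>X - \<mu>\<close> raises \<open>c\<close> by one, and at
  \<open>c = 2 * n\<close> the band is empty.\<close>

lemma weight_functional:
  assumes "weight \<mu> c a"
  shows "seq_functional (\<lambda>k. trace_pair n ((comm_fun n J ^^ k) a) b) ([:- \<mu>, 1:] ^ (2 * n - c) * q) = 0"
  using assms
proof (induction "2 * n - c" arbitrary: a c)
  case 0
  have "a i j = 0" if "i < n" "j < n" for i j
    using 0 that unfolding weight_def by force
  then have "trace_pair n ((comm_fun n J ^^ k) a) b = trace_pair n ((comm_fun n J ^^ k) (\<lambda>_ _. 0)) b" for k
    by (intro trace_pair_cong comm_fun_cong) auto
  moreover have "(comm_fun n J ^^ k) (\<lambda>_ _. 0) = (\<lambda>_ _. 0)" for k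
    by (induction k) (simp_all add: comm_fun_def)
  ultimately show ?case by (simp add: seq_functional_def trace_pair_def)
next
  case (Suc d)
  let ?a = "\<lambda>i j. comm_fun n J a i j - \<mu> * a i j"
  let ?s = "\<lambda>k. trace_pair n ((comm_fun n J ^^ k) a) b"
  have "seq_functional (\<lambda>k. trace_pair n ((comm_fun n J ^^ k) ?a) b)
      ([:- \<mu>, 1:] ^ (2 * n - Suc c) * q) = 0"
    using Suc.hyps(2) by (intro Suc.hyps(1)[OF _ weight_step[OF Suc.prems]]) simp
  also have "(\<lambda>k. trace_pair n ((comm_fun n J ^^ k) ?a) b)
      = (\<lambda>k. ?s (Suc k) - \<mu> * ?s k)"
    by (simp only: comm_fun_pow_diff trace_pair_diff funpow_Suc_right o_apply)
  finally have "seq_functional ?s ([:- \<mu>, 1:] * ([:- \<mu>, 1:] ^ (2 * n - Suc c) * q)) = 0"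
    by (simp only: seq_functional_linear_factor)
  moreover have "2 * n - c = Suc (2 * n - Suc c)" using Suc.hyps(2) by simp
  ultimately show ?case by (simp only: power_Suc mult.assoc)
qed

text \<open>The sum is the trace of \<open>q(ad J) a\<close> times \<open>b\<close> for an
  interpolating \<open>q\<close>: modulo a power of \<open>X - \<mu>\<close> that annihilates the
  \<open>\<mu>\<close>-component, \<open>q\<close> is the constant \<open>c \<mu>\<close>. As
  \<open>c 0 = 0\<close>, \<open>q\<close> has no constant term, so only the traces in
  \<open>tr\<close> occur.\<close>

lemma weighted_trace_zero:
  assumes tr: "\<And>k. k \<ge> 1 \<Longrightarrow> trace_pair n ((comm_fun n J ^^ k) a) b = 0" and c0: "c 0 = 0"
  shows "(\<Sum>i<n. \<Sum>j<n. c (J i i - J j j) * a i j * b j i) = 0"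
proof (cases "n = 0")
  case False
  define M where "M = (\<lambda>(i, j). J i i - J j j) ` ({..<n} \<times> {..<n})"
  have M: "finite M" unfolding M_def by simp
  have inM: "J i i - J j j \<in> M" if "i < n" "j < n" for i j
    unfolding M_def by (rule image_eqI[of _ _ "(i, j)"]) (use that in auto)
  have M0: "0 \<in> M" using inM[of 0 0] False by simp
  \<comment> \<open>The order \<open>2 * n\<close> is what \<open>weight_functional\<close> needs
    for a component starting at \<open>c = 0\<close>.\<close>
  obtain q where q: "\<forall>\<mu>\<in>M. [:- \<mu>, 1:] ^ (2 * n) dvd q - [:c \<mu>:]"
    using hermite_interpolation[OF M] by blast
  define p where "p \<mu> = (\<lambda>i j. if J i i - J j j = \<mu> then a i j else 0)" for \<mu>
  define s where "s \<mu> k = trace_pair n ((comm_fun n J ^^ k) (p \<mu>)) b" for \<mu> k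
  have q0: "Polynomial.coeff q 0 = 0"
  proof -
    have "[:- 0, 1:] ^ (2 * n) dvd q - [:c 0:]" using q M0 by blast
    moreover have "[:0, 1:] dvd [:- 0, 1::'a:] ^ (2 * n)" using False by (simp add: dvd_power)
    ultimately have "[:0, 1:] dvd q" using c0 dvd_trans by fastforce
    then have "poly q 0 = 0" by auto
    then show ?thesis by (simp add: poly_0_coeff_0)
  qed
  have e: "seq_functional (s \<mu>) q = c \<mu> * s \<mu> 0" if \<mu>: "\<mu> \<in> M" for \<mu>
  proof -
    obtain u where u: "q - [:c \<mu>:] = [:- \<mu>, 1:] ^ (2 * n) * u" using q \<mu> by (meson dvdE)
    have "weight \<mu> 0 (p \<mu>)" unfolding weight_def p_def by auto
    from weight_functional[OF this, of b u]
    have "seq_functional (s \<mu>) ([:- \<mu>, 1:] ^ (2 * n) * u) = 0" unfolding s_def by simp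
    moreover have "q = [:- \<mu>, 1:] ^ (2 * n) * u + [:c \<mu>:]" using u by (simp add: algebra_simps)
    ultimately have "seq_functional (s \<mu>) q = seq_functional (s \<mu>) [:c \<mu>:]"
      by (simp add: seq_functional_add)
    then show ?thesis by (simp add: seq_functional_def)
  qed
  have tot: "(\<Sum>\<mu>\<in>M. s \<mu> k) = trace_pair n ((comm_fun n J ^^ k) a) b" for k
  proof -
    have "(\<Sum>\<mu>\<in>M. s \<mu> k) = trace_pair n ((comm_fun n J ^^ k) (\<lambda>i j. \<Sum>\<mu>\<in>M. p \<mu> i j)) b"
      unfolding s_def comm_fun_pow_sum trace_pair_sum ..
    also have "\<dots> = trace_pair n ((comm_fun n J ^^ k) a) b"
    proof (intro trace_pair_cong comm_fun_cong)
      fix i j assume "i < n" "j < n"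
      then show "(\<Sum>\<mu>\<in>M. p \<mu> i j) = a i j" using inM M by (simp add: p_def)
    qed
    finally show ?thesis .
  qed
  have "(\<Sum>\<mu>\<in>M. c \<mu> * s \<mu> 0) = (\<Sum>\<mu>\<in>M. seq_functional (s \<mu>) q)" using e by simp
  also have "\<dots> = (\<Sum>k\<le>Polynomial.degree q. Polynomial.coeff q k * (\<Sum>\<mu>\<in>M. s \<mu> k))"
    unfolding seq_functional_def sum_distrib_left by (rule sum.swap)
  also have "\<dots> = 0"
  proof (intro sum.neutral ballI)
    fix k
    show "Polynomial.coeff q k * (\<Sum>\<mu>\<in>M. s \<mu> k) = 0"
      using q0 tr[of k] unfolding tot by (cases k) auto
  qed
  finally have "0 = (\<Sum>\<mu>\<in>M. c \<mu> * s \<mu> 0)" ..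
  also have "\<dots> = (\<Sum>\<mu>\<in>M. trace_pair n (\<lambda>i j. c \<mu> * p \<mu> i j) b)"
    by (simp add: s_def trace_pair_def sum_distrib_left mult.assoc)
  also have "\<dots> = trace_pair n (\<lambda>i j. \<Sum>\<mu>\<in>M. c \<mu> * p \<mu> i j) b" by (rule trace_pair_sum[symmetric])
  also have "\<dots> = trace_pair n (\<lambda>i j. c (J i i - J j j) * a i j) b"
  proof (intro trace_pair_cong)
    fix i j assume ij: "i < n" "j < n"
    have "(\<Sum>\<mu>\<in>M. c \<mu> * p \<mu> i j) = (\<Sum>\<mu>\<in>M. if \<mu> = J i i - J j j then c \<mu> * a i j else 0)"
      by (rule sum.cong) (auto simp: p_def)
    then show "(\<Sum>\<mu>\<in>M. c \<mu> * p \<mu> i j) = c (J i i - J j j) * a i j"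
      using inM[OF ij] M by simp
  qed
  finally show ?thesis by (simp add: trace_pair_def)
qed simp

end

section \<open>Detecting nilpotency by traces\<close>

definition mat_trace :: "'a::comm_ring_1 mat \<Rightarrow> 'a" where
  "mat_trace A = (\<Sum>i<dim_row A. A $$ (i, i))"

definition mat_comm :: "'a::comm_ring_1 mat \<Rightarrow> 'a mat \<Rightarrow> 'a mat" where
  "mat_comm A B = A * B - B * A"

lemma mat_comm_carrier [simp]:
  "A \<in> carrier_mat n n \<Longrightarrow> B \<in> carrier_mat n n \<Longrightarrow> mat_comm A B \<in> carrier_mat n n"
  by (simp add: mat_comm_def minus_carrier_mat)

lemma mat_comm_pow_carrier [simp]:
  "A \<in> carrier_mat n n \<Longrightarrow> B \<in> carrier_mat n n \<Longrightarrow> (mat_comm A ^^ k) B \<in> carrier_mat n n"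
  by (induction k) simp_all

lemma mat_mult_index:
  "A \<in> carrier_mat n n \<Longrightarrow> B \<in> carrier_mat n n \<Longrightarrow> i < n \<Longrightarrow> j < n \<Longrightarrow>
    (A * B) $$ (i, j) = (\<Sum>k<n. A $$ (i, k) * B $$ (k, j))"
  by (simp add: scalar_prod_def atLeast0LessThan)

lemma mat_trace_mult:
  assumes "A \<in> carrier_mat n n" "B \<in> carrier_mat n n"
  shows "mat_trace (A * B) = (\<Sum>i<n. \<Sum>k<n. A $$ (i, k) * B $$ (k, i))"
  using assms by (simp add: mat_trace_def scalar_prod_def atLeast0LessThan)

lemma mat_trace_mult_commute:
  assumes "A \<in> carrier_mat n n" "B \<in> carrier_mat n n"
  shows "mat_trace (A * B) = mat_trace (B * A)"
  unfolding mat_trace_mult[OF assms] mat_trace_mult[OF assms(2,1)]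
  by (subst sum.swap) (simp add: mult.commute)

lemma mat_trace_add:
  "A \<in> carrier_mat n n \<Longrightarrow> B \<in> carrier_mat n n \<Longrightarrow> mat_trace (A + B) = mat_trace A + mat_trace B"
  by (simp add: mat_trace_def sum.distrib)

lemma mat_trace_minus:
  "A \<in> carrier_mat n n \<Longrightarrow> B \<in> carrier_mat n n \<Longrightarrow> mat_trace (A - B) = mat_trace A - mat_trace B"
  by (simp add: mat_trace_def sum_subtractf)

lemma mat_trace_smult: "A \<in> carrier_mat n n \<Longrightarrow> mat_trace (c \<cdot>\<^sub>m A) = c * mat_trace A"
  by (simp add: mat_trace_def sum_distrib_left)

lemma mat_trace_mat_comm:
  assumes "A \<in> carrier_mat n n" "B \<in> carrier_mat n n" "C \<in> carrier_mat n n"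
  shows "mat_trace (mat_comm A B * C) = mat_trace (A * mat_comm B C)"
proof -
  have "mat_trace (B * A * C) = mat_trace (B * (A * C))" using assms by (simp add: assoc_mult_mat)
  also have "\<dots> = mat_trace (A * C * B)" using assms by (intro mat_trace_mult_commute[of _ n]) auto
  also have "\<dots> = mat_trace (A * (C * B))" using assms by (simp add: assoc_mult_mat)
  finally show ?thesis
    using assms unfolding mat_comm_def
    by (simp add: minus_mult_distrib_mat[of _ n n _ _ n] mult_minus_distrib_mat[of _ n n _ n]
        mat_trace_minus[of _ n] assoc_mult_mat[of _ n n _ n _ n])
qed

lemma mat_comm_index:
  assumes "A \<in> carrier_mat n n" "B \<in> carrier_mat n n" "i < n" "j < n"
  shows "mat_comm A B $$ (i, j) = (\<Sum>k<n. A $$ (i, k) * B $$ (k, j)) - (\<Sum>k<n. B $$ (i, k) * A $$ (k, j))"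
  unfolding mat_comm_def using assms by (simp add: scalar_prod_def atLeast0LessThan)

lemma mat_comm_pow_index:
  assumes "A \<in> carrier_mat n n" "B \<in> carrier_mat n n" "i < n" "j < n"
  shows "((mat_comm A ^^ k) B) $$ (i, j)
    = (comm_fun n (\<lambda>i j. A $$ (i, j)) ^^ k) (\<lambda>i j. B $$ (i, j)) i j"
  using assms(3,4)
proof (induction k arbitrary: i j)
  case (Suc k)
  have "(mat_comm A ^^ Suc k) B $$ (i, j) = mat_comm A ((mat_comm A ^^ k) B) $$ (i, j)" by simp
  also have "\<dots> = (\<Sum>l<n. A $$ (i, l) * ((mat_comm A ^^ k) B) $$ (l, j))
      - (\<Sum>l<n. ((mat_comm A ^^ k) B) $$ (i, l) * A $$ (l, j))"
    using mat_comm_index[OF assms(1) mat_comm_pow_carrier[OF assms(1,2)] Suc.prems] by simp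
  finally show ?case using Suc by (simp add: comm_fun_def sum_subtractf)
qed simp

lemma mat_trace_comm_pow:
  assumes "A \<in> carrier_mat n n" "B \<in> carrier_mat n n" "C \<in> carrier_mat n n"
  shows "mat_trace ((mat_comm A ^^ k) B * C)
    = trace_pair n ((comm_fun n (\<lambda>i j. A $$ (i, j)) ^^ k) (\<lambda>i j. B $$ (i, j))) (\<lambda>i j. C $$ (i, j))"
  using assms by (simp add: mat_trace_mult[of _ n] mat_comm_pow_index trace_pair_def)

text \<open>The entries of \<open>J ^ k\<close> are supported on \<open>j >= i + k\<close>.\<close>

lemma strictly_upper_triangular_pow:
  fixes J :: "'a::comm_ring_1 mat"
  assumes J: "J \<in> carrier_mat n n" and z: "\<And>i j. i < n \<Longrightarrow> j \<le> i \<Longrightarrow> J $$ (i, j) = 0"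
  shows "J ^\<^sub>m n = 0\<^sub>m n n"
proof -
  have "(J ^\<^sub>m k) $$ (i, j) = 0" if "i < n" "j < n" "j < i + k" for i j k
    using that
  proof (induction k arbitrary: j)
    case (Suc k)
    have "(J ^\<^sub>m Suc k) $$ (i, j) = (\<Sum>l<n. (J ^\<^sub>m k) $$ (i, l) * J $$ (l, j))"
      using J Suc.prems by (simp add: mat_mult_index[OF pow_carrier_mat[OF J] J] del: index_mult_mat)
    also have "\<dots> = 0"
    proof (intro sum.neutral ballI)
      fix l assume l: "l \<in> {..<n}"
      show "(J ^\<^sub>m k) $$ (i, l) * J $$ (l, j) = 0"
        using Suc.IH[of l] z[of l j] Suc.prems l by (cases "l < i + k") auto
    qed
    finally show ?case .
  qed (use J in auto)
  then show ?thesis using J by (intro eq_matI) auto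
qed

text \<open>In Cartan's argument \<open>Y\<close> is a rational replacement of the semisimple part of \<open>D\<close>: its adjoint action
  is a polynomial without constant term in \<open>ad D\<close>, so \<open>Z \<mapsto> tr (Y Z)\<close> kills every commutator
  \<open>[A, B]\<close> with \<open>tr ((ad D)\<^sup>k A \<cdot> B) = 0\<close> for all \<open>k \<ge> 1\<close>.\<close>

definition detects :: "nat \<Rightarrow> 'a::comm_ring_1 mat \<Rightarrow> 'a mat \<Rightarrow> bool" where
  "detects n D Y \<longleftrightarrow> Y \<in> carrier_mat n n \<and> mat_trace (Y * D) \<noteq> 0 \<and>
     (\<forall>A\<in>carrier_mat n n. \<forall>B\<in>carrier_mat n n.
        (\<forall>k\<ge>1. mat_trace ((mat_comm D ^^ k) A * B) = 0) \<longrightarrow> mat_trace (Y * mat_comm A B) = 0)"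

text \<open>\<open>Y\<close> is diagonal and replaces each eigenvalue by its image under
  \<open>\<phi>\<close>. The trace of \<open>Y [A, B]\<close> is then a sum of \<open>A\<close> and
  \<open>B\<close> entries weighted by differences of these images, which by additivity of
  \<open>\<phi>\<close> is the sum in \<open>weighted_trace_zero\<close>.\<close>

lemma detects_jordan:
  fixes J :: "'a::field_char_0 mat"
  assumes J: "J \<in> carrier_mat n n" "upper_triangular J"
    "\<And>i j. i < n \<Longrightarrow> j < n \<Longrightarrow> J $$ (i, j) \<noteq> 0 \<Longrightarrow> J $$ (i, i) = J $$ (j, j)"
    and nil: "J ^\<^sub>m n \<noteq> 0\<^sub>m n n"
  shows "\<exists>Y. detects n J Y"
proof -
  interpret jordan_fun n "\<lambda>i j. J $$ (i, j)"
    by unfold_locales (use J in auto)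
  obtain i0 where i0: "i0 < n" "J $$ (i0, i0) \<noteq> 0"
  proof -
    have "\<exists>i<n. J $$ (i, i) \<noteq> 0"
    proof (rule ccontr)
      assume "\<not> ?thesis"
      then have "J $$ (i, j) = 0" if "i < n" "j \<le> i" for i j
        using that upper[of i j] by (cases "j = i") auto
      then show False using strictly_upper_triangular_pow[OF J(1)] nil by blast
    qed
    then show thesis using that by blast
  qed
  obtain \<phi> :: "'a \<Rightarrow> rat" where \<phi>: "\<And>x y. \<phi> (x + y) = \<phi> x + \<phi> y"
    "\<And>q x. \<phi> (of_rat q * x) = q * \<phi> x" "\<phi> (J $$ (i0, i0)) \<noteq> 0"
    using rational_functional[OF i0(2)] by blast
  have \<phi>0: "\<phi> 0 = 0" using \<phi>(1)[of 0 0] by simp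
  have \<phi>d: "\<phi> (x - y) = \<phi> x - \<phi> y" for x y using \<phi>(1)[of "x - y" y] by simp
  have \<phi>s: "\<phi> (\<Sum>i\<in>I. f i) = (\<Sum>i\<in>I. \<phi> (f i))" if "finite I" for f and I :: "nat set"
    using that by induction (auto simp: \<phi>0 \<phi>(1))
  define c :: "'a \<Rightarrow> 'a" where "c x = of_rat (\<phi> x)" for x
  define Y where "Y = mat n n (\<lambda>(i, j). if i = j then c (J $$ (i, i)) else 0)"
  have Y: "Y \<in> carrier_mat n n" by (simp add: Y_def)
  have tY: "mat_trace (Y * Z) = (\<Sum>i<n. c (J $$ (i, i)) * Z $$ (i, i))" if "Z \<in> carrier_mat n n" for Z
  proof -
    have "(\<Sum>k<n. Y $$ (i, k) * Z $$ (k, i)) = (\<Sum>k<n. if k = i then c (J $$ (i, i)) * Z $$ (i, i) else 0)"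
      if "i < n" for i using that by (intro sum.cong) (auto simp: Y_def)
    then show ?thesis unfolding mat_trace_mult[OF Y that] by (intro sum.cong) auto
  qed
  \<comment> \<open>Applying \<open>\<phi>\<close> to the trace once more gives a sum of rational
    squares, one of them nonzero.\<close>
  have "\<phi> (mat_trace (Y * J)) = (\<Sum>i<n. (\<phi> (J $$ (i, i)))\<^sup>2)"
    unfolding tY[OF J(1)] by (simp add: \<phi>s c_def \<phi>(2) power2_eq_square)
  moreover have "(\<Sum>i<n. (\<phi> (J $$ (i, i)))\<^sup>2) > 0"
    by (rule sum_pos2[of _ i0]) (use i0 \<phi>(3) in auto)
  ultimately have "mat_trace (Y * J) \<noteq> 0" using \<phi>0 by auto
  moreover have "mat_trace (Y * mat_comm A B) = 0"
    if A: "A \<in> carrier_mat n n" and B: "B \<in> carrier_mat n n"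
      and tr: "\<forall>k\<ge>1. mat_trace ((mat_comm J ^^ k) A * B) = 0" for A B
  proof -
    have "(\<Sum>i<n. \<Sum>j<n. c (J $$ (i, i) - J $$ (j, j)) * A $$ (i, j) * B $$ (j, i)) = 0"
      by (rule weighted_trace_zero) (use tr J A B in \<open>auto simp: mat_trace_comm_pow c_def \<phi>0\<close>)
    then have e: "(\<Sum>i<n. \<Sum>j<n. c (J $$ (i, i)) * (A $$ (i, j) * B $$ (j, i)))
        = (\<Sum>i<n. \<Sum>j<n. c (J $$ (j, j)) * (A $$ (i, j) * B $$ (j, i)))"
      by (simp add: c_def \<phi>d of_rat_diff sum_subtractf algebra_simps)
    have "mat_trace (Y * mat_comm A B) = (\<Sum>i<n. \<Sum>j<n. c (J $$ (i, i)) * (A $$ (i, j) * B $$ (j, i)))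
        - (\<Sum>i<n. \<Sum>j<n. c (J $$ (i, i)) * (B $$ (i, j) * A $$ (j, i)))"
      using tY A B by (simp add: mat_comm_index[OF A B] sum_subtractf sum_distrib_left right_diff_distrib)
    also have "(\<Sum>i<n. \<Sum>j<n. c (J $$ (i, i)) * (B $$ (i, j) * A $$ (j, i)))
        = (\<Sum>i<n. \<Sum>j<n. c (J $$ (j, j)) * (A $$ (i, j) * B $$ (j, i)))"
      by (subst sum.swap) (simp add: mult.commute)
    finally show ?thesis using e by simp
  qed
  ultimately show ?thesis unfolding detects_def using Y by blast
qed

locale conj_mat =
  fixes n :: nat and P Q :: "'a::comm_ring_1 mat"
  assumes P: "P \<in> carrier_mat n n" and Q: "Q \<in> carrier_mat n n" and PQ: "P * Q = 1\<^sub>m n"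
begin

definition conj :: "'a mat \<Rightarrow> 'a mat" where "conj A = Q * A * P"

lemma conj_carrier [simp]: "A \<in> carrier_mat n n \<Longrightarrow> conj A \<in> carrier_mat n n"
  using P Q by (simp add: conj_def)

lemma conj_mult:
  assumes "A \<in> carrier_mat n n" "B \<in> carrier_mat n n"
  shows "conj (A * B) = conj A * conj B"
proof -
  have "conj A * conj B = Q * A * (P * (Q * (B * P)))"
    unfolding conj_def using P Q assms by (simp add: assoc_mult_mat[of _ n n _ n _ n])
  also have "P * (Q * (B * P)) = P * Q * (B * P)"
    using P Q assms by (simp add: assoc_mult_mat[of _ n n _ n _ n])
  also have "\<dots> = B * P" using PQ P assms by simp
  finally show ?thesis
    unfolding conj_def using P Q assms by (simp add: assoc_mult_mat[of _ n n _ n _ n])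
qed

lemma conj_minus:
  assumes "A \<in> carrier_mat n n" "B \<in> carrier_mat n n"
  shows "conj (A - B) = conj A - conj B"
  unfolding conj_def using P Q assms
  by (simp add: minus_mult_distrib_mat[of _ n n _ _ n] mult_minus_distrib_mat[of _ n n _ n])

lemma conj_mat_comm:
  assumes "A \<in> carrier_mat n n" "B \<in> carrier_mat n n"
  shows "conj (mat_comm A B) = mat_comm (conj A) (conj B)"
  unfolding mat_comm_def using assms by (simp add: conj_minus conj_mult)

lemma conj_mat_comm_pow:
  assumes "A \<in> carrier_mat n n" "B \<in> carrier_mat n n"
  shows "conj ((mat_comm A ^^ k) B) = (mat_comm (conj A) ^^ k) (conj B)"
  by (induction k) (use assms in \<open>simp_all add: conj_mat_comm\<close>)

lemma mat_trace_conj: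
  assumes "A \<in> carrier_mat n n"
  shows "mat_trace (conj A) = mat_trace A"
proof -
  have "mat_trace (conj A) = mat_trace (P * (Q * A))"
    unfolding conj_def using P Q assms by (intro mat_trace_mult_commute[of _ n]) auto
  also have "P * (Q * A) = A" using P Q assms PQ by (simp add: assoc_mult_mat[symmetric, of _ n n _ n _ n])
  finally show ?thesis .
qed

lemma detects_conj:
  assumes D: "D \<in> carrier_mat n n" and Y: "detects n (conj D) (conj Y)" "Y \<in> carrier_mat n n"
  shows "detects n D Y"
  unfolding detects_def
proof (intro conjI ballI impI)
  note tr = mat_trace_conj conj_mult[symmetric] conj_mat_comm[symmetric] conj_mat_comm_pow[symmetric]
  have "mat_trace (conj Y * conj D) = mat_trace (Y * D)" using D Y(2) by (simp add: tr)
  then show "mat_trace (Y * D) \<noteq> 0" using Y unfolding detects_def by simp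
  fix A B assume AB: "A \<in> carrier_mat n n" "B \<in> carrier_mat n n"
    and orth: "\<forall>k\<ge>1. mat_trace ((mat_comm D ^^ k) A * B) = 0"
  have "mat_trace ((mat_comm (conj D) ^^ k) (conj A) * conj B) = mat_trace ((mat_comm D ^^ k) A * B)" for k
    using D AB by (simp add: tr mult_carrier_mat[of _ n n _ n])
  then have "mat_trace (conj Y * mat_comm (conj A) (conj B)) = 0"
    using Y(1) AB orth unfolding detects_def by simp
  moreover have "mat_trace (conj Y * mat_comm (conj A) (conj B)) = mat_trace (Y * mat_comm A B)"
    using Y(2) AB by (simp add: tr)
  ultimately show "mat_trace (Y * mat_comm A B) = 0" by simp
qed (use Y in auto)

end

lemma ex_detects:
  fixes D :: "'a::{alg_closed_field, field_char_0} mat"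
  assumes D: "D \<in> carrier_mat n n" and nil: "D ^\<^sub>m n \<noteq> 0\<^sub>m n n"
  shows "\<exists>Y. detects n D Y"
proof -
  obtain J P Q where w: "similar_mat_wit D J P Q" and J: "J \<in> carrier_mat n n" "upper_triangular J"
    "\<And>i j. i < n \<Longrightarrow> j < n \<Longrightarrow> J $$ (i, j) \<noteq> 0 \<Longrightarrow> J $$ (i, i) = J $$ (j, j)"
    using similar_jordan_matrix[OF D] by metis
  have PQ: "P \<in> carrier_mat n n" "Q \<in> carrier_mat n n" "P * Q = 1\<^sub>m n" "Q * P = 1\<^sub>m n" "D = P * J * Q"
    using similar_mat_witD2[OF D w] by auto
  have "D ^\<^sub>m n = P * J ^\<^sub>m n * Q" by (rule similar_mat_wit_pow_id[OF w])
  then have "J ^\<^sub>m n \<noteq> 0\<^sub>m n n" using nil PQ by auto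
  then obtain Y where Y: "detects n J Y" using detects_jordan J by blast
  then have Yc: "Y \<in> carrier_mat n n" unfolding detects_def by simp
  interpret c: conj_mat n P Q by unfold_locales (use PQ in auto)
  interpret d: conj_mat n Q P by unfold_locales (use PQ in auto)
  have inv: "c.conj (d.conj Z) = Z" if "Z \<in> carrier_mat n n" for Z
  proof -
    have "c.conj (d.conj Z) = Q * P * Z * (Q * P)"
      unfolding c.conj_def d.conj_def using PQ(1,2) that by (simp add: assoc_mult_mat[of _ n n _ n _ n])
    then show ?thesis using PQ(4) that by simp
  qed
  have "D = d.conj J" using PQ(5) by (simp add: d.conj_def)
  then have "detects n D (d.conj Y)"
    using c.detects_conj[OF D, of "d.conj Y"] Y Yc inv J(1) by simp
  then show ?thesis by blast
qed

text \<open>Eigenvalues exist in the algebraic closure only, so \<open>D\<close> is transported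
  along \<open>to_ac\<close> and \<open>f\<close> takes its values there. The traces in the last
  condition stay in the base field, where the Killing form is computed.\<close>

lemma nilpotent_or_functional:
  fixes D :: "'a::field_char_0 mat"
  assumes D: "D \<in> carrier_mat n n" and nil: "D ^\<^sub>m n \<noteq> 0\<^sub>m n n"
  obtains f :: "'a mat \<Rightarrow> 'a alg_closure" where
    "\<And>A B. A \<in> carrier_mat n n \<Longrightarrow> B \<in> carrier_mat n n \<Longrightarrow> f (A + B) = f A + f B"
    "\<And>c A. A \<in> carrier_mat n n \<Longrightarrow> f (c \<cdot>\<^sub>m A) = to_ac c * f A"
    "f D \<noteq> 0"
    "\<And>A B. A \<in> carrier_mat n n \<Longrightarrow> B \<in> carrier_mat n n \<Longrightarrow>
      (\<And>k. k \<ge> 1 \<Longrightarrow> mat_trace ((mat_comm D ^^ k) A * B) = 0) \<Longrightarrow> f (mat_comm A B) = 0"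
proof -
  interpret h: field_hom "to_ac :: 'a \<Rightarrow> 'a alg_closure" by unfold_locales auto
  define h where "h = (map_mat to_ac :: 'a mat \<Rightarrow> 'a alg_closure mat)"
  have hc [simp]: "h A \<in> carrier_mat n n" if "A \<in> carrier_mat n n" for A
    using that by (simp add: h_def)
  have hm: "h (A * B) = h A * h B" if "A \<in> carrier_mat n n" "B \<in> carrier_mat n n" for A B
    unfolding h_def using that by (rule h.mat_hom_mult)
  have hcomm: "h (mat_comm A B) = mat_comm (h A) (h B)" if "A \<in> carrier_mat n n" "B \<in> carrier_mat n n" for A B
  proof -
    have "h (A * B - B * A) = h (A * B) - h (B * A)"
      using that by (intro eq_matI) (auto simp: h_def)
    then show ?thesis using that by (simp add: mat_comm_def hm)
  qed
  have hpow: "h ((mat_comm D ^^ k) A) = (mat_comm (h D) ^^ k) (h A)" if "A \<in> carrier_mat n n" for k A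
    by (induction k) (use that D in \<open>simp_all add: hcomm\<close>)
  have htr: "mat_trace (h A) = to_ac (mat_trace A)" if "A \<in> carrier_mat n n" for A
    using that by (simp add: mat_trace_def h_def to_ac_sum)
  have "h D ^\<^sub>m n \<noteq> 0\<^sub>m n n"
  proof
    assume "h D ^\<^sub>m n = 0\<^sub>m n n"
    moreover have "h (0\<^sub>m n n) = 0\<^sub>m n n" by (intro eq_matI) (auto simp: h_def)
    ultimately have "h (D ^\<^sub>m n) = h (0\<^sub>m n n)"
      unfolding h_def using D by (simp add: h.mat_hom_pow)
    moreover have "h (D ^\<^sub>m n) $$ (i, j) = to_ac ((D ^\<^sub>m n) $$ (i, j))" if "i < n" "j < n" for i j
      using that carrier_matD[OF pow_carrier_mat[OF D, of n]] D by (simp add: h_def)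
    moreover have "h (0\<^sub>m n n) $$ (i, j) = 0" if "i < n" "j < n" for i j
      using that by (simp add: h_def)
    ultimately have "(D ^\<^sub>m n) $$ (i, j) = 0" if "i < n" "j < n" for i j
      using that by (metis to_ac_eq_0_iff)
    then have "D ^\<^sub>m n = 0\<^sub>m n n"
      using pow_carrier_mat[OF D, of n] by (intro eq_matI) auto
    then show False using nil by blast
  qed
  then obtain Y where Y: "detects n (h D) Y" using ex_detects[of "h D" n] D by auto
  then have Yc: "Y \<in> carrier_mat n n" unfolding detects_def by simp
  show thesis
  proof (rule that[of "\<lambda>A. mat_trace (Y * h A)"])
    fix A B :: "'a mat" assume AB: "A \<in> carrier_mat n n" "B \<in> carrier_mat n n"
    have "h (A + B) = h A + h B" using AB by (intro eq_matI) (auto simp: h_def)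
    then show "mat_trace (Y * h (A + B)) = mat_trace (Y * h A) + mat_trace (Y * h B)"
      using AB Yc by (simp add: mult_add_distrib_mat[of _ n n _ n] mat_trace_add[of _ n])
    assume "\<And>k. k \<ge> 1 \<Longrightarrow> mat_trace ((mat_comm D ^^ k) A * B) = 0"
    then have "\<forall>k\<ge>1. mat_trace (h ((mat_comm D ^^ k) A * B)) = 0"
      using AB D by (simp add: htr mult_carrier_mat[of _ n n _ n])
    then have "\<forall>k\<ge>1. mat_trace ((mat_comm (h D) ^^ k) (h A) * h B) = 0"
      using AB D by (simp add: hm hpow)
    then have "mat_trace (Y * mat_comm (h A) (h B)) = 0"
      using Y AB unfolding detects_def by (meson hc)
    then show "mat_trace (Y * h (mat_comm A B)) = 0" using AB by (simp add: hcomm)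
  next
    fix c and A :: "'a mat" assume A: "A \<in> carrier_mat n n"
    have "h (c \<cdot>\<^sub>m A) = to_ac c \<cdot>\<^sub>m h A" using A by (intro eq_matI) (auto simp: h_def)
    then show "mat_trace (Y * h (c \<cdot>\<^sub>m A)) = to_ac c * mat_trace (Y * h A)"
      using A Yc by (simp add: mult_smult_distrib[of _ n n _ n] mat_trace_smult[of _ n])
  qed (use Y in \<open>simp add: detects_def\<close>)
qed

section \<open>Linear algebra\<close>

context vector_space
begin

text \<open>Separation by linear forms. It turns a congruence modulo \<open>I\<close> into scalar
  identities, in which sums over dual bases can be rearranged.\<close>

lemma in_subspace_if_functionals:
  assumes S: "subspace S"
    and p: "\<And>p. Vector_Spaces.linear scale (*) p \<Longrightarrow> (\<And>x. x \<in> S \<Longrightarrow> p x = 0) \<Longrightarrow> p z = 0"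
  shows "z \<in> S"
proof (rule ccontr)
  assume z: "z \<notin> S"
  interpret p: vector_space_pair scale "(*) :: 'a \<Rightarrow> 'a \<Rightarrow> 'a"
    by unfold_locales (auto simp: algebra_simps)
  obtain B where B: "B \<subseteq> S" "independent B" "S \<subseteq> span B"
    using maximal_independent_subset by blast
  have SB: "span B = S" using span_subspace[OF B(1,3) S] .
  then have ind: "independent (insert z B)" using z B by (simp add: independent_insertI)
  obtain g where g: "Vector_Spaces.linear scale (*) g" "\<forall>x\<in>insert z B. g x = (if x = z then 1 else 0)"
    using p.linear_independent_extend[OF ind, of "\<lambda>x. if x = z then 1 else 0"] by blast
  have "g x = 0" if "x \<in> B" for x using g(2) that z B(1) by auto
  then have "g x = 0" if "x \<in> S" for x
    using p.linear_eq_0_on_span[OF g(1), of B x] SB that by blast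
  then have "g z = 0" by (rule p[OF g(1)])
  then show False using g(2) by simp
qed

end

context finite_dimensional_vector_space
begin

text \<open>Coordinates on the quotient by \<open>S\<close> without forming it: a basis of
  \<open>S\<close> is extended to the whole space, \<open>e\<close> lists the added vectors and
  \<open>c\<close> their coefficients.\<close>

lemma quotient_coordinates:
  assumes S: "subspace S"
  obtains n :: nat and e :: "nat \<Rightarrow> 'b" and c :: "nat \<Rightarrow> 'b \<Rightarrow> 'a"
  where "\<And>i. Vector_Spaces.linear scale (*) (c i)"
    "\<And>x. x \<in> S \<longleftrightarrow> (\<forall>i<n. c i x = 0)"
    "\<And>x. x - (\<Sum>i<n. scale (c i x) (e i)) \<in> S"
    "\<And>i j. i < n \<Longrightarrow> j < n \<Longrightarrow> c i (e j) = (if i = j then 1 else 0)"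
proof -
  obtain C where C: "C \<subseteq> S" "independent C" "S \<subseteq> span C"
    using maximal_independent_subset by blast
  have SC: "span C = S" using span_subspace[OF C(1,3) S] .
  obtain D where D: "C \<subseteq> D" "independent D" "span D = UNIV"
    using maximal_independent_subset_extend[of C UNIV] C(2) by (metis subset_UNIV top.extremum_uniqueI)
  have fin: "finite D" using D(2) by (rule finiteI_independent)
  then obtain e n where e: "bij_betw e {..<n::nat} (D - C)"
    using ex_bij_betw_nat_finite[of "D - C"] unfolding atLeast0LessThan by blast
  define c where "c i x = representation D x (e i)" for i x
  have eD: "e i \<in> D" "e i \<notin> C" if "i < n" for i using bij_betw_apply[OF e, of i] that by auto
  have lin: "Vector_Spaces.linear scale (*) (c i)" for i
  proof -
    have "representation D (x + y) (e i) = representation D x (e i) + representation D y (e i)" for x y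
      using representation_add[OF D(2), of y x] D(3) by simp
    moreover have "representation D (scale a x) (e i) = a * representation D x (e i)" for a x
      using representation_scale[OF D(2), of x a] D(3) by simp
    ultimately show ?thesis
      unfolding c_def by unfold_locales (simp_all add: ring_distribs)
  qed
  have cS: "c i x = 0" if x: "x \<in> S" and i: "i < n" for x i
  proof -
    have "representation D x = representation C x"
      using representation_extend[OF D(2), of x C] D(1) SC x by simp
    then show ?thesis using eD[OF i] representation_ne_zero[of C x "e i"] unfolding c_def by metis
  qed
  have exp: "x - (\<Sum>i<n. scale (c i x) (e i)) \<in> S" for x
  proof -
    have "x = (\<Sum>b\<in>D. scale (representation D x b) b)"
      using sum_representation_eq[OF D(2) _ fin, of x] D(3) by simp
    also have "\<dots> = (\<Sum>b\<in>D - C. scale (representation D x b) b) + (\<Sum>b\<in>C. scale (representation D x b) b)"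
      using D(1) fin by (rule sum.subset_diff)
    also have "(\<Sum>b\<in>D - C. scale (representation D x b) b) = (\<Sum>i<n. scale (c i x) (e i))"
      unfolding c_def by (rule sum.reindex_bij_betw[OF e, symmetric])
    finally have "x - (\<Sum>i<n. scale (c i x) (e i)) = (\<Sum>b\<in>C. scale (representation D x b) b)"
      by (simp add: algebra_simps)
    also have "\<dots> \<in> S" using S C(1) by (intro subspace_sum subspace_scale) auto
    finally show ?thesis .
  qed
  show thesis
  proof (rule that[OF lin, where n = n and e = e])
    show "x \<in> S \<longleftrightarrow> (\<forall>i<n. c i x = 0)" for x
    proof
      assume "\<forall>i<n. c i x = 0"
      then have "(\<Sum>i<n. scale (c i x) (e i)) = 0" by (intro sum.neutral) simp
      then show "x \<in> S" using exp[of x] by simp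
    qed (use cS in blast)
    show "c i (e j) = (if i = j then 1 else 0)" if "i < n" "j < n" for i j
    proof -
      have "representation D (e j) = (\<lambda>b. if b = e j then 1 else 0)"
        using D(2) eD(1)[OF that(2)] by (rule representation_basis)
      moreover have "e i = e j \<longleftrightarrow> i = j"
        using that inj_on_eq_iff[OF bij_betw_imp_inj_on[OF e]] by simp
      ultimately show ?thesis unfolding c_def by simp
    qed
  qed (rule exp)
qed

lemma ex_max_dim:
  assumes "P S"
  obtains T where "P T" "\<And>U. P U \<Longrightarrow> dim U \<le> dim T"
proof -
  have "\<forall>U. P U \<longrightarrow> dim U < Suc (dim UNIV)" using dim_subset[OF subset_UNIV] by (simp add: less_Suc_eq_le)
  then show thesis using ex_has_greatest_nat[of P S dim] assms that by blast
qed

lemma ex_min_dim: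
  assumes "P S"
  obtains T where "P T" "\<And>U. P U \<Longrightarrow> dim T \<le> dim U"
  using ex_has_least_nat[of P S dim] assms by blast

end

section \<open>Ideals of bracket algebras\<close>

context bracket_algebra
begin

lemma bracket_linear:
  "Vector_Spaces.linear scale scale (\<lambda>y. bracket x y)" "Vector_Spaces.linear scale scale (\<lambda>x. bracket x y)"
  using bilinear_bracket unfolding bilinear_map_def by auto

lemma bracket_simps:
  "bracket (x + y) z = bracket x z + bracket y z" "bracket z (x + y) = bracket z x + bracket z y"
  "bracket (x - y) z = bracket x z - bracket y z" "bracket z (x - y) = bracket z x - bracket z y"
  "bracket (- x) z = - bracket x z" "bracket z (- x) = - bracket z x"
  "bracket (scale a x) z = scale a (bracket x z)" "bracket z (scale a x) = scale a (bracket z x)"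
  "bracket 0 z = 0" "bracket z 0 = 0"
  "bracket (\<Sum>i\<in>A. f i) z = (\<Sum>i\<in>A. bracket (f i) z)" "bracket z (\<Sum>i\<in>A. f i) = (\<Sum>i\<in>A. bracket z (f i))"
proof -
  interpret l: Vector_Spaces.linear scale scale "\<lambda>x. bracket x z" by (rule bracket_linear)
  interpret r: Vector_Spaces.linear scale scale "\<lambda>x. bracket z x" by (rule bracket_linear)
  show "bracket (x + y) z = bracket x z + bracket y z" "bracket z (x + y) = bracket z x + bracket z y"
    "bracket (x - y) z = bracket x z - bracket y z" "bracket z (x - y) = bracket z x - bracket z y"
    "bracket (- x) z = - bracket x z" "bracket z (- x) = - bracket z x"
    "bracket (scale a x) z = scale a (bracket x z)" "bracket z (scale a x) = scale a (bracket z x)"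
    "bracket 0 z = 0" "bracket z 0 = 0"
    "bracket (\<Sum>i\<in>A. f i) z = (\<Sum>i\<in>A. bracket (f i) z)" "bracket z (\<Sum>i\<in>A. f i) = (\<Sum>i\<in>A. bracket z (f i))"
    by (rule l.add r.add l.diff r.diff l.neg r.neg l.scale r.scale l.zero r.zero l.sum r.sum)+
qed

lemma idealI:
  assumes "subspace V" "\<And>x y. x \<in> V \<Longrightarrow> bracket x y \<in> V" "\<And>x y. x \<in> V \<Longrightarrow> bracket y x \<in> V"
  shows "ideal V"
proof -
  have "bracket_prod V UNIV \<subseteq> V" "bracket_prod UNIV V \<subseteq> V"
    unfolding bracket_prod_def by (rule span_minimal; use assms in blast)+
  then show ?thesis
    unfolding ideal_def set_plus_def using assms(1) by (auto intro: subspace_add)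
qed

lemma idealD:
  assumes "ideal V"
  shows "subspace V" "x \<in> V \<Longrightarrow> bracket x y \<in> V" "x \<in> V \<Longrightarrow> bracket y x \<in> V"
proof -
  show V: "subspace V" using assms unfolding ideal_def by simp
  have z: "0 \<in> bracket_prod A B" for A B unfolding bracket_prod_def by (rule span_zero)
  have b: "bracket a b \<in> bracket_prod A B" if "a \<in> A" "b \<in> B" for a b A B
    unfolding bracket_prod_def using that by (auto intro: span_base)
  have sub: "p + q \<in> V" if "p \<in> bracket_prod V UNIV" "q \<in> bracket_prod UNIV V" for p q
    using assms that unfolding ideal_def set_plus_def by blast
  show "bracket x y \<in> V" if "x \<in> V" using sub[OF b z, of x y] that by simp
  show "bracket y x \<in> V" if "x \<in> V" using sub[OF z b, of y x] that by simp
qed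

end

section \<open>Central extensions of semisimple algebras\<close>

text \<open>\<open>I\<close> is an ideal modulo which the bracket satisfies the Leibniz identity, and \<open>J / I\<close> is central
  with semisimple quotient.  The quotients are never formed: everything is stated modulo \<open>I\<close> or \<open>J\<close>.\<close>

locale leibniz_extension =
  bracket_algebra scale bracket + finite_dimensional_vector_space scale Basis
  for scale :: "'k::field_char_0 \<Rightarrow> 'l::ab_group_add \<Rightarrow> 'l" and bracket and Basis :: "'l set" +
  fixes I J :: "'l set"
  assumes subspace_I: "subspace I" and subspace_J: "subspace J" and I_subset_J: "I \<subseteq> J"
    and bracket_J: "x \<in> J \<Longrightarrow> bracket x y \<in> I" "x \<in> J \<Longrightarrow> bracket y x \<in> I"
    and leibniz: "bracket (bracket x y) z - bracket (bracket x z) y - bracket x (bracket y z) \<in> I"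
    and abelian_ideal: "ideal V \<Longrightarrow> (\<And>x y. x \<in> V \<Longrightarrow> y \<in> V \<Longrightarrow> bracket x y \<in> J) \<Longrightarrow> V \<subseteq> J"
begin

text \<open>The squares together with \<open>J\<close> span an ideal \<open>Q\<close>, the analogue
  of the Leibniz kernel. Brackets with second argument in \<open>Q\<close> lie in \<open>I\<close>,
  so \<open>Q\<close> is abelian modulo \<open>J\<close> and hence inside \<open>J\<close>: the
  quotient by \<open>J\<close> is a Lie algebra.\<close>

lemma square_in_J: "bracket x x \<in> J"
proof -
  define Q where "Q = span ({bracket x x | x. True} \<union> J)"
  have JQ: "J \<subseteq> Q" and sq: "bracket x x \<in> Q" for x unfolding Q_def by (auto intro: span_base)
  have subQ: "subspace Q" unfolding Q_def by (rule subspace_span)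
  have IQ: "x \<in> Q" if "x \<in> I" for x using that I_subset_J JQ by blast
  have sym: "bracket x z + bracket z x \<in> Q" for x z
  proof -
    have "bracket x z + bracket z x = bracket (x + z) (x + z) - bracket x x - bracket z z"
      by (simp add: bracket_simps algebra_simps)
    then show ?thesis using sq subQ by (simp add: subspace_diff)
  qed
  have right: "bracket y q \<in> I" if "q \<in> Q" for y q
    using that unfolding Q_def
  proof (induction rule: span_induct_alt)
    case (step c z w)
    \<comment> \<open>With the last two arguments of the Leibniz identity equal, the first two terms
      cancel.\<close>
    have "bracket y (bracket x x) \<in> I" for x using leibniz[of y x x] subspace_neg[OF subspace_I] by fastforce
    then have "bracket y z \<in> I" using step bracket_J by auto
    then show ?case using step subspace_I by (simp add: bracket_simps subspace_add subspace_scale)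
  qed (simp add: bracket_simps subspace_0[OF subspace_I])
  have left: "bracket q y \<in> Q" if "q \<in> Q" for y q
  proof -
    have "q \<in> span ({bracket x x | x. True} \<union> J)" using that unfolding Q_def .
    then show ?thesis
    proof (induction rule: span_induct_alt)
      case (step c z w)
      have "bracket (bracket x x) y \<in> Q" for x
      proof -
        have "bracket (bracket x x) y = (bracket (bracket x x) y - bracket (bracket x y) x - bracket x (bracket x y))
          + (bracket (bracket x y) x + bracket x (bracket x y))" by (simp add: algebra_simps)
        also have "\<dots> \<in> Q" by (intro subspace_add[OF subQ] IQ leibniz sym)
        finally show ?thesis .
      qed
      then have "bracket z y \<in> Q" using step bracket_J IQ by auto
      then show ?case using step subQ by (simp add: bracket_simps subspace_add subspace_scale)
    qed (simp add: bracket_simps subspace_0[OF subQ])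
  qed
  have "Q \<subseteq> J"
  proof (rule abelian_ideal)
    show "ideal Q" by (rule idealI) (use subQ left right IQ in auto)
  qed (use right I_subset_J in blast)
  then show ?thesis using sq by blast
qed

lemma antisym_J: "bracket x y + bracket y x \<in> J"
proof -
  have "bracket x y + bracket y x = bracket (x + y) (x + y) - bracket x x - bracket y y"
    by (simp add: bracket_simps algebra_simps)
  then show ?thesis using square_in_J subspace_J by (simp add: subspace_diff)
qed

lemma leibniz_mod:
  assumes "subspace S" "I \<subseteq> S"
  shows "bracket (bracket x z) y \<in> S \<Longrightarrow> bracket x (bracket y z) \<in> S \<Longrightarrow> bracket (bracket x y) z \<in> S"
    and "bracket (bracket x y) z \<in> S \<Longrightarrow> bracket (bracket x z) y \<in> S \<Longrightarrow> bracket x (bracket y z) \<in> S"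
proof -
  define l where "l = bracket (bracket x y) z - bracket (bracket x z) y - bracket x (bracket y z)"
  have l: "l \<in> S" using leibniz assms(2) unfolding l_def by blast
  have "bracket (bracket x y) z = l + (bracket (bracket x z) y + bracket x (bracket y z))"
    "bracket x (bracket y z) = bracket (bracket x y) z - (bracket (bracket x z) y + l)"
    by (simp_all add: l_def algebra_simps)
  then show "bracket (bracket x z) y \<in> S \<Longrightarrow> bracket x (bracket y z) \<in> S \<Longrightarrow> bracket (bracket x y) z \<in> S"
    "bracket (bracket x y) z \<in> S \<Longrightarrow> bracket (bracket x z) y \<in> S \<Longrightarrow> bracket x (bracket y z) \<in> S"
    using l assms(1) by (metis subspace_add, metis subspace_add subspace_diff)
qed

lemma antisym_mod:
  assumes "subspace S" "J \<subseteq> S" "bracket x y \<in> S"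
  shows "bracket y x \<in> S"
  using subspace_diff[OF assms(1) subsetD[OF assms(2) antisym_J[of x y]] assms(3)] by simp

end

section \<open>Engel's theorem\<close>

context leibniz_extension
begin

definition nilpotent_mod :: "'l \<Rightarrow> bool" where
  "nilpotent_mod x \<longleftrightarrow> (\<exists>k. \<forall>y. ((\<lambda>y. bracket y x) ^^ k) y \<in> J)"

text \<open>Stated for a pair \<open>A \<subset> B\<close> so that the induction hypothesis for a
  smaller \<open>g\<close> serves twice: on \<open>h\<close> modulo \<open>g\<close> it yields a
  vector normalising \<open>g\<close>, on \<open>B\<close> modulo \<open>A\<close> a common null
  vector of \<open>g\<close>.\<close>

lemma engel_vector:
  assumes h: "subspace h" "J \<subseteq> h" "\<And>x y. x \<in> h \<Longrightarrow> y \<in> h \<Longrightarrow> bracket x y \<in> h"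
    and nil: "\<And>x. x \<in> h \<Longrightarrow> nilpotent_mod x"
    and A: "subspace A" "J \<subseteq> A" "\<And>a x. a \<in> A \<Longrightarrow> x \<in> h \<Longrightarrow> bracket a x \<in> A"
    and B: "subspace B" "\<And>b x. b \<in> B \<Longrightarrow> x \<in> h \<Longrightarrow> bracket b x \<in> B"
    and AB: "A \<subset> B"
  shows "\<exists>v\<in>B - A. \<forall>x\<in>h. bracket v x \<in> A"
  using assms
proof (induction "dim h" arbitrary: h A B rule: less_induct)
  case less
  note h = less.prems(1-3) and nil = less.prems(4) and A = less.prems(5-7)
    and B = less.prems(8,9) and AB = less.prems(10)
  have IA: "x \<in> A" if "x \<in> I" for x using that I_subset_J A(2) by blast
  show ?case
  proof (cases "h = J")
    case True
    obtain v where "v \<in> B - A" using AB by blast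
    then show ?thesis using True bracket_J IA by blast
  next
    case False
    define P where "P g \<longleftrightarrow> subspace g \<and> J \<subseteq> g \<and> g \<subset> h \<and> (\<forall>x\<in>g. \<forall>y\<in>g. bracket x y \<in> g)" for g
    have "P J" unfolding P_def using False h(2) subspace_J bracket_J I_subset_J by auto
    then obtain g where Pg: "P g" and gmax: "\<And>g'. P g' \<Longrightarrow> dim g' \<le> dim g"
      using ex_max_dim[of P J] by blast
    have g: "subspace g" "J \<subseteq> g" "g \<subset> h" "\<And>x y. x \<in> g \<Longrightarrow> y \<in> g \<Longrightarrow> bracket x y \<in> g"
      using Pg unfolding P_def by auto
    have dimg: "dim g < dim h"
    proof (rule dim_psubset)
      have "span g = g" "span h = h" using g(1) h(1) by (simp_all only: span_eq_iff)
      then show "span g \<subset> span h" using g(3) by (simp only:)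
    qed
    have nilg: "nilpotent_mod x" if "x \<in> g" for x using nil that g(3) by blast
    have hg: "bracket b x \<in> h" if "b \<in> h" "x \<in> g" for b x using h(3) that g(3) by blast
    have Ag: "bracket a x \<in> A" if "a \<in> A" "x \<in> g" for a x using A(3) that g(3) by blast
    have Bg: "bracket b x \<in> B" if "b \<in> B" "x \<in> g" for b x using B(2) that g(3) by blast
    obtain v where v: "v \<in> h - g" "\<And>x. x \<in> g \<Longrightarrow> bracket v x \<in> g"
      using less.hyps[OF dimg g(1,2,4) nilg g(1,2,4) h(1) hg g(3)] by blast
    define g' where "g' = span (insert v g)"
    have g'E: "\<exists>c a. x = a + scale c v \<and> a \<in> g" if x: "x \<in> g'" for x
    proof -
      obtain c where "x - scale c v \<in> span g" using x unfolding g'_def span_insert by blast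
      then have "x - scale c v \<in> g" using g(1) by (simp only: span_eq_iff[THEN iffD2])
      moreover have "x = (x - scale c v) + scale c v" by simp
      ultimately show ?thesis by blast
    qed
    have sub': "subspace g'" unfolding g'_def by (rule subspace_span)
    have gg': "g \<subseteq> g'" "v \<in> g'" unfolding g'_def by (auto intro: span_base)
    have g'h: "g' \<subseteq> h" unfolding g'_def by (rule span_minimal) (use v g h in auto)
    have cl: "bracket x y \<in> g" if x: "x \<in> g'" and y: "y \<in> g'" for x y
    proof -
      obtain c a where xa: "x = a + scale c v" "a \<in> g" using g'E[OF x] by blast
      obtain d b where yb: "y = b + scale d v" "b \<in> g" using g'E[OF y] by blast
      have "bracket a v \<in> g" using antisym_mod[OF g(1,2)] v(2) xa(2) by blast
      moreover have "bracket v v \<in> g" using square_in_J g(2) by blast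
      ultimately show ?thesis unfolding xa yb
        using g(1,4) xa(2) yb(2) v(2) by (simp add: bracket_simps subspace_add subspace_scale)
    qed
    \<comment> \<open>Adjoining \<open>v\<close> to \<open>g\<close> gives a subalgebra, as even the
      brackets of \<open>g'\<close> lie in \<open>g\<close>; now \<open>g\<close> was
      maximal.\<close>
    have "g' = h"
    proof (rule ccontr)
      assume "g' \<noteq> h"
      then have "P g'" unfolding P_def using sub' g'h gg' g(2) cl by auto
      then have "dim g' \<le> dim g" by (rule gmax)
      then have "g = g'" using g(1) sub' gg'(1) subspace_dim_equal by blast
      then show False using v(1) gg'(2) by blast
    qed
    \<comment> \<open>The null vectors of \<open>g\<close> modulo \<open>A\<close>. By the Leibniz
      identity \<open>W\<close> is stable under \<open>v\<close>, because \<open>[v, g]\<close> lies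
      in \<open>g\<close>.\<close>
    define W where "W = {w \<in> B. \<forall>x\<in>g. bracket w x \<in> A}"
    obtain u where u: "u \<in> B - A" "\<And>x. x \<in> g \<Longrightarrow> bracket u x \<in> A"
      using less.hyps[OF dimg g(1,2,4) nilg A(1,2) Ag B(1) Bg AB] by blast
    have Wv: "bracket w v \<in> W" if w: "w \<in> W" for w
    proof -
      have "bracket (bracket w v) x \<in> A" if x: "x \<in> g" for x
      proof (rule leibniz_mod(1)[OF A(1)])
        show "I \<subseteq> A" using IA by blast
        show "bracket (bracket w x) v \<in> A" using w x v(1) A(3) unfolding W_def by blast
        show "bracket w (bracket v x) \<in> A" using w x v(2) unfolding W_def by blast
      qed
      then show ?thesis using w v(1) B(2) unfolding W_def by blast
    qed
    define it where "it k = ((\<lambda>y. bracket y v) ^^ k) u" for k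
    obtain k0 where "it k0 \<in> A"
      using nil[of v] v(1) A(2) unfolding nilpotent_mod_def it_def by blast
    \<comment> \<open>The last iterate of \<open>u\<close> under \<open>v\<close> outside
      \<open>A\<close> is a null vector for \<open>v\<close> as well as for
      \<open>g\<close>.\<close>
    define k where "k = (LEAST k. it k \<in> A)"
    have k: "it k \<in> A" unfolding k_def using \<open>it k0 \<in> A\<close> by (rule LeastI)
    have "it 0 \<notin> A" using u(1) by (simp add: it_def)
    then obtain k' where k': "k = Suc k'" using k by (cases k) auto
    have notA: "it k' \<notin> A" using not_less_Least[of k' "\<lambda>k. it k \<in> A"] k' unfolding k_def by simp
    have W: "it j \<in> W" for j
    proof (induction j)
      case 0 then show ?case using u by (simp add: it_def W_def)
    next
      case (Suc j) then show ?case using Wv by (simp add: it_def)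
    qed
    have "bracket (it k') x \<in> A" if xh: "x \<in> h" for x
    proof -
      obtain c a where xa: "x = a + scale c v" "a \<in> g" using g'E[of x] \<open>g' = h\<close> xh by blast
      have "bracket (it k') v \<in> A" using k unfolding k' it_def by simp
      moreover have "bracket (it k') a \<in> A" using W[of k'] xa(2) unfolding W_def by blast
      ultimately show ?thesis unfolding xa using A(1) by (simp add: bracket_simps subspace_add subspace_scale)
    qed
    then show ?thesis using notA W[of k'] unfolding W_def by blast
  qed
qed

text \<open>Take \<open>A\<close> maximal among the proper right-stable subspaces over
  \<open>J\<close>. Engel's theorem gives \<open>v\<close> outside \<open>A\<close> with
  \<open>[v, V]\<close> in \<open>A\<close>; by maximality \<open>V\<close> is \<open>A\<close> plus
  the line of \<open>v\<close>, so all brackets of \<open>V\<close> lie in \<open>A\<close>, against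
  perfectness.\<close>

lemma perfect_nilpotent:
  assumes V: "subspace V" "J \<subseteq> V" "\<And>x y. x \<in> V \<Longrightarrow> y \<in> V \<Longrightarrow> bracket x y \<in> V"
    and nil: "\<And>x. x \<in> V \<Longrightarrow> nilpotent_mod x"
    and perfect: "V \<subseteq> span ({bracket x y | x y. x \<in> V \<and> y \<in> V} \<union> J)"
  shows "V \<subseteq> J"
proof (rule ccontr)
  assume nJ: "\<not> V \<subseteq> J"
  define P where "P A \<longleftrightarrow> subspace A \<and> J \<subseteq> A \<and> A \<subset> V \<and> (\<forall>a\<in>A. \<forall>x\<in>V. bracket a x \<in> A)" for A
  have "P J" unfolding P_def using nJ V(2) subspace_J bracket_J I_subset_J by auto
  then obtain A where PA: "P A" and Amax: "\<And>A'. P A' \<Longrightarrow> dim A' \<le> dim A"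
    using ex_max_dim[of P J] by blast
  have A: "subspace A" "J \<subseteq> A" "A \<subset> V" "\<And>a x. a \<in> A \<Longrightarrow> x \<in> V \<Longrightarrow> bracket a x \<in> A"
    using PA unfolding P_def by auto
  obtain v where v: "v \<in> V - A" "\<And>x. x \<in> V \<Longrightarrow> bracket v x \<in> A"
    using engel_vector[OF V nil A(1,2,4) V(1,3) A(3)] by blast
  define A' where "A' = span (insert v A)"
  have sub': "subspace A'" unfolding A'_def by (rule subspace_span)
  have AA': "A \<subseteq> A'" "v \<in> A'" unfolding A'_def by (auto intro: span_base)
  have A'V: "A' \<subseteq> V" unfolding A'_def by (rule span_minimal) (use v A V in auto)
  have br: "bracket a x \<in> A" if "a \<in> A'" "x \<in> V" for a x
  proof -
    obtain c where "a - scale c v \<in> span A" using \<open>a \<in> A'\<close> unfolding A'_def span_insert by blast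
    then have "bracket (a - scale c v) x \<in> A"
      using A(1,4) that(2) by (simp only: span_eq_iff[THEN iffD2])
    then have "bracket (a - scale c v) x + scale c (bracket v x) \<in> A"
      using A(1) v(2)[OF that(2)] by (simp only: subspace_add subspace_scale)
    then show ?thesis by (simp add: bracket_simps)
  qed
  have "A' = V"
  proof (rule ccontr)
    assume "A' \<noteq> V"
    then have "P A'" unfolding P_def using sub' A'V AA' A(2) br by auto
    then have "dim A' \<le> dim A" by (rule Amax)
    then have "A = A'" using A(1) sub' AA'(1) subspace_dim_equal by blast
    then show False using v(1) AA'(2) by blast
  qed
  then have "span ({bracket x y | x y. x \<in> V \<and> y \<in> V} \<union> J) \<subseteq> A"
    using br A(1,2) by (intro span_minimal) auto
  then show False using perfect A(3) by blast
qed

lemma ideal_derived_J: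
  assumes V: "ideal V"
  shows "ideal (span ({bracket x y | x y. x \<in> V \<and> y \<in> V} \<union> J))" (is "ideal ?D")
proof (rule idealI)
  have sub: "subspace ?D" by (rule subspace_span)
  then show "subspace ?D" .
  have BD: "bracket x y \<in> ?D" if "x \<in> V" "y \<in> V" for x y
    using that by (auto intro: span_base)
  have JD: "J \<subseteq> ?D" by (auto intro: span_base)
  have ID: "I \<subseteq> ?D" using I_subset_J JD by blast
  fix z y assume z: "z \<in> ?D"
  show "bracket z y \<in> ?D" using z
  proof (induction z rule: span_induct_alt)
    case (step c b w)
    have "bracket b y \<in> ?D"
    proof (cases "b \<in> J")
      case False
      then obtain u v where uv: "b = bracket u v" "u \<in> V" "v \<in> V" using step by auto
      show ?thesis unfolding uv(1)
        by (rule leibniz_mod(1)[OF sub ID]) (use uv idealD[OF V] BD in auto)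
    qed (use bracket_J ID in blast)
    then show ?case using step sub by (simp add: bracket_simps subspace_add subspace_scale)
  qed (simp add: bracket_simps span_zero)
  show "bracket y z \<in> ?D" using z
  proof (induction z rule: span_induct_alt)
    case (step c b w)
    have "bracket y b \<in> ?D"
    proof (cases "b \<in> J")
      case False
      then obtain u v where uv: "b = bracket u v" "u \<in> V" "v \<in> V" using step by auto
      show ?thesis unfolding uv(1)
        by (rule leibniz_mod(2)[OF sub ID]) (use uv idealD[OF V] BD in auto)
    qed (use bracket_J ID in blast)
    then show ?case using step sub by (simp add: bracket_simps subspace_add subspace_scale)
  qed (simp add: bracket_simps span_zero)
qed

end

section \<open>The Killing form\<close>

text \<open>\<open>e\<close> is a basis of a complement of \<open>J\<close> and \<open>c\<close> are the coordinates modulo \<open>J\<close>, so \<open>rho\<close> and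
  \<open>kappa\<close> below are right multiplication on the quotient by \<open>J\<close> and its Killing form.\<close>

locale leibniz_extension_coordinates = leibniz_extension scale bracket Basis I J
  for scale :: "'k::field_char_0 \<Rightarrow> 'l::ab_group_add \<Rightarrow> 'l" and bracket and Basis :: "'l set" and I J +
  fixes n :: nat and e :: "nat \<Rightarrow> 'l" and c :: "nat \<Rightarrow> 'l \<Rightarrow> 'k"
  assumes c_linear: "Vector_Spaces.linear scale (*) (c i)"
    and J_iff: "x \<in> J \<longleftrightarrow> (\<forall>i<n. c i x = 0)"
    and c_expand: "x - (\<Sum>i<n. scale (c i x) (e i)) \<in> J"
    and c_e: "i < n \<Longrightarrow> j < n \<Longrightarrow> c i (e j) = (if i = j then 1 else 0)"
begin

lemma c_simps:
  "c i (x + y) = c i x + c i y" "c i (x - y) = c i x - c i y" "c i (- x) = - c i x"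
  "c i (scale a x) = a * c i x" "c i 0 = 0" "c i (\<Sum>j\<in>A. f j) = (\<Sum>j\<in>A. c i (f j))"
proof -
  interpret l: Vector_Spaces.linear scale "(*)" "c i" by (rule c_linear)
  show "c i (x + y) = c i x + c i y" "c i (x - y) = c i x - c i y" "c i (- x) = - c i x"
    "c i (scale a x) = a * c i x" "c i 0 = 0" "c i (\<Sum>j\<in>A. f j) = (\<Sum>j\<in>A. c i (f j))"
    by (rule l.add l.diff l.neg l.scale l.zero l.sum)+
qed

lemma c_J: "x \<in> J \<Longrightarrow> i < n \<Longrightarrow> c i x = 0" and c_I: "x \<in> I \<Longrightarrow> i < n \<Longrightarrow> c i x = 0"
  using J_iff I_subset_J by blast+

lemma c_bracket_expand:
  assumes j: "j < n"
  shows "c j (bracket y x) = (\<Sum>i<n. c i y * c j (bracket (e i) x))"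
proof -
  have "c j (bracket (y - (\<Sum>i<n. scale (c i y) (e i))) x) = 0"
    using bracket_J(1)[OF c_expand] c_I j by blast
  then show ?thesis by (simp add: bracket_simps c_simps)
qed

lemma c_leibniz:
  assumes "i < n"
  shows "c i (bracket x (bracket y z)) = c i (bracket (bracket x y) z) - c i (bracket (bracket x z) y)"
  using c_I[OF leibniz assms, of x y z] by (simp add: c_simps)

lemma c_antisym:
  assumes "i < n"
  shows "c i (bracket x y) = - c i (bracket y x)"
  using c_J[OF antisym_J assms, of x y] by (simp add: c_simps eq_neg_iff_add_eq_0)

text \<open>Images are rows, which suits operators acting on the right: \<open>rho x * rho y\<close>
  applies \<open>x\<close> first, and brackets become commutators without a sign.\<close>

definition rho :: "'l \<Rightarrow> 'k mat" where
  "rho x = mat n n (\<lambda>(i, j). c j (bracket (e i) x))"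

lemma rho_carrier [simp]: "rho x \<in> carrier_mat n n"
  by (simp add: rho_def)

lemma rho_index: "i < n \<Longrightarrow> j < n \<Longrightarrow> rho x $$ (i, j) = c j (bracket (e i) x)"
  by (simp add: rho_def)

lemma rho_mult_index:
  assumes "i < n" "j < n"
  shows "(rho x * rho y) $$ (i, j) = c j (bracket (bracket (e i) x) y)"
proof -
  have "(rho x * rho y) $$ (i, j) = (\<Sum>k<n. c k (bracket (e i) x) * c j (bracket (e k) y))"
    using assms by (simp add: mat_mult_index[of _ n] rho_index del: index_mult_mat)
  then show ?thesis using c_bracket_expand[OF assms(2), of "bracket (e i) x" y] by simp
qed

lemma rho_add: "rho (x + y) = rho x + rho y"
  by (rule eq_matI) (auto simp: rho_def bracket_simps c_simps)

lemma rho_scale: "rho (scale a x) = a \<cdot>\<^sub>m rho x"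
  by (rule eq_matI) (auto simp: rho_def bracket_simps c_simps)

lemma rho_J: "x \<in> J \<Longrightarrow> rho x = 0\<^sub>m n n"
  by (rule eq_matI) (auto simp: rho_def intro!: c_I bracket_J)

lemma rho_bracket: "rho (bracket x y) = mat_comm (rho x) (rho y)"
proof (rule eq_matI)
  fix i j assume "i < dim_row (mat_comm (rho x) (rho y))" "j < dim_col (mat_comm (rho x) (rho y))"
  then have ij: "i < n" "j < n" using mat_comm_carrier[OF rho_carrier rho_carrier, of x y] by auto
  have "mat_comm (rho x) (rho y) $$ (i, j) = (rho x * rho y) $$ (i, j) - (rho y * rho x) $$ (i, j)"
    unfolding mat_comm_def
    using ij carrier_matD[OF rho_carrier[of x]] carrier_matD[OF rho_carrier[of y]]
    by (simp del: index_mult_mat(1))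
  then show "rho (bracket x y) $$ (i, j) = mat_comm (rho x) (rho y) $$ (i, j)"
    using ij by (simp only: rho_mult_index rho_index c_leibniz)
qed (use carrier_matD[OF mat_comm_carrier[OF rho_carrier rho_carrier, of x y]]
    carrier_matD[OF rho_carrier[of "bracket x y"]] in simp_all)

lemma rho_bracket_pow: "(mat_comm (rho x) ^^ k) (rho y) = rho (((bracket x) ^^ k) y)"
  by (induction k) (simp_all add: rho_bracket)

lemma rho_pow_index:
  assumes "i < n" "j < n"
  shows "(rho x ^\<^sub>m k) $$ (i, j) = c j (((\<lambda>y. bracket y x) ^^ k) (e i))"
  using assms(2)
proof (induction k arbitrary: j)
  case 0
  then show ?case using assms(1) carrier_matD[OF rho_carrier[of x]] by (simp add: c_e)
next
  case (Suc k)
  have "(rho x ^\<^sub>m Suc k) $$ (i, j) = (\<Sum>l<n. (rho x ^\<^sub>m k) $$ (i, l) * rho x $$ (l, j))"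
    using mat_mult_index[OF pow_carrier_mat[OF rho_carrier] rho_carrier assms(1) Suc.prems] by simp
  also have "\<dots> = c j (bracket (((\<lambda>y. bracket y x) ^^ k) (e i)) x)"
    using Suc by (subst c_bracket_expand) (simp_all add: rho_index)
  finally show ?case by simp
qed

lemma nilpotent_mod_if_rho:
  assumes "rho x ^\<^sub>m n = 0\<^sub>m n n"
  shows "nilpotent_mod x"
proof -
  have lin: "Vector_Spaces.linear scale scale ((\<lambda>y. bracket y x) ^^ k)" for k
  proof (induction k)
    case 0 show ?case using linear_id by (simp add: id_def)
  next
    case (Suc k) then show ?case
      using Vector_Spaces.linear_compose[OF Suc bracket_linear(2)] by (simp add: o_def)
  qed
  interpret l: Vector_Spaces.linear scale scale "(\<lambda>y. bracket y x) ^^ n" by (rule lin)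
  have z: "((\<lambda>y. bracket y x) ^^ n) (e i) \<in> J" if "i < n" for i
    unfolding J_iff using rho_pow_index[OF that, of _ x n] assms that by simp
  have JJ: "((\<lambda>y. bracket y x) ^^ k) y \<in> J" if "y \<in> J" for y k
    by (induction k) (use that bracket_J I_subset_J in auto)
  have "((\<lambda>y. bracket y x) ^^ n) y \<in> J" for y
  proof -
    let ?s = "\<Sum>i<n. scale (c i y) (e i)"
    have "((\<lambda>y. bracket y x) ^^ n) ?s \<in> J"
      unfolding l.sum l.scale using z by (intro subspace_sum subspace_J subspace_scale) auto
    moreover have "((\<lambda>y. bracket y x) ^^ n) (y - ?s) \<in> J" by (rule JJ[OF c_expand])
    ultimately have "((\<lambda>y. bracket y x) ^^ n) (y - ?s) + ((\<lambda>y. bracket y x) ^^ n) ?s \<in> J"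
      using subspace_J by (simp only: subspace_add)
    then show ?thesis unfolding l.diff by simp
  qed
  then show ?thesis unfolding nilpotent_mod_def by blast
qed

definition kappa :: "'l \<Rightarrow> 'l \<Rightarrow> 'k" where
  "kappa x y = mat_trace (rho x * rho y)"

lemma kappa_sym: "kappa x y = kappa y x"
  unfolding kappa_def by (rule mat_trace_mult_commute[of _ n]) simp_all

lemma kappa_bracket: "kappa (bracket x y) z = kappa x (bracket y z)"
  unfolding kappa_def rho_bracket by (rule mat_trace_mat_comm[of _ n]) simp_all

lemma kappa_eq: "kappa x y = (\<Sum>i<n. c i (bracket (bracket (e i) x) y))"
  unfolding kappa_def mat_trace_def
  using carrier_matD[OF rho_carrier[of x]] by (simp add: rho_mult_index del: index_mult_mat(1))

lemma kappa_linear: "Vector_Spaces.linear scale (*) (\<lambda>y. kappa x y)"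
  by unfold_locales
    (simp_all add: kappa_eq bracket_simps c_simps sum.distrib sum_distrib_left ring_distribs)

lemma kappa_simps:
  "kappa x (y + z) = kappa x y + kappa x z" "kappa x (y - z) = kappa x y - kappa x z"
  "kappa x (scale a y) = a * kappa x y" "kappa x (\<Sum>j\<in>A. f j) = (\<Sum>j\<in>A. kappa x (f j))"
  "kappa x 0 = 0"
proof -
  interpret l: Vector_Spaces.linear scale "(*)" "kappa x" by (rule kappa_linear)
  show "kappa x (y + z) = kappa x y + kappa x z" "kappa x (y - z) = kappa x y - kappa x z"
    "kappa x (scale a y) = a * kappa x y" "kappa x (\<Sum>j\<in>A. f j) = (\<Sum>j\<in>A. kappa x (f j))"
    "kappa x 0 = 0"
    by (rule l.add l.diff l.scale l.sum l.zero)+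
qed

lemma kappa_simps_left:
  "kappa (y + z) x = kappa y x + kappa z x" "kappa (y - z) x = kappa y x - kappa z x"
  "kappa (scale a y) x = a * kappa y x" "kappa (\<Sum>j\<in>A. f j) x = (\<Sum>j\<in>A. kappa (f j) x)"
  "kappa 0 x = 0"
  using kappa_simps[of x] by (simp_all only: kappa_sym[of x])

lemma kappa_J: "x \<in> J \<Longrightarrow> kappa x y = 0" "x \<in> J \<Longrightarrow> kappa y x = 0"
proof -
  show 1: "kappa x y = 0" if "x \<in> J" for x y
  proof -
    have "rho x * rho y = 0\<^sub>m n n" using rho_J[OF that] left_mult_zero_mat[OF rho_carrier[of y]] by simp
    then show ?thesis by (simp add: kappa_def mat_trace_def)
  qed
  show "kappa y x = 0" if "x \<in> J" using 1[OF that, of y] kappa_sym[of y x] by simp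
qed

text \<open>If \<open>rho x\<close> were not nilpotent, there would be a form nonzero at
  \<open>rho x\<close> that vanishes at \<open>rho z\<close> for every \<open>z\<close> in the span
  of \<open>J\<close> and the brackets of \<open>V\<close>, hence for \<open>z = x\<close>. So
  \<open>V\<close> consists of nilpotent elements and Engel's theorem applies.\<close>

lemma cartan:
  assumes V: "ideal V" "J \<subseteq> V"
    and perfect: "V \<subseteq> span ({bracket x y | x y. x \<in> V \<and> y \<in> V} \<union> J)"
    and kappa0: "\<And>x y. x \<in> V \<Longrightarrow> y \<in> V \<Longrightarrow> kappa x y = 0"
  shows "V \<subseteq> J"
proof (rule perfect_nilpotent[OF idealD(1)[OF V(1)] V(2) idealD(2)[OF V(1)] _ perfect])
  fix x assume x: "x \<in> V"
  show "nilpotent_mod x"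
  proof (rule nilpotent_mod_if_rho, rule ccontr)
    assume "rho x ^\<^sub>m n \<noteq> 0\<^sub>m n n"
    then obtain f :: "'k mat \<Rightarrow> 'k alg_closure" where
      f: "\<And>A B. A \<in> carrier_mat n n \<Longrightarrow> B \<in> carrier_mat n n \<Longrightarrow> f (A + B) = f A + f B"
        "\<And>c A. A \<in> carrier_mat n n \<Longrightarrow> f (c \<cdot>\<^sub>m A) = to_ac c * f A"
        "f (rho x) \<noteq> 0"
        "\<And>A B. A \<in> carrier_mat n n \<Longrightarrow> B \<in> carrier_mat n n \<Longrightarrow>
          (\<And>k. k \<ge> 1 \<Longrightarrow> mat_trace ((mat_comm (rho x) ^^ k) A * B) = 0) \<Longrightarrow> f (mat_comm A B) = 0"
      using nilpotent_or_functional[OF rho_carrier] by blast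
    have f0: "f (0\<^sub>m n n) = 0" using f(1)[of "0\<^sub>m n n" "0\<^sub>m n n"] by simp
    have "f (rho z) = 0" if "z \<in> span ({bracket x y | x y. x \<in> V \<and> y \<in> V} \<union> J)" for z
      using that
    proof (induction rule: span_induct_alt)
      case base
      show ?case using rho_J[OF subspace_0[OF subspace_J]] f0 by simp
    next
      case (step a b w)
      have "f (rho b) = 0"
      proof (cases "b \<in> J")
        case False
        then obtain u v where uv: "b = bracket u v" "u \<in> V" "v \<in> V" using step by auto
        \<comment> \<open>By \<open>rho_bracket_pow\<close> the traces required by
          \<open>f(4)\<close> are values of \<open>kappa\<close> on \<open>V\<close>.\<close>
        have "((bracket x) ^^ k) u \<in> V" for k
          by (induction k) (use x uv idealD(2)[OF V(1)] in auto)
        then show ?thesis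
          unfolding uv(1) rho_bracket using kappa0 uv(3)
          by (intro f(4)) (simp_all add: rho_bracket_pow kappa_def[symmetric])
      qed (simp add: rho_J f0)
      then show ?case using step by (simp add: rho_add rho_scale f(1,2))
    qed
    then show False using f(3) perfect x by blast
  qed
qed

text \<open>The radical \<open>N\<close> of \<open>kappa\<close> is an ideal. A minimal ideal
  strictly above \<open>J\<close> inside \<open>N\<close> is perfect modulo \<open>J\<close>,
  because no ideal strictly above \<open>J\<close> is abelian modulo \<open>J\<close>; Cartan's
  criterion then puts it into \<open>J\<close>.\<close>

lemma kappa_nondegenerate:
  assumes "\<And>y. kappa x y = 0"
  shows "x \<in> J"
proof -
  define N where "N = {x. \<forall>y. kappa x y = 0}"
  define P where "P V \<longleftrightarrow> ideal V \<and> J \<subset> V \<and> V \<subseteq> N" for V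
  have JN: "J \<subseteq> N" using kappa_J by (auto simp: N_def)
  have "ideal N"
  proof (rule idealI)
    show "subspace N"
      unfolding N_def by (rule subspaceI) (simp_all add: kappa_simps_left)
    fix x y assume x: "x \<in> N"
    then show 1: "bracket x y \<in> N" unfolding N_def by (simp add: kappa_bracket)
    have "kappa (bracket y x) z = - kappa (bracket x y) z" for z
      using kappa_J(1)[OF antisym_J, of y x z] by (simp add: kappa_simps_left eq_neg_iff_add_eq_0)
    then show "bracket y x \<in> N" using 1 unfolding N_def by simp
  qed
  have "N = J"
  proof (rule ccontr)
    assume "N \<noteq> J"
    then have "P N" unfolding P_def using \<open>ideal N\<close> JN by blast
    then obtain V where PV: "P V" and min: "\<And>V'. P V' \<Longrightarrow> dim V \<le> dim V'"
      using ex_min_dim[of P N] by blast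
    have V: "ideal V" "J \<subset> V" "V \<subseteq> N" using PV unfolding P_def by auto
    define D where "D = span ({bracket x y | x y. x \<in> V \<and> y \<in> V} \<union> J)"
    have D: "ideal D" unfolding D_def by (rule ideal_derived_J[OF V(1)])
    have JD: "J \<subseteq> D" and BD: "\<And>x y. x \<in> V \<Longrightarrow> y \<in> V \<Longrightarrow> bracket x y \<in> D"
      unfolding D_def by (auto intro: span_base)
    have DV: "D \<subseteq> V" unfolding D_def
      by (rule span_minimal) (use V(2) idealD[OF V(1)] in auto)
    have "D \<noteq> J" using abelian_ideal[OF V(1)] BD V(2) by blast
    then have "P D" unfolding P_def using D JD DV V(3) by blast
    then have "D = V" using subspace_dim_equal[OF idealD(1)[OF D] idealD(1)[OF V(1)] DV] min by blast
    then have "V \<subseteq> J"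
      using V by (intro cartan) (auto simp: N_def D_def)
    then show False using V(2) by blast
  qed
  then show ?thesis using assms by (auto simp: N_def)
qed

text \<open>The coefficients of \<open>d i\<close> form a column of the inverse Gram matrix of
  \<open>e\<close>; a kernel vector of the Gram matrix would give an element orthogonal to
  everything.\<close>

lemma dual_basis:
  obtains d :: "nat \<Rightarrow> 'l" where "\<And>x i. i < n \<Longrightarrow> kappa x (d i) = c i x"
proof -
  have kx: "kappa x y = (\<Sum>k<n. c k x * kappa (e k) y)" for x y
  proof -
    have "kappa (x - (\<Sum>k<n. scale (c k x) (e k))) y = 0" by (rule kappa_J(1)[OF c_expand])
    then show ?thesis by (simp add: kappa_simps_left)
  qed
  define G where "G = mat n n (\<lambda>(i, j). kappa (e i) (e j))"
  have G: "G \<in> carrier_mat n n" by (simp add: G_def)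
  have "det G \<noteq> 0"
  proof
    assume "det G = 0"
    then obtain v where v: "v \<in> carrier_vec n" "v \<noteq> 0\<^sub>v n" "G *\<^sub>v v = 0\<^sub>v n"
      using det_0_iff_vec_prod_zero_field[OF G] by blast
    define x where "x = (\<Sum>j<n. scale (v $ j) (e j))"
    have "kappa (e i) x = 0" if "i < n" for i
    proof -
      have "(G *\<^sub>v v) $ i = (\<Sum>j<n. kappa (e i) (e j) * v $ j)"
        using that v(1) by (simp add: G_def scalar_prod_def atLeast0LessThan)
      then show ?thesis using v(3) that by (simp add: x_def kappa_simps mult.commute)
    qed
    then have "kappa x y = 0" for y
      using kx[of y x] kappa_sym[of x y] by simp
    then have xJ: "x \<in> J" by (rule kappa_nondegenerate)
    have "v $ i = 0" if "i < n" for i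
    proof -
      have "c i x = (\<Sum>j<n. if j = i then v $ i else 0)"
        unfolding x_def c_simps using that by (intro sum.cong) (auto simp: c_e)
      then show ?thesis using xJ that c_J by simp
    qed
    then show False using v by (metis carrier_vecD eq_vecI index_zero_vec)
  qed
  from det_non_zero_imp_unit[OF G this, of "()"] obtain H where
    H: "H \<in> carrier_mat n n" "G * H = 1\<^sub>m n"
    unfolding Units_def by (auto simp: ring_mat_def)
  define d where "d i = (\<Sum>j<n. scale (H $$ (j, i)) (e j))" for i
  have "kappa (e k) (d i) = (if k = i then 1 else 0)" if "k < n" "i < n" for k i
  proof -
    have "kappa (e k) (d i) = (\<Sum>j<n. G $$ (k, j) * H $$ (j, i))"
      unfolding d_def kappa_simps using that by (intro sum.cong) (auto simp: G_def)
    also have "\<dots> = (G * H) $$ (k, i)" using mat_mult_index[OF G H(1) that] by simp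
    finally show ?thesis using H(2) that by simp
  qed
  then have "kappa x (d i) = c i x" if "i < n" for x i
    using that by (simp add: kx[of x "d i"] if_distrib[of "\<lambda>t. _ * t"] cong: if_cong)
  then show thesis using that by blast
qed

end

section \<open>The Casimir operator\<close>

context leibniz_extension_coordinates
begin

text \<open>A linear map sending \<open>J\<close> into \<open>I\<close> depends, modulo
  \<open>I\<close>, only on coordinates modulo \<open>J\<close>. It is applied with both dual bases,
  hence the general \<open>a\<close> and \<open>u\<close>.\<close>

lemma bracket_expand_mod_I:
  assumes p: "Vector_Spaces.linear scale (*) p" and pI: "\<And>x. x \<in> I \<Longrightarrow> p x = 0"
    and f: "Vector_Spaces.linear scale scale f" and fJ: "\<And>x. x \<in> J \<Longrightarrow> f x \<in> I"
    and xJ: "x - (\<Sum>i<n. scale (a i) (u i)) \<in> J"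
  shows "p (f x) = (\<Sum>i<n. a i * p (f (u i)))"
proof -
  interpret p: Vector_Spaces.linear scale "(*)" p by (fact p)
  interpret f: Vector_Spaces.linear scale scale f by (fact f)
  have "p (f (x - (\<Sum>i<n. scale (a i) (u i)))) = 0" using pI fJ xJ by blast
  then show ?thesis by (simp add: f.diff f.sum f.scale p.diff p.sum p.scale)
qed

text \<open>The Casimir operator is formed with the Killing form itself; with this normalisation it
  acts on the adjoint module exactly as the identity.\<close>

lemma derived_inter_J_aux:
  assumes x: "x \<in> span {bracket a b | a b. True}" and xJ: "x \<in> J"
  shows "x \<in> I"
proof -
  obtain d where d: "\<And>x i. i < n \<Longrightarrow> kappa x (d i) = c i x" using dual_basis by blast
  have d_expand: "y - (\<Sum>i<n. scale (kappa y (e i)) (d i)) \<in> J" for y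
  proof (rule kappa_nondegenerate)
    fix z
    let ?w = "y - (\<Sum>i<n. scale (kappa y (e i)) (d i))"
    have "kappa ?w (e j) = 0" if j: "j < n" for j
    proof -
      have "(\<Sum>i<n. kappa y (e i) * kappa (d i) (e j)) = (\<Sum>i<n. if i = j then kappa y (e j) else 0)"
        using j by (intro sum.cong) (auto simp: kappa_sym[of _ "e j"] d c_e)
      then show ?thesis using j by (simp add: kappa_simps_left)
    qed
    moreover have "kappa ?w (z - (\<Sum>j<n. scale (c j z) (e j))) = 0" by (rule kappa_J(2)[OF c_expand])
    ultimately show "kappa ?w z = 0" by (simp only: kappa_simps) simp
  qed
  define C where "C x = (\<Sum>i<n. bracket (bracket x (e i)) (d i))" for x
  have C_add: "C (x + y) = C x + C y" and C_scale: "C (scale a x) = scale a (C x)" for x y a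
    by (simp_all add: C_def bracket_simps sum.distrib scale_sum_right)
  have C_mod_J: "C x - x \<in> J" for x
  proof (rule kappa_nondegenerate)
    fix y
    \<comment> \<open>Invariance and antisymmetry turn the \<open>i\<close>-th term of the Casimir
      sum into a diagonal entry of \<open>rho x * rho y\<close>; summing gives the trace.\<close>
    have "kappa (bracket (bracket x (e i)) (d i)) y = c i (bracket (bracket (e i) x) y)" if i: "i < n" for i
    proof -
      have "kappa (bracket (bracket x (e i)) (d i)) y = kappa (bracket (d i) y) (bracket x (e i))"
        by (rule trans[OF kappa_bracket kappa_sym])
      also have "\<dots> = c i (bracket y (bracket x (e i)))"
        by (rule trans[OF kappa_bracket trans[OF kappa_sym d[OF i]]])
      also have "\<dots> = - c i (bracket (bracket x (e i)) y)" by (rule c_antisym[OF i])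
      also have "\<dots> = c i (bracket (bracket (e i) x) y)"
        using c_I[OF bracket_J(1)[OF antisym_J] i, of x "e i" y]
        by (simp add: bracket_simps c_simps add_eq_0_iff)
      finally show ?thesis .
    qed
    then have "kappa (C x) y = kappa x y"
      unfolding C_def kappa_simps_left kappa_eq[of x y] by (intro sum.cong) auto
    then show "kappa (C x - x) y = 0" by (simp add: kappa_simps_left)
  qed
  have C_bracket: "bracket (C a) b - C (bracket a b) \<in> I" for a b
  proof (rule in_subspace_if_functionals[OF subspace_I])
    fix p :: "'l \<Rightarrow> 'k"
    assume p: "Vector_Spaces.linear scale (*) p" and pI: "\<And>x. x \<in> I \<Longrightarrow> p x = 0"
    interpret p: Vector_Spaces.linear scale "(*)" p by (fact p)
    define \<beta> where "\<beta> u v = p (bracket (bracket a u) v)" for u v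
    have lb: "p (bracket (bracket x y) z) = p (bracket (bracket x z) y) + p (bracket x (bracket y z))" for x y z
      using pI[OF leibniz[of x y z]] by (simp add: p.diff diff_eq_eq add.commute)
    \<comment> \<open>Move \<open>b\<close> leftwards past \<open>v\<close> and then past
      \<open>u\<close>; each exchange leaves one correction term.\<close>
    have step: "p (bracket (bracket (bracket a u) v) b)
        = p (bracket (bracket (bracket a b) u) v) + (\<beta> (bracket u b) v + \<beta> u (bracket v b))" for u v
    proof -
      have "bracket (bracket (bracket a u) b - bracket (bracket a b) u - bracket a (bracket u b)) v \<in> I"
        by (rule bracket_J(1)[OF subsetD[OF I_subset_J leibniz]])
      from pI[OF this] have "p (bracket (bracket (bracket a u) b) v)
          = p (bracket (bracket (bracket a b) u) v) + \<beta> (bracket u b) v"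
        by (simp add: \<beta>_def bracket_simps p.diff diff_eq_eq add.commute)
      then show ?thesis using lb[of "bracket a u" v b] by (simp add: \<beta>_def)
    qed
    have left: "\<beta> (bracket (e i) b) (d i) = (\<Sum>k<n. c k (bracket (e i) b) * \<beta> (e k) (d i))" for i
      unfolding \<beta>_def
    proof (rule bracket_expand_mod_I[OF p pI, where f = "\<lambda>u. bracket (bracket a u) (d i)"])
      show "Vector_Spaces.linear scale scale (\<lambda>u. bracket (bracket a u) (d i))"
        using Vector_Spaces.linear_compose[OF bracket_linear(1) bracket_linear(2), of "d i" a] by (simp add: o_def)
      show "bracket (bracket a u) (d i) \<in> I" if "u \<in> J" for u
        by (rule bracket_J(1)[OF subsetD[OF I_subset_J bracket_J(2)[OF that]]])
    qed (assumption, rule c_expand)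
    have right: "\<beta> (e i) (bracket (d i) b) = (\<Sum>k<n. kappa (bracket (d i) b) (e k) * \<beta> (e i) (d k))" for i
      unfolding \<beta>_def
    proof (rule bracket_expand_mod_I[OF p pI, where f = "\<lambda>u. bracket (bracket a (e i)) u"])
      show "bracket (bracket a (e i)) u \<in> I" if "u \<in> J" for u
        by (rule bracket_J(2)[OF that])
    qed (assumption, rule bracket_linear, rule d_expand)
    \<comment> \<open>The matrices of right multiplication by \<open>b\<close> in the two dual bases
      are negative transposes of each other, so the correction terms cancel in the sum.\<close>
    have swap: "kappa (bracket (d i) b) (e k) = - c i (bracket (e k) b)" if i: "i < n" for i k
    proof -
      have "kappa (bracket (d i) b) (e k) = c i (bracket b (e k))"
        by (rule trans[OF kappa_bracket trans[OF kappa_sym d[OF i]]])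
      then show ?thesis using c_antisym[OF i, of b "e k"] by simp
    qed
    have "(\<Sum>i<n. \<beta> (e i) (bracket (d i) b)) = (\<Sum>i<n. \<Sum>k<n. - c i (bracket (e k) b) * \<beta> (e i) (d k))"
      unfolding right by (intro sum.cong refl) (simp add: swap)
    also have "\<dots> = (\<Sum>k<n. \<Sum>i<n. - c i (bracket (e k) b) * \<beta> (e i) (d k))"
      by (rule sum.swap)
    also have "\<dots> = - (\<Sum>k<n. \<Sum>i<n. c i (bracket (e k) b) * \<beta> (e i) (d k))"
      by (simp only: mult_minus_left sum_negf)
    also have "\<dots> = - (\<Sum>i<n. \<beta> (bracket (e i) b) (d i))" unfolding left ..
    finally have "(\<Sum>i<n. \<beta> (bracket (e i) b) (d i) + \<beta> (e i) (bracket (d i) b)) = 0"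
      by (simp add: sum.distrib)
    then have "p (bracket (C a) b) = p (C (bracket a b))"
      by (simp add: C_def bracket_simps p.sum step sum.distrib)
    then show "p (bracket (C a) b - C (bracket a b)) = 0" by (simp add: p.diff)
  qed
  have C_mod_I: "C y - y \<in> I" if "y \<in> span {bracket a b | a b. True}" for y
    using that
  proof (induction rule: span_induct_alt)
    case base
    show ?case using subspace_0[OF subspace_I] by (simp add: C_def bracket_simps)
  next
    case (step r y w)
    then obtain a b where y: "y = bracket a b" by blast
    \<comment> \<open>\<open>[C a, b]\<close> and \<open>[a, b]\<close> agree modulo
      \<open>I\<close> since \<open>C a - a\<close> lies in \<open>J\<close>.\<close>
    have "bracket (C a - a) b - (bracket (C a) b - C (bracket a b)) \<in> I"
      by (rule subspace_diff[OF subspace_I bracket_J(1)[OF C_mod_J] C_bracket])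
    then have "C y - y \<in> I" unfolding y by (simp add: bracket_simps)
    then have "scale r (C y - y) + (C w - w) \<in> I"
      using step subspace_I by (simp only: subspace_add subspace_scale)
    then show ?case by (simp add: C_add C_scale scale_right_diff_distrib add_diff_add)
  qed
  have "C x \<in> I"
    unfolding C_def
    by (intro subspace_sum[OF subspace_I]) (rule bracket_J(1)[OF subsetD[OF I_subset_J bracket_J(1)[OF xJ]]])
  then have "C x - (C x - x) \<in> I" using C_mod_I[OF x] subspace_I by (simp only: subspace_diff)
  then show ?thesis by simp
qed

end

theorem (in leibniz_extension) derived_inter_J:
  assumes "x \<in> span {bracket a b | a b. True}" "x \<in> J"
  shows "x \<in> I"
proof (rule quotient_coordinates[OF subspace_J])
  fix n :: nat and e and c :: "nat \<Rightarrow> 'l \<Rightarrow> 'k"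
  assume "\<And>i. Vector_Spaces.linear scale (*) (c i)"
    "\<And>x. x \<in> J \<longleftrightarrow> (\<forall>i<n. c i x = 0)" "\<And>x. x - (\<Sum>i<n. scale (c i x) (e i)) \<in> J"
    "\<And>i j. i < n \<Longrightarrow> j < n \<Longrightarrow> c i (e j) = (if i = j then 1 else 0)"
  then interpret leibniz_extension_coordinates scale bracket Basis I J n e c
    by (intro leibniz_extension_coordinates.intro leibniz_extension_coordinates_axioms.intro
        leibniz_extension_axioms)
  show ?thesis using assms by (rule derived_inter_J_aux)
qed

section \<open>Solvable ideals of a central extension\<close>

context leibniz_extension
begin

lemma subspace_derived: "subspace V \<Longrightarrow> subspace (derived n V)"
  by (cases n) (simp_all add: bracket_prod_def)

lemma span_Un_decomp:
  assumes "subspace S" "z \<in> span (S \<union> J)"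
  obtains s j where "z = s + j" "s \<in> S" "j \<in> J"
proof -
  have "span (S \<union> J) = {s + j | s j. s \<in> S \<and> j \<in> J}"
    using span_Un[of S J] span_eq_iff[THEN iffD2, OF assms(1)] span_eq_iff[THEN iffD2, OF subspace_J] by simp
  then show thesis using assms(2) that by auto
qed

text \<open>\<open>W\<close> is the derived series of \<open>V + J\<close> with \<open>J\<close>
  added at every step, so each \<open>W n\<close> is an ideal containing \<open>J\<close>. It
  reaches \<open>J\<close> when the series of \<open>V\<close> vanishes; going back, each
  \<open>W k\<close> is abelian modulo \<open>J\<close> and hence inside \<open>J\<close>.\<close>

lemma solvable_ideal_subset_J:
  assumes V: "ideal V" and sol: "solvable V"
  shows "V \<subseteq> J"
proof -
  define W where "W = rec_nat (span (V \<union> J)) (\<lambda>_ W. span ({bracket x y | x y. x \<in> W \<and> y \<in> W} \<union> J))"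
  have W0: "W 0 = span (V \<union> J)" and WS: "W (Suc n) = span ({bracket x y | x y. x \<in> W n \<and> y \<in> W n} \<union> J)" for n
    by (simp_all add: W_def)
  note subV = idealD(1)[OF V]
  have "ideal (W 0)"
  proof (rule idealI)
    show sub: "subspace (W 0)" unfolding W0 by (rule subspace_span)
    have VW: "V \<subseteq> W 0" "J \<subseteq> W 0" unfolding W0 by (auto intro: span_base)
    fix x y assume "x \<in> W 0"
    then obtain v j where vj: "x = v + j" "v \<in> V" "j \<in> J" unfolding W0 by (rule span_Un_decomp[OF subV])
    have "bracket v y \<in> W 0" "bracket y v \<in> W 0" using idealD(2,3)[OF V vj(2)] VW by blast+
    moreover have "bracket j y \<in> W 0" "bracket y j \<in> W 0"
      using bracket_J[OF vj(3)] I_subset_J VW by blast+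
    ultimately show "bracket x y \<in> W 0" "bracket y x \<in> W 0"
      unfolding vj(1) using sub by (simp_all add: bracket_simps subspace_add)
  qed
  then have idW: "ideal (W n)" for n
    by (induction n) (simp_all only: WS ideal_derived_J)
  have Wsub: "W n \<subseteq> span (derived n V \<union> J)" for n
  proof (induction n)
    case (Suc n)
    show ?case unfolding WS
    proof (rule span_minimal[OF _ subspace_span], rule Un_least, rule subsetI)
      fix z assume "z \<in> {bracket x y | x y. x \<in> W n \<and> y \<in> W n}"
      then obtain x y where z: "z = bracket x y" and xy: "x \<in> span (derived n V \<union> J)" "y \<in> span (derived n V \<union> J)"
        using Suc by blast
      obtain s j where x: "x = s + j" "s \<in> derived n V" "j \<in> J"
        using span_Un_decomp[OF subspace_derived[OF subV] xy(1)] by blast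
      obtain s' j' where y: "y = s' + j'" "s' \<in> derived n V" "j' \<in> J"
        using span_Un_decomp[OF subspace_derived[OF subV] xy(2)] by blast
      let ?S = "span (derived (Suc n) V \<union> J)"
      have JS: "u \<in> ?S" if "u \<in> I" for u using that I_subset_J by (auto intro: span_base)
      have "bracket s s' \<in> derived (Suc n) V"
        using x(2) y(2) by (auto simp: bracket_prod_def intro: span_base)
      then have "bracket s s' \<in> ?S" by (auto intro: span_base)
      moreover have "bracket s j' \<in> ?S" "bracket j y \<in> ?S"
        using JS bracket_J x(3) y(3) by blast+
      ultimately have "bracket s s' + bracket s j' + bracket j y \<in> ?S" by (intro span_add)
      moreover have "z = bracket s s' + bracket s j' + bracket j y"
        by (simp add: z x(1) y(1) bracket_simps add_ac)
      ultimately show "z \<in> ?S" by (simp only:)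
    next
      show "J \<subseteq> span (derived (Suc n) V \<union> J)" by (auto intro: span_base)
    qed
  qed (simp add: W0)
  obtain k where k: "derived k V = {0}" using sol unfolding solvable_def by blast
  have Wk: "W k \<subseteq> J"
  proof -
    have "span ({0} \<union> J) \<subseteq> J" using subspace_J by (intro span_minimal) (auto intro: subspace_0)
    then show ?thesis using Wsub[of k] k by simp
  qed
  have "W 0 \<subseteq> J" using Wk
  proof (induction k)
    case (Suc k)
    have "W k \<subseteq> J"
    proof (rule abelian_ideal[OF idW])
      fix x y assume "x \<in> W k" "y \<in> W k"
      then have "bracket x y \<in> W (Suc k)" unfolding WS by (auto intro: span_base)
      then show "bracket x y \<in> J" using Suc.prems by blast
    qed
    then show ?case by (rule Suc.IH)
  qed
  then show ?thesis unfolding W0 by (auto intro: span_base)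
qed

end

section \<open>The radical of a Leibniz triple system\<close>

context leibniz_triple_system
begin

lemma triple_simps:
  "\<lbrace>x + y, b, c\<rbrace> = \<lbrace>x, b, c\<rbrace> + \<lbrace>y, b, c\<rbrace>" "\<lbrace>a, x + y, c\<rbrace> = \<lbrace>a, x, c\<rbrace> + \<lbrace>a, y, c\<rbrace>"
  "\<lbrace>a, b, x + y\<rbrace> = \<lbrace>a, b, x\<rbrace> + \<lbrace>a, b, y\<rbrace>"
  "\<lbrace>x - y, b, c\<rbrace> = \<lbrace>x, b, c\<rbrace> - \<lbrace>y, b, c\<rbrace>" "\<lbrace>a, x - y, c\<rbrace> = \<lbrace>a, x, c\<rbrace> - \<lbrace>a, y, c\<rbrace>"
  "\<lbrace>a, b, x - y\<rbrace> = \<lbrace>a, b, x\<rbrace> - \<lbrace>a, b, y\<rbrace>"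
  "\<lbrace>scale r x, b, c\<rbrace> = scale r \<lbrace>x, b, c\<rbrace>" "\<lbrace>a, scale r x, c\<rbrace> = scale r \<lbrace>a, x, c\<rbrace>"
  "\<lbrace>a, b, scale r x\<rbrace> = scale r \<lbrace>a, b, x\<rbrace>"
  "\<lbrace>0, b, c\<rbrace> = 0" "\<lbrace>a, 0, c\<rbrace> = 0" "\<lbrace>a, b, 0\<rbrace> = 0"
proof -
  have l: "Vector_Spaces.linear scale scale (\<lambda>x. \<lbrace>x, b, c\<rbrace>)" "Vector_Spaces.linear scale scale (\<lambda>x. \<lbrace>a, x, c\<rbrace>)"
    "Vector_Spaces.linear scale scale (\<lambda>x. \<lbrace>a, b, x\<rbrace>)" for a b c
    using trilinear unfolding trilinear_op_def by blast+
  interpret l1: Vector_Spaces.linear scale scale "\<lambda>x. \<lbrace>x, b, c\<rbrace>" by (rule l)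
  interpret l2: Vector_Spaces.linear scale scale "\<lambda>x. \<lbrace>a, x, c\<rbrace>" by (rule l)
  interpret l3: Vector_Spaces.linear scale scale "\<lambda>x. \<lbrace>a, b, x\<rbrace>" by (rule l)
  show "\<lbrace>x + y, b, c\<rbrace> = \<lbrace>x, b, c\<rbrace> + \<lbrace>y, b, c\<rbrace>" "\<lbrace>a, x + y, c\<rbrace> = \<lbrace>a, x, c\<rbrace> + \<lbrace>a, y, c\<rbrace>"
    "\<lbrace>a, b, x + y\<rbrace> = \<lbrace>a, b, x\<rbrace> + \<lbrace>a, b, y\<rbrace>"
    "\<lbrace>x - y, b, c\<rbrace> = \<lbrace>x, b, c\<rbrace> - \<lbrace>y, b, c\<rbrace>" "\<lbrace>a, x - y, c\<rbrace> = \<lbrace>a, x, c\<rbrace> - \<lbrace>a, y, c\<rbrace>"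
    "\<lbrace>a, b, x - y\<rbrace> = \<lbrace>a, b, x\<rbrace> - \<lbrace>a, b, y\<rbrace>"
    "\<lbrace>scale r x, b, c\<rbrace> = scale r \<lbrace>x, b, c\<rbrace>" "\<lbrace>a, scale r x, c\<rbrace> = scale r \<lbrace>a, x, c\<rbrace>"
    "\<lbrace>a, b, scale r x\<rbrace> = scale r \<lbrace>a, b, x\<rbrace>"
    "\<lbrace>0, b, c\<rbrace> = 0" "\<lbrace>a, 0, c\<rbrace> = 0" "\<lbrace>a, b, 0\<rbrace> = 0"
    by (rule l1.add l2.add l3.add l1.diff l2.diff l3.diff l1.scale l2.scale l3.scale l1.zero l2.zero l3.zero)+
qed

lemma triple_prod_mem: "a \<in> A \<Longrightarrow> b \<in> B \<Longrightarrow> c \<in> C \<Longrightarrow> \<lbrace>a, b, c\<rbrace> \<in> triple_prod A B C"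
  unfolding triple_prod_def by (rule span_base) blast

lemma triple_prod_least:
  "subspace S \<Longrightarrow> (\<And>a b c. a \<in> A \<Longrightarrow> b \<in> B \<Longrightarrow> c \<in> C \<Longrightarrow> \<lbrace>a, b, c\<rbrace> \<in> S) \<Longrightarrow> triple_prod A B C \<subseteq> S"
  unfolding triple_prod_def by (rule span_minimal) blast+

lemma zero_in_triple_prod: "0 \<in> triple_prod A B C"
  unfolding triple_prod_def by (rule span_zero)

lemma sum3_least:
  "subspace S \<Longrightarrow> A \<subseteq> S \<Longrightarrow> B \<subseteq> S \<Longrightarrow> C \<subseteq> S \<Longrightarrow> A + B + C \<subseteq> S"
  unfolding set_plus_def by (auto intro!: subspace_add)

lemma sum3_mem:
  assumes "(0::'v) \<in> A" "0 \<in> B" "0 \<in> C"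
  shows "x \<in> A \<Longrightarrow> x \<in> A + B + C" "x \<in> B \<Longrightarrow> x \<in> A + B + C" "x \<in> C \<Longrightarrow> x \<in> A + B + C"
  using assms set_plus_intro[of x A 0 B] set_plus_intro[of 0 A x B] set_plus_intro[of 0 A 0 B]
    set_plus_intro[of x "A + B" 0 C] set_plus_intro[of 0 "A + B" x C] by simp_all

lemma idealI:
  assumes "subspace I" "\<And>x a b. x \<in> I \<Longrightarrow> \<lbrace>x, a, b\<rbrace> \<in> I" "\<And>x a b. x \<in> I \<Longrightarrow> \<lbrace>a, x, b\<rbrace> \<in> I"
    "\<And>x a b. x \<in> I \<Longrightarrow> \<lbrace>a, b, x\<rbrace> \<in> I"
  shows "ideal I"
  unfolding ideal_def using assms by (intro conjI sum3_least triple_prod_least) auto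

lemma idealD:
  assumes "ideal I"
  shows "subspace I" "x \<in> I \<Longrightarrow> \<lbrace>x, a, b\<rbrace> \<in> I" "x \<in> I \<Longrightarrow> \<lbrace>a, x, b\<rbrace> \<in> I" "x \<in> I \<Longrightarrow> \<lbrace>a, b, x\<rbrace> \<in> I"
proof -
  note z = sum3_mem[OF zero_in_triple_prod zero_in_triple_prod zero_in_triple_prod]
  have *: "x \<in> I" if "x \<in> triple_prod I UNIV UNIV + triple_prod UNIV I UNIV + triple_prod UNIV UNIV I" for x
    using assms that unfolding ideal_def by blast
  show "subspace I" using assms unfolding ideal_def by simp
  show "x \<in> I \<Longrightarrow> \<lbrace>x, a, b\<rbrace> \<in> I" by (rule *, rule z(1), rule triple_prod_mem) auto
  show "x \<in> I \<Longrightarrow> \<lbrace>a, x, b\<rbrace> \<in> I" by (rule *, rule z(2), rule triple_prod_mem) auto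
  show "x \<in> I \<Longrightarrow> \<lbrace>a, b, x\<rbrace> \<in> I" by (rule *, rule z(3), rule triple_prod_mem) auto
qed

lemma derived_Suc_mem:
  assumes "x \<in> derived n I" "y \<in> derived n I"
  shows "\<lbrace>a, x, y\<rbrace> \<in> derived (Suc n) I" "\<lbrace>x, a, y\<rbrace> \<in> derived (Suc n) I" "\<lbrace>x, y, a\<rbrace> \<in> derived (Suc n) I"
proof -
  note z = sum3_mem[OF zero_in_triple_prod zero_in_triple_prod zero_in_triple_prod]
  show "\<lbrace>a, x, y\<rbrace> \<in> derived (Suc n) I" unfolding derived.simps using assms by (intro z(1) triple_prod_mem UNIV_I)
  show "\<lbrace>x, a, y\<rbrace> \<in> derived (Suc n) I" unfolding derived.simps using assms by (intro z(2) triple_prod_mem UNIV_I)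
  show "\<lbrace>x, y, a\<rbrace> \<in> derived (Suc n) I" unfolding derived.simps using assms by (intro z(3) triple_prod_mem UNIV_I)
qed

lemma derived_Suc_least:
  assumes "subspace S" "\<And>a x y. x \<in> derived n I \<Longrightarrow> y \<in> derived n I \<Longrightarrow> \<lbrace>a, x, y\<rbrace> \<in> S"
    "\<And>a x y. x \<in> derived n I \<Longrightarrow> y \<in> derived n I \<Longrightarrow> \<lbrace>x, a, y\<rbrace> \<in> S"
    "\<And>a x y. x \<in> derived n I \<Longrightarrow> y \<in> derived n I \<Longrightarrow> \<lbrace>x, y, a\<rbrace> \<in> S"
  shows "derived (Suc n) I \<subseteq> S"
  unfolding derived.simps using assms by (intro sum3_least triple_prod_least) auto

lemma subspace_derived:
  assumes "subspace I"
  shows "subspace (derived n I)"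
proof (cases n)
  case (Suc m)
  have "subspace (A + B)" if "subspace A" "subspace B" for A B :: "'v set"
    using subspace_sums[OF that] unfolding set_plus_def by (simp add: conj_commute Bex_def ac_simps)
  then show ?thesis unfolding Suc derived.simps triple_prod_def by simp
qed (use assms in simp)

text \<open>Multiplying a generator of the next term by two elements of \<open>T\<close> gives
  nested products, and the axioms rewrite these as left-nested products
  \<open>{{p, q, s}, u, v}\<close>. The core is that such a product lies in \<open>Q\<close> as soon
  as two of \<open>p\<close>, \<open>q\<close>, \<open>s\<close> lie in \<open>D\<close>.\<close>

lemma ideal_derived:
  assumes I: "ideal I"
  shows "ideal (derived n I)"
proof (induction n)
  case (Suc n)
  define D where "D = derived n I"
  define Q where "Q = derived (Suc n) I"
  have D: "ideal D" using Suc by (simp add: D_def)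
  have Q: "subspace Q" unfolding Q_def by (rule subspace_derived[OF idealD(1)[OF I]])
  have q: "\<lbrace>a, x, y\<rbrace> \<in> Q" "\<lbrace>x, a, y\<rbrace> \<in> Q" "\<lbrace>x, y, a\<rbrace> \<in> Q" if "x \<in> D" "y \<in> D" for a x y
    using derived_Suc_mem[of x n I y a] that unfolding Q_def D_def by auto
  note d = idealD(2,3,4)[OF D]
  note s = subspace_add[OF Q] subspace_diff[OF Q]
  \<comment> \<open>The axioms solved for a left-nested product. In the facts below the digits name
    the inner slots lying in \<open>D\<close>: \<open>r\<close> settles \<open>f13\<close> and
    \<open>f23\<close>, while \<open>f12\<close> needs \<open>m\<close>, which leads back to
    \<open>f13\<close>.\<close>
  have r: "\<lbrace>\<lbrace>p, q, s\<rbrace>, u, v\<rbrace> = \<lbrace>p, q, \<lbrace>s, u, v\<rbrace>\<rbrace> + \<lbrace>\<lbrace>p, q, u\<rbrace>, s, v\<rbrace> + \<lbrace>\<lbrace>p, q, v\<rbrace>, s, u\<rbrace> - \<lbrace>\<lbrace>p, q, v\<rbrace>, u, s\<rbrace>" for p q s u v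
    unfolding triple_right by (simp add: algebra_simps)
  have m: "\<lbrace>\<lbrace>p, q, s\<rbrace>, u, v\<rbrace> = \<lbrace>p, \<lbrace>q, s, u\<rbrace>, v\<rbrace> + \<lbrace>\<lbrace>p, s, q\<rbrace>, u, v\<rbrace> + \<lbrace>\<lbrace>p, u, q\<rbrace>, s, v\<rbrace> - \<lbrace>\<lbrace>p, u, s\<rbrace>, q, v\<rbrace>" for p q s u v
    unfolding triple_middle by (simp add: algebra_simps)
  have f13: "\<lbrace>\<lbrace>p, q, s\<rbrace>, u, v\<rbrace> \<in> Q" if "p \<in> D" "s \<in> D" for p q s u v
    unfolding r[of p q s u v] using that by (intro s q d)
  have f23: "\<lbrace>\<lbrace>p, q, s\<rbrace>, u, v\<rbrace> \<in> Q" if "q \<in> D" "s \<in> D" for p q s u v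
    unfolding r[of p q s u v] using that by (intro s q(1) q(2) q(3) d(2) d(1) | assumption)+
  have f12: "\<lbrace>\<lbrace>p, q, s\<rbrace>, u, v\<rbrace> \<in> Q" if "p \<in> D" "q \<in> D" for p q s u v
  proof -
    have "\<lbrace>p, \<lbrace>q, s, u\<rbrace>, v\<rbrace> \<in> Q" using that by (intro q(3) d)
    moreover have "\<lbrace>\<lbrace>p, s, q\<rbrace>, u, v\<rbrace> \<in> Q" "\<lbrace>\<lbrace>p, u, q\<rbrace>, s, v\<rbrace> \<in> Q" using that f13 by blast+
    moreover have "\<lbrace>\<lbrace>p, u, s\<rbrace>, q, v\<rbrace> \<in> Q" using that by (intro q(3) d)
    ultimately show ?thesis unfolding m[of p q s u v] by (intro s)
  qed
  define S where "S = {z. \<forall>u v. \<lbrace>z, u, v\<rbrace> \<in> Q \<and> \<lbrace>u, z, v\<rbrace> \<in> Q \<and> \<lbrace>u, v, z\<rbrace> \<in> Q}"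
  have S: "subspace S"
    unfolding S_def
    by (rule subspaceI) (simp_all add: triple_simps subspace_0[OF Q] subspace_add[OF Q] subspace_scale[OF Q])
  have "Q \<subseteq> S"
    unfolding Q_def
  proof (rule derived_Suc_least[OF S]; fold D_def)
    fix a x y assume xy: "x \<in> D" "y \<in> D"
    have in1: "\<lbrace>\<lbrace>a, x, y\<rbrace>, u, v\<rbrace> \<in> Q" "\<lbrace>\<lbrace>x, a, y\<rbrace>, u, v\<rbrace> \<in> Q" "\<lbrace>\<lbrace>x, y, a\<rbrace>, u, v\<rbrace> \<in> Q"
      "\<lbrace>\<lbrace>a, y, x\<rbrace>, u, v\<rbrace> \<in> Q" "\<lbrace>\<lbrace>y, a, x\<rbrace>, u, v\<rbrace> \<in> Q" "\<lbrace>\<lbrace>y, x, a\<rbrace>, u, v\<rbrace> \<in> Q" for a u v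
      using xy by (simp_all add: f12 f13 f23)
    \<comment> \<open>The other terms that the axioms produce: one of \<open>x\<close>,
      \<open>y\<close> inside and one outside, or both outside.\<close>
    have in2: "\<lbrace>\<lbrace>b, c, x\<rbrace>, y, v\<rbrace> \<in> Q" "\<lbrace>\<lbrace>b, c, x\<rbrace>, v, y\<rbrace> \<in> Q" "\<lbrace>\<lbrace>b, c, y\<rbrace>, x, v\<rbrace> \<in> Q" "\<lbrace>\<lbrace>b, c, y\<rbrace>, v, x\<rbrace> \<in> Q"
      "\<lbrace>\<lbrace>b, x, c\<rbrace>, y, v\<rbrace> \<in> Q" "\<lbrace>\<lbrace>b, x, c\<rbrace>, v, y\<rbrace> \<in> Q" "\<lbrace>\<lbrace>b, y, c\<rbrace>, x, v\<rbrace> \<in> Q" "\<lbrace>\<lbrace>b, y, c\<rbrace>, v, x\<rbrace> \<in> Q"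
      "\<lbrace>b, x, y\<rbrace> \<in> Q" "\<lbrace>b, y, x\<rbrace> \<in> Q" for b c v
      using xy d q by simp_all
    show "\<lbrace>a, x, y\<rbrace> \<in> S" "\<lbrace>x, a, y\<rbrace> \<in> S" "\<lbrace>x, y, a\<rbrace> \<in> S"
      unfolding S_def mem_Collect_eq
      by (intro allI conjI; (unfold triple_middle[of _ a] triple_middle[of _ x] triple_right[of _ _ a] triple_right[of _ _ x])?;
          (intro s in1 in2)?)+
  qed
  then show ?case unfolding S_def Q_def[symmetric] by (intro idealI[OF Q]) auto
qed (use I in simp)

lemma derived_shift:
  assumes "derived k A \<subseteq> B"
  shows "derived (n + k) A \<subseteq> derived n B"
proof (induction n)
  case (Suc n)
  have "triple_prod P Q S \<subseteq> triple_prod P' Q' S'" if "P \<subseteq> P'" "Q \<subseteq> Q'" "S \<subseteq> S'" for P Q S P' Q' S'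
    unfolding triple_prod_def by (rule span_mono) (use that in blast)
  then show ?case unfolding add_Suc derived.simps using Suc by (intro set_plus_mono2) auto
qed (use assms in simp)

lemma solvable_if_derived_subset:
  assumes A: "subspace A" and sub: "derived k A \<subseteq> B" and B: "solvable B"
  shows "solvable A"
proof -
  obtain m where m: "m > 0" "derived m B = {0}" using B unfolding solvable_def by blast
  have "derived (m + k) A \<subseteq> {0}" using derived_shift[OF sub, of m] m(2) by simp
  moreover have "0 \<in> derived (m + k) A" by (rule subspace_0[OF subspace_derived[OF A]])
  ultimately have "derived (m + k) A = {0}" by blast
  then show ?thesis unfolding solvable_def using m(1) by (intro exI[of _ "m + k"]) simp
qed

text \<open>The \<open>n\<close>-th derived term of the sum stays in \<open>derived n A + B\<close>,
  so it enters \<open>B\<close> once the series of \<open>A\<close> vanishes.\<close>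

lemma ideal_sum_solvable:
  assumes A: "ideal A" "solvable A" and B: "ideal B" "solvable B"
  shows "ideal (span (A \<union> B))" "solvable (span (A \<union> B))"
proof -
  have decomp: "\<exists>s b. z = s + b \<and> s \<in> S \<and> b \<in> B" if "subspace S" "z \<in> span (S \<union> B)" for S z
    using that span_Un[of S B] span_eq_iff[THEN iffD2, OF that(1)] span_eq_iff[THEN iffD2, OF idealD(1)[OF B(1)]]
    by auto
  let ?C = "span (A \<union> B)"
  have AC: "x \<in> ?C" if "x \<in> A \<or> x \<in> B" for x using that by (auto intro: span_base)
  show C: "ideal ?C"
  proof (rule idealI[OF subspace_span])
    fix z u v assume "z \<in> ?C"
    then obtain a b where ab: "z = a + b" "a \<in> A" "b \<in> B" using decomp[OF idealD(1)[OF A(1)]] by blast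
    show "\<lbrace>z, u, v\<rbrace> \<in> ?C" "\<lbrace>u, z, v\<rbrace> \<in> ?C" "\<lbrace>u, v, z\<rbrace> \<in> ?C"
      using idealD(2-4)[OF A(1) ab(2)] idealD(2-4)[OF B(1) ab(3)]
      by (simp_all add: ab(1) triple_simps span_add AC)
  qed
  have sub: "derived n ?C \<subseteq> span (derived n A \<union> B)" for n
  proof (induction n)
    case (Suc n)
    let ?S = "span (derived (Suc n) A \<union> B)"
    have inS: "x \<in> ?S" if "x \<in> derived (Suc n) A \<or> x \<in> B" for x using that by (auto intro: span_base)
    show ?case
    proof (rule derived_Suc_least[OF subspace_span])
      fix t x y assume "x \<in> derived n ?C" "y \<in> derived n ?C"
      then have "x \<in> span (derived n A \<union> B)" "y \<in> span (derived n A \<union> B)" using Suc by blast+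
      then obtain a b a' b' where ab: "x = a + b" "a \<in> derived n A" "b \<in> B"
        "y = a' + b'" "a' \<in> derived n A" "b' \<in> B"
        using decomp[OF subspace_derived[OF idealD(1)[OF A(1)]]] by meson
      note m = derived_Suc_mem[OF ab(2,5)] and Bb = idealD(2-4)[OF B(1) ab(3)] and Bb' = idealD(2-4)[OF B(1) ab(6)]
      show "\<lbrace>t, x, y\<rbrace> \<in> ?S" "\<lbrace>x, t, y\<rbrace> \<in> ?S" "\<lbrace>x, y, t\<rbrace> \<in> ?S"
        using m Bb Bb' by (simp_all add: ab(1,4) triple_simps span_add inS del: derived.simps)
    qed
  qed simp
  obtain k where k: "derived k A = {0}" using A(2) unfolding solvable_def by blast
  have "span ({0} \<union> B) \<subseteq> B" using idealD(1)[OF B(1)] by (intro span_minimal) (auto intro: subspace_0)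
  then have "derived k ?C \<subseteq> B" using sub[of k] k by auto
  then show "solvable ?C" by (rule solvable_if_derived_subset[OF subspace_span _ B(2)])
qed

text \<open>A solvable ideal of largest dimension absorbs every other one, because sums of two are
  solvable; the span in the definition is therefore that ideal.\<close>

lemma solvable_radical:
  shows ideal_radical: "ideal solvable_radical" and solvable_solvable_radical: "solvable solvable_radical"
    and solvable_subset_radical: "ideal I \<Longrightarrow> solvable I \<Longrightarrow> I \<subseteq> solvable_radical"
proof -
  have "ideal {0}" by (rule idealI) (auto simp: triple_simps)
  moreover have "derived (Suc 0) {0} \<subseteq> {0}"
    by (rule derived_Suc_least) (auto simp: triple_simps)
  then have "derived (Suc 0) {0} = {0}"
    using subspace_0[OF subspace_derived[OF subspace_single_0, of "Suc 0"]] by blast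
  then have "solvable {0}" unfolding solvable_def by blast
  ultimately obtain M where M: "ideal M \<and> solvable M" and max: "\<And>U. ideal U \<and> solvable U \<Longrightarrow> dim U \<le> dim M"
    using ex_max_dim[of "\<lambda>I. ideal I \<and> solvable I" "{0}"] by blast
  have sub: "I \<subseteq> M" if I: "ideal I" "solvable I" for I
  proof -
    have "ideal (span (I \<union> M)) \<and> solvable (span (I \<union> M))" using ideal_sum_solvable I M by blast
    then have "dim (span (I \<union> M)) \<le> dim M" by (rule max)
    moreover have MM: "M \<subseteq> span (I \<union> M)" by (auto intro: span_base)
    ultimately have "M = span (I \<union> M)"
      using subspace_dim_equal[OF idealD(1) subspace_span MM] M by blast
    then show ?thesis by (auto intro: span_base)
  qed
  have "solvable_radical = M"
  proof
    show "solvable_radical \<subseteq> M" unfolding solvable_radical_def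
      by (rule span_minimal) (use sub M idealD(1) in auto)
    show "M \<subseteq> solvable_radical" unfolding solvable_radical_def using M by (auto intro: span_base)
  qed
  then show "ideal solvable_radical" "solvable solvable_radical"
    "ideal I \<Longrightarrow> solvable I \<Longrightarrow> I \<subseteq> solvable_radical"
    using M sub by auto
qed

end

section \<open>The universal envelope\<close>

lemma (in vector_space) ex_finite_dimensional:
  assumes "finite S" "span S = UNIV"
  obtains B where "finite_dimensional_vector_space scale B"
proof -
  obtain B where B: "B \<subseteq> S" "independent B" "S \<subseteq> span B"
    using maximal_independent_subset by blast
  have "span S \<subseteq> span B" by (rule span_minimal[OF B(3) subspace_span])
  then have "finite_dimensional_vector_space scale B"
    using B(1,2) assms finite_subset by unfold_locales auto
  then show thesis by (rule that)
qed

context universal_leibniz_envelope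
begin

section \<open>Multiplication operators and the Leibniz identity modulo \<open>K(T)\<close>\<close>

abbreviation "L \<equiv> bracket_TT_T"
text \<open>The arguments are swapped so that \<open>R w\<close> is an operator on \<open>T\<close>,
  right multiplication by \<open>w\<close>.\<close>

abbreviation "R w a \<equiv> bracket_T_TT a w"
abbreviation "M \<equiv> bracket_TT_TT"

lemmas LRM_simps =
  bilinear_add_scale[OF bilinear_TT_T] bilinear_add_scale[OF bilinear_T_TT]
  bilinear_add_scale[OF bilinear_TT_TT] bilinear_add_scale[OF tensor_bilinear]
  bracket_zero triple_simps

lemmas LRM_tensor = bracket_TT_T_tensor bracket_T_TT_tensor bracket_TT_TT_tensor

lemma bilinear_diff:
  assumes "bilinear_map sA sB sC f"
  shows "f (x - x') y = f x y - f x' y" "f x (y - y') = f x y - f x y'"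
proof -
  interpret l: Vector_Spaces.linear sB sC "\<lambda>y. f x y"
    using assms unfolding bilinear_map_def by blast
  interpret r: Vector_Spaces.linear sA sC "\<lambda>x. f x y"
    using assms unfolding bilinear_map_def by blast
  show "f (x - x') y = f x y - f x' y" "f x (y - y') = f x y - f x y'" by (rule r.diff, rule l.diff)
qed

lemmas LRM_diff = bilinear_diff[OF bilinear_TT_T] bilinear_diff[OF bilinear_T_TT]
  bilinear_diff[OF bilinear_TT_TT] bilinear_diff[OF tensor_bilinear]

text \<open>There is no case for scalars: they are absorbed into the first factor of a pure
  tensor.\<close>

lemma tensor_induct [case_names tensor add]:
  assumes t: "\<And>a b. P (tensor a b)" and add: "\<And>x y. P x \<Longrightarrow> P y \<Longrightarrow> P (x + y)"
  shows "P w"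
proof -
  have "w \<in> W.span {tensor a b | a b. True}" using span_tensors by simp
  then show ?thesis
  proof (induction rule: W.span_induct_alt)
    case base
    show ?case using t[of 0 0] by (simp add: LRM_simps)
  next
    case (step c x y)
    then obtain a b where "x = tensor a b" by blast
    then have "tscale c x = tensor (scale c a) b" by (simp add: LRM_simps)
    then show ?case using step add t by simp
  qed
qed

lemma L_M: "L (M w w') a = R w' (L w a) - L w (R w' a)"
proof (induction w rule: tensor_induct)
  case (tensor p q)
  show ?case
  proof (induction w' rule: tensor_induct)
    case (tensor s t)
    show ?case by (simp add: LRM_tensor LRM_diff triple_simps triple_right algebra_simps)
  qed (simp add: LRM_simps algebra_simps)
qed (simp add: LRM_simps algebra_simps)

text \<open>On pure tensors this combines the axioms: \<open>triple_middle\<close> rewrites the term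
  with \<open>R w b\<close>, \<open>triple_right\<close> the one with \<open>R w c\<close>.\<close>

lemma R_derivation: "R w \<lbrace>a, b, c\<rbrace> = \<lbrace>R w a, b, c\<rbrace> + \<lbrace>a, R w b, c\<rbrace> + \<lbrace>a, b, R w c\<rbrace>"
proof (induction w rule: tensor_induct)
  case (tensor s t)
  show ?case by (simp add: LRM_tensor triple_simps triple_right triple_middle algebra_simps)
qed (simp add: LRM_simps algebra_simps)

lemma R_M: "R (M w w') a = R w' (R w a) - R w (R w' a)"
proof (induction w rule: tensor_induct)
  case (tensor p q)
  show ?case
  proof (induction w' rule: tensor_induct)
    case (tensor s t)
    show ?case by (simp add: LRM_tensor LRM_diff triple_simps triple_right triple_middle algebra_simps)
  qed (simp add: LRM_simps algebra_simps)
qed (simp add: LRM_simps algebra_simps)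

text \<open>In a Leibniz algebra \<open>[x, [y, z] + [z, y]] = 0\<close>. Here this is an
  alternating sum of three instances of \<open>triple_right\<close>, whose twelve terms
  cancel.\<close>

lemma L_R_L: "L w (R w' a) = - L w (L w' a)"
proof (induction w rule: tensor_induct)
  case (tensor p q)
  show ?case
  proof (induction w' rule: tensor_induct)
    case (tensor s t)
    show ?case by (simp add: LRM_tensor triple_simps triple_right algebra_simps)
  qed (simp add: LRM_simps algebra_simps)
qed (simp add: LRM_simps algebra_simps)

lemma triple_R_L: "\<lbrace>a, R w b, c\<rbrace> = - \<lbrace>a, L w b, c\<rbrace>"
proof (induction w rule: tensor_induct)
  case (tensor s t)
  show ?case by (simp add: LRM_tensor triple_simps triple_middle algebra_simps)
qed (simp add: LRM_simps algebra_simps)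

lemma triple_R_L_right: "\<lbrace>a, b, R w c\<rbrace> = - \<lbrace>a, b, L w c\<rbrace>"
  using L_R_L[where w = "tensor a b" and w' = w and a = c] by (simp add: LRM_tensor)

lemma ubracket_pair: "ubracket (a, w) (b, w') = (L w b + R w' a, tensor a b + M w w')"
  by (simp add: ubracket_def)

lemma uscale_pair: "uscale c (a, w) = (scale c a, tscale c w)"
proof -
  interpret P: vector_space_prod scale tscale ..
  show ?thesis by (simp add: uscale_def P.scale_def)
qed

lemma U_subspaceI:
  assumes "(0, 0) \<in> S" "\<And>a w b w'. (a, w) \<in> S \<Longrightarrow> (b, w') \<in> S \<Longrightarrow> (a + b, w + w') \<in> S"
    "\<And>c a w. (a, w) \<in> S \<Longrightarrow> (scale c a, tscale c w) \<in> S"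
  shows "U.subspace S"
proof (rule U.subspaceI)
  show "0 \<in> S" using assms(1) by (simp add: zero_prod_def)
  show "x + y \<in> S" if "x \<in> S" "y \<in> S" for x y
    using that assms(2) by (cases x; cases y) simp
  show "uscale c x \<in> S" if "x \<in> S" for c x
    using that assms(3) by (cases x) (simp add: uscale_pair)
qed

lemma K_kernel_iff: "w \<in> K_kernel \<longleftrightarrow> (\<forall>a. L w a = 0 \<and> R w a = 0)"
  by (simp add: K_kernel_def inT_def inTT_def ubracket_pair LRM_simps zero_prod_def)

lemma subspace_K: "W.subspace K_kernel"
  by (rule W.subspaceI) (simp_all add: K_kernel_iff LRM_simps)

lemma inTT_iff: "x \<in> inTT ` S \<longleftrightarrow> (\<exists>w\<in>S. x = (0, w))"
  by (auto simp: inTT_def)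

text \<open>This and the next two lemmas collect the failures of the Leibniz identity inside
  \<open>T \<otimes> T\<close>: by the operator identities above they act on \<open>T\<close> as
  zero, though nothing forces them to vanish as tensors.\<close>

lemma M_tensor_defect: "M (tensor a b) w - tensor (R w a) b - tensor a (R w b) \<in> K_kernel"
  unfolding K_kernel_iff
  by (simp add: LRM_diff LRM_simps L_M R_M LRM_tensor R_derivation algebra_simps)

lemma tensor_L_R_K: "tensor a (L w b + R w b) \<in> K_kernel"
  unfolding K_kernel_iff by (simp add: LRM_simps LRM_tensor triple_R_L triple_R_L_right)

lemma M_M_defect: "M (M w w') w'' - M (M w w'') w' - M w (M w' w'') \<in> K_kernel"
  unfolding K_kernel_iff by (simp add: LRM_diff LRM_simps L_M R_M algebra_simps)

lemma M_tensor_right: "M w (tensor b c) = tensor (L w b) c - tensor (L w c) b"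
proof (induction w rule: tensor_induct)
  case (tensor p q)
  show ?case by (simp add: LRM_tensor)
qed (simp add: LRM_simps algebra_simps)

lemma ubracket_leibniz:
  "ubracket (ubracket x y) z - ubracket (ubracket x z) y - ubracket x (ubracket y z) \<in> inTT ` K_kernel"
proof -
  obtain a w b w' c w'' where xyz: "x = (a, w)" "y = (b, w')" "z = (c, w'')" by (metis surj_pair)
  let ?d = "ubracket (ubracket x y) z - ubracket (ubracket x z) y - ubracket x (ubracket y z)"
  have T: "fst ?d = 0"
    unfolding xyz by (simp add: ubracket_pair LRM_simps LRM_tensor L_M R_M L_R_L algebra_simps)
  \<comment> \<open>The terms in \<open>w\<close>, \<open>b\<close>, \<open>c\<close> cancel exactly
    by \<open>M_tensor_right\<close>; the other combinations are sums of the three defects.\<close>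
  have "snd ?d = (M (tensor a b) w'' - tensor (R w'' a) b - tensor a (R w'' b))
      - (M (tensor a c) w' - tensor (R w' a) c - tensor a (R w' c))
      - tensor a (L w' c + R w' c)
      + (M (M w w') w'' - M (M w w'') w' - M w (M w' w''))"
    unfolding xyz by (simp add: ubracket_pair LRM_simps M_tensor_right algebra_simps)
  also have "\<dots> \<in> K_kernel"
    by (intro W.subspace_add[OF subspace_K] W.subspace_diff[OF subspace_K] M_tensor_defect tensor_L_R_K M_M_defect)
  finally have "snd ?d \<in> K_kernel" .
  then show ?thesis using T unfolding inTT_iff by (intro bexI[of _ "snd ?d"]) (simp_all add: prod_eq_iff)
qed

section \<open>Envelopes of ideals and their solvability\<close>

lemma j_ideal_iff:
  assumes I: "subspace I"
  shows "w \<in> j_ideal I \<longleftrightarrow> (\<forall>a. L w a \<in> I \<and> R w a \<in> I)"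
proof -
  have br: "ubracket (inTT w) (inT a) = inT (L w a)" "ubracket (inT a) (inTT w) = inT (R w a)" for a
    by (simp_all add: inT_def inTT_def ubracket_pair LRM_simps)
  have inj: "inT x \<in> inT ` I \<longleftrightarrow> x \<in> I" for x by (auto simp: inT_def)
  have subI: "U.subspace (inT ` I)"
    by (rule U_subspaceI) (use I in \<open>auto simp: inT_def subspace_0 subspace_add subspace_scale\<close>)
  have z: "0 \<in> U.bracket_prod A B" for A B unfolding U.bracket_prod_def by (rule U.span_zero)
  have b: "ubracket x y \<in> U.bracket_prod A B" if "x \<in> A" "y \<in> B" for x y A B
    unfolding U.bracket_prod_def by (rule U.span_base) (use that in blast)
  show ?thesis
  proof
    assume w: "w \<in> j_ideal I"
    have sub: "p + q \<in> inT ` I" if "p \<in> U.bracket_prod {inTT w} (range inT)"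
      "q \<in> U.bracket_prod (range inT) {inTT w}" for p q
      using w that unfolding j_ideal_def set_plus_def by blast
    show "\<forall>a. L w a \<in> I \<and> R w a \<in> I"
    proof (intro allI conjI)
      fix a
      have "ubracket (inTT w) (inT a) + 0 \<in> inT ` I" by (intro sub b z) auto
      then show "L w a \<in> I" by (simp add: br inj)
      have "0 + ubracket (inT a) (inTT w) \<in> inT ` I" by (intro sub b z) auto
      then show "R w a \<in> I" by (simp add: br inj)
    qed
  next
    assume a: "\<forall>a. L w a \<in> I \<and> R w a \<in> I"
    have "U.bracket_prod {inTT w} (range inT) \<subseteq> inT ` I"
      unfolding U.bracket_prod_def by (rule U.span_minimal[OF _ subI]) (use a in \<open>auto simp: br inj\<close>)
    moreover have "U.bracket_prod (range inT) {inTT w} \<subseteq> inT ` I"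
      unfolding U.bracket_prod_def by (rule U.span_minimal[OF _ subI]) (use a in \<open>auto simp: br inj\<close>)
    ultimately show "w \<in> j_ideal I"
      unfolding j_ideal_def set_plus_def using U.subspace_add[OF subI] by blast
  qed
qed

lemma J_envelope_iff:
  assumes "subspace I"
  shows "(a, w) \<in> J_envelope I \<longleftrightarrow> a \<in> I \<and> (\<forall>b. L w b \<in> I \<and> R w b \<in> I)"
  unfolding J_envelope_def set_plus_def inT_def inTT_def j_ideal_iff[OF assms, symmetric] by auto

lemma I_envelope_iff: "(a, w) \<in> I_envelope I \<longleftrightarrow> a \<in> I \<and> w \<in> i_ideal I"
  unfolding I_envelope_def set_plus_def inT_def inTT_def by auto

lemma tensor_prod_mem: "a \<in> A \<Longrightarrow> b \<in> B \<Longrightarrow> tensor a b \<in> tensor_prod A B"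
  unfolding tensor_prod_def by (rule W.span_base) blast

lemma subspace_tensor_prod: "W.subspace (tensor_prod A B)"
  unfolding tensor_prod_def by (rule W.subspace_span)

lemma subspace_W_sum: "W.subspace A \<Longrightarrow> W.subspace B \<Longrightarrow> W.subspace (A + B)"
  using W.subspace_sums[of A B] unfolding set_plus_def by (simp add: conj_commute Bex_def ac_simps)

lemma W_sum_mem:
  "W.subspace A \<Longrightarrow> W.subspace B \<Longrightarrow> x \<in> A \<Longrightarrow> x \<in> A + B"
  "W.subspace A \<Longrightarrow> W.subspace B \<Longrightarrow> x \<in> B \<Longrightarrow> x \<in> A + B"
  using set_plus_intro[of x A 0 B] set_plus_intro[of 0 A x B] by (auto dest: W.subspace_0)

lemma L_ideal: "ideal I \<Longrightarrow> a \<in> I \<Longrightarrow> L w a \<in> I"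
  by (induction w rule: tensor_induct) (simp_all add: LRM_tensor LRM_simps idealD subspace_add[OF idealD(1)])

lemma R_ideal: "ideal I \<Longrightarrow> a \<in> I \<Longrightarrow> R w a \<in> I"
  by (induction w rule: tensor_induct)
    (simp_all add: LRM_tensor LRM_simps idealD subspace_add[OF idealD(1)] subspace_diff[OF idealD(1)])

text \<open>By \<open>M_tensor_right\<close> only left multiplication by \<open>w\<close> enters,
  and its values appear in the first factor.\<close>

lemma M_tensor_prod:
  assumes "\<And>c. L w c \<in> S"
  shows "M w w' \<in> tensor_prod S UNIV"
  by (induction w' rule: tensor_induct)
    (simp_all add: M_tensor_right LRM_simps W.subspace_diff W.subspace_add subspace_tensor_prod
      tensor_prod_mem assms)

lemma ideal_J_envelope:
  assumes I: "ideal I"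
  shows "U.ideal (J_envelope I)"
proof (rule U.idealI)
  note s = idealD(1)[OF I]
  note J = J_envelope_iff[OF s]
  show "U.subspace (J_envelope I)"
    by (rule U_subspaceI)
      (simp_all add: J LRM_simps subspace_0[OF s] subspace_add[OF s] subspace_scale[OF s])
  note i = idealD(2-4)[OF I] L_ideal[OF I] R_ideal[OF I] subspace_add[OF s] subspace_diff[OF s]
  fix x y :: "'v \<times> 'w" assume x: "x \<in> J_envelope I"
  obtain a w b w' where xy: "x = (a, w)" "y = (b, w')" by (metis surj_pair)
  then have aw: "a \<in> I" "\<And>b. L w b \<in> I" "\<And>b. R w b \<in> I" using x by (simp_all add: J)
  show "ubracket x y \<in> J_envelope I" "ubracket y x \<in> J_envelope I"
    unfolding xy ubracket_pair J using aw by (simp_all add: LRM_simps LRM_tensor L_M R_M i)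
qed

lemma tensor_prod_act:
  assumes w: "w \<in> tensor_prod D UNIV" and S: "subspace S"
    and gen: "\<And>x t. x \<in> D \<Longrightarrow> \<lbrace>x, t, c\<rbrace> \<in> S \<and> \<lbrace>c, x, t\<rbrace> \<in> S \<and> \<lbrace>c, t, x\<rbrace> \<in> S"
  shows "L w c \<in> S \<and> R w c \<in> S"
  using w unfolding tensor_prod_def
proof (induction rule: W.span_induct_alt)
  case (step r x y)
  then show ?case using gen
    by (auto simp: LRM_simps LRM_tensor intro!: subspace_add[OF S] subspace_scale[OF S] subspace_diff[OF S])
qed (simp add: LRM_simps subspace_0[OF S])

text \<open>One step of the series of \<open>I\<close> costs two brackets in the envelope: the first
  bracket leads from \<open>J_envelope I\<close> into \<open>P 0\<close>, then brackets of
  \<open>P k\<close> lie in \<open>Q k\<close> and brackets of \<open>Q k\<close> in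
  \<open>P (Suc k)\<close>.\<close>

lemma solvable_J_envelope:
  assumes I: "ideal I" "solvable I"
  shows "U.solvable (J_envelope I)"
proof -
  define D where "D k = derived k I" for k
  have D: "ideal (D k)" for k unfolding D_def by (rule ideal_derived[OF I(1)])
  note s = idealD(1)[OF D]
  have DS: "\<lbrace>a, x, y\<rbrace> \<in> D (Suc k)" "\<lbrace>x, a, y\<rbrace> \<in> D (Suc k)" "\<lbrace>x, y, a\<rbrace> \<in> D (Suc k)"
    if "x \<in> D k" "y \<in> D k" for a x y k
    using derived_Suc_mem[of x k I y a] that unfolding D_def by auto
  define P where "P k = {(a, w). a \<in> D k \<and> w \<in> tensor_prod (D k) UNIV}" for k
  \<comment> \<open>\<open>Q\<close> controls only the left action of its tensors. That is what
    \<open>M_tensor_prod\<close> asks for, so the next bracket lands in \<open>tensor_prod\<close>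
    again.\<close>
  define Q where "Q k = {(a, w). a \<in> D (Suc k) \<and> (\<forall>c. L w c \<in> D (Suc k))}" for k
  have subP: "U.subspace (P k)" for k
    by (rule U_subspaceI) (simp_all add: P_def subspace_0[OF s] subspace_add[OF s] subspace_scale[OF s]
        W.subspace_0 W.subspace_add W.subspace_scale subspace_tensor_prod)
  have subQ: "U.subspace (Q k)" for k
    by (rule U_subspaceI) (simp_all add: Q_def LRM_simps subspace_0[OF s] subspace_add[OF s] subspace_scale[OF s])
  have prod_sub: "U.bracket_prod A A \<subseteq> B" if "U.subspace B" "\<And>x y. x \<in> A \<Longrightarrow> y \<in> A \<Longrightarrow> ubracket x y \<in> B" for A B
    unfolding U.bracket_prod_def by (rule U.span_minimal) (use that in blast)+
  have JP: "ubracket x y \<in> P 0" if "x \<in> J_envelope I" "y \<in> J_envelope I" for x y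
  proof -
    obtain a w b w' where xy: "x = (a, w)" "y = (b, w')" by (metis surj_pair)
    have D0: "D 0 = I" by (simp add: D_def)
    have "a \<in> I" "\<And>b. L w b \<in> I" "\<And>b. R w' b \<in> I"
      using that unfolding xy by (simp_all add: J_envelope_iff[OF idealD(1)[OF I(1)]])
    then show ?thesis unfolding xy ubracket_pair P_def D0
      by (simp add: subspace_add[OF idealD(1)[OF I(1)]] W.subspace_add[OF subspace_tensor_prod] tensor_prod_mem M_tensor_prod)
  qed
  have PQ: "ubracket x y \<in> Q k" if xy: "x \<in> P k" "y \<in> P k" for x y k
  proof -
    obtain a w b w' where xy': "x = (a, w)" "y = (b, w')" by (metis surj_pair)
    have ab: "a \<in> D k" "b \<in> D k" "w \<in> tensor_prod (D k) UNIV" "w' \<in> tensor_prod (D k) UNIV"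
      using xy by (simp_all add: xy' P_def)
    have act: "L v c \<in> D (Suc k) \<and> R v c \<in> D (Suc k)" if "v \<in> tensor_prod (D k) UNIV" "c \<in> D k" for v c
      by (rule tensor_prod_act[OF that(1) s]) (use that(2) DS in blast)
    have act': "L v c \<in> D k \<and> R v c \<in> D k" if "v \<in> tensor_prod (D k) UNIV" for v c
      by (rule tensor_prod_act[OF that s]) (use idealD[OF D] in blast)
    show ?thesis unfolding xy' ubracket_pair Q_def
      using ab act act' DS[of a k b]
      by (simp add: LRM_simps LRM_tensor L_M subspace_add[OF s] subspace_diff[OF s])
  qed
  have QP: "ubracket x y \<in> P (Suc k)" if xy: "x \<in> Q k" "y \<in> Q k" for x y k
  proof -
    obtain a w b w' where xy': "x = (a, w)" "y = (b, w')" by (metis surj_pair)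
    have ab: "a \<in> D (Suc k)" "b \<in> D (Suc k)" "\<And>c. L w c \<in> D (Suc k)"
      using xy by (simp_all add: xy' Q_def)
    then show ?thesis unfolding xy' ubracket_pair P_def
      by (simp add: subspace_add[OF s] L_ideal[OF D] R_ideal[OF D] W.subspace_add[OF subspace_tensor_prod]
          tensor_prod_mem M_tensor_prod)
  qed
  have step: "U.derived (Suc (2 * k)) (J_envelope I) \<subseteq> P k" for k
  proof (induction k)
    case 0
    show ?case using prod_sub[OF subP] JP by simp
  next
    case (Suc k)
    have "U.derived (Suc (Suc (2 * k))) (J_envelope I) \<subseteq> Q k"
      unfolding U.derived.simps(2)[of "Suc (2 * k)"] using Suc PQ by (intro prod_sub[OF subQ]) blast
    then have "U.derived (Suc (Suc (Suc (2 * k)))) (J_envelope I) \<subseteq> P (Suc k)"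
      unfolding U.derived.simps(2)[of "Suc (Suc (2 * k))"] using QP by (intro prod_sub[OF subP]) blast
    then show ?case by simp
  qed
  obtain k where k: "D k = {0}" using I(2) unfolding solvable_def D_def by blast
  have "tensor_prod {0} UNIV \<subseteq> {0}"
    unfolding tensor_prod_def by (rule W.span_minimal) (auto simp: LRM_simps)
  then have "P k \<subseteq> {0}" using k by (auto simp: P_def zero_prod_def)
  then have "U.derived (Suc (2 * k)) (J_envelope I) \<subseteq> {0}" using step[of k] by blast
  moreover have "0 \<in> U.derived (Suc (2 * k)) (J_envelope I)"
    by (simp add: U.bracket_prod_def U.span_zero)
  ultimately have "U.derived (Suc (2 * k)) (J_envelope I) = {0}" by blast
  then show ?thesis unfolding U.solvable_def by blast
qed

end

context universal_leibniz_envelope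
begin

section \<open>The radical of the envelope\<close>

abbreviation "Rad \<equiv> solvable_radical"
abbreviation "J \<equiv> J_envelope Rad"

lemma J_iff: "(a, w) \<in> J \<longleftrightarrow> a \<in> Rad \<and> (\<forall>b. L w b \<in> Rad \<and> R w b \<in> Rad)"
  by (rule J_envelope_iff[OF idealD(1)[OF ideal_radical]])

lemma subspace_Rad: "subspace Rad" by (rule idealD(1)[OF ideal_radical])

lemma ideal_J: "U.ideal J" by (rule ideal_J_envelope[OF ideal_radical])

lemma U_ideal_comb:
  assumes V: "U.ideal V"
  shows "(a, w) \<in> V \<Longrightarrow> (b, w') \<in> V \<Longrightarrow> (a + b, w + w') \<in> V"
    "(a, w) \<in> V \<Longrightarrow> (b, w') \<in> V \<Longrightarrow> (a - b, w - w') \<in> V"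
    "(a, w) \<in> V \<Longrightarrow> (scale c a, tscale c w) \<in> V" "(0, 0) \<in> V"
  using U.subspace_add[OF U.idealD(1)[OF V], of "(a, w)" "(b, w')"]
    U.subspace_diff[OF U.idealD(1)[OF V], of "(a, w)" "(b, w')"]
    U.subspace_scale[OF U.idealD(1)[OF V], of "(a, w)" c]
    U.subspace_0[OF U.idealD(1)[OF V]] by (simp_all add: uscale_pair zero_prod_def)

text \<open>The automorphism of the \<open>\<int>/2\<close>-graded algebra \<open>U(T)\<close>.\<close>

definition sigma :: "'v \<times> 'w \<Rightarrow> 'v \<times> 'w" where
  "sigma x = (- fst x, snd x)"

lemma LRM_neg:
  "L w (- a) = - L w a" "R w (- a) = - R w a" "tensor (- a) b = - tensor a b" "tensor a (- b) = - tensor a b"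
  using LRM_diff(2)[of w 0 a] LRM_diff(3)[of 0 a w] LRM_diff(7)[of 0 a b] LRM_diff(8)[of a 0 b]
  by (simp_all add: LRM_simps)

lemma sigma_ubracket: "sigma (ubracket x y) = ubracket (sigma x) (sigma y)"
  by (cases x; cases y) (simp add: sigma_def ubracket_pair LRM_neg)

lemma sigma_sigma [simp]: "sigma (sigma x) = x"
  by (simp add: sigma_def)

lemma sigma_add: "sigma (x + y) = sigma x + sigma y"
  by (simp add: sigma_def prod_eq_iff)

lemma sigma_scale: "sigma (uscale c x) = uscale c (sigma x)"
  by (cases x) (simp add: sigma_def uscale_pair)

lemma sigma_J: "x \<in> J \<Longrightarrow> sigma x \<in> J"
  by (cases x) (simp add: sigma_def J_iff subspace_neg[OF subspace_Rad])

lemma ideal_sigma: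
  assumes V: "U.ideal V"
  shows "U.ideal {x. sigma x \<in> V}"
proof (rule U.idealI)
  have "sigma 0 = 0" by (simp add: sigma_def zero_prod_def)
  then show "U.subspace {x. sigma x \<in> V}"
    by (intro U.subspaceI)
      (simp_all add: sigma_add sigma_scale U.subspace_0 U.subspace_add U.subspace_scale U.idealD(1)[OF V])
qed (simp_all add: sigma_ubracket U.idealD[OF V])

text \<open>A triple product with two entries in the odd part \<open>B1\<close> is a bracket of two
  elements of \<open>B\<close>, or differs from another such product by one. So
  \<open>derived (Suc 0) B1\<close> lies in \<open>Rad\<close>, which makes \<open>B1\<close>
  solvable.\<close>

lemma graded_abelian_ideal:
  assumes B: "U.ideal B" and graded: "\<And>x. x \<in> B \<Longrightarrow> sigma x \<in> B"
    and ab: "\<And>x y. x \<in> B \<Longrightarrow> y \<in> B \<Longrightarrow> ubracket x y \<in> J"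
  shows "B \<subseteq> J"
proof -
  define B1 where "B1 = {a. (a, 0) \<in> B}"
  note comb = U_ideal_comb[OF B]
  have br: "ubracket x y \<in> B" "ubracket y x \<in> B" if "x \<in> B" for x y
    using U.idealD(2,3)[OF B that] by auto
  have parts: "a \<in> B1" "(0, w) \<in> B" if "(a, w) \<in> B" for a w
  proof -
    have "(- a, w) \<in> B" using graded[OF that] by (simp add: sigma_def)
    \<comment> \<open>\<open>x - \<sigma> x\<close> is twice the odd part of \<open>x\<close>; it is
      halved below.\<close>
    then have "(a + a, 0) \<in> B" using comb(2)[OF that, of "- a" w] by simp
    then have "(scale (1 / 2) (a + a), tscale (1 / 2) 0) \<in> B" by (rule comb(3))
    moreover have "scale (1 / 2) (a + a) = a"
      by (simp add: scale_right_distrib scale_left_distrib[symmetric])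
    ultimately have "(a, 0) \<in> B" by simp
    then show "a \<in> B1" "(0, w) \<in> B" using comb(2)[OF that, of a 0] by (simp_all add: B1_def)
  qed
  have B1: "ideal B1"
  proof (rule idealI)
    show "subspace B1"
      using comb(1)[of _ 0 _ 0] comb(3)[of _ 0] comb(4) by (intro subspaceI) (simp_all add: B1_def)
    fix x a b assume x: "x \<in> B1"
    then have xB: "(x, 0) \<in> B" by (simp add: B1_def)
    have "ubracket (ubracket (x, 0) (a, 0)) (b, 0) \<in> B" "ubracket (ubracket (a, 0) (x, 0)) (b, 0) \<in> B"
      "ubracket (ubracket (a, 0) (b, 0)) (x, 0) \<in> B"
      using xB br by blast+
    then show "\<lbrace>x, a, b\<rbrace> \<in> B1" "\<lbrace>a, x, b\<rbrace> \<in> B1" "\<lbrace>a, b, x\<rbrace> \<in> B1"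
      by (simp_all add: ubracket_pair LRM_simps LRM_tensor B1_def)
  qed
  have "derived (Suc 0) B1 \<subseteq> Rad"
  proof (rule derived_Suc_least[OF subspace_Rad])
    fix a x y assume "x \<in> derived 0 B1" "y \<in> derived 0 B1"
    then have xy: "(x, 0) \<in> B" "(y, 0) \<in> B" by (simp_all add: B1_def)
    have "ubracket (ubracket (a, 0) (x, 0)) (y, 0) \<in> J" "ubracket (ubracket (x, 0) (a, 0)) (y, 0) \<in> J"
      "ubracket (x, 0) (ubracket (y, 0) (a, 0)) \<in> J"
      using xy br ab by blast+
    then have in_Rad: "\<lbrace>a, x, y\<rbrace> \<in> Rad" "\<lbrace>x, a, y\<rbrace> \<in> Rad" "\<lbrace>x, y, a\<rbrace> - \<lbrace>x, a, y\<rbrace> \<in> Rad"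
      by (simp_all add: ubracket_pair LRM_simps LRM_tensor J_iff)
    then show "\<lbrace>a, x, y\<rbrace> \<in> Rad" "\<lbrace>x, a, y\<rbrace> \<in> Rad" by simp_all
    show "\<lbrace>x, y, a\<rbrace> \<in> Rad" using subspace_add[OF subspace_Rad in_Rad(3,2)] by simp
  qed
  then have "solvable B1"
    by (rule solvable_if_derived_subset[OF idealD(1)[OF B1] _ solvable_solvable_radical])
  then have B1R: "B1 \<subseteq> Rad" using solvable_subset_radical B1 by blast
  show ?thesis
  proof
    fix x assume "x \<in> B"
    obtain a w where x: "x = (a, w)" by (metis surj_pair)
    have aw: "a \<in> B1" "(0, w) \<in> B" using parts \<open>x \<in> B\<close> x by auto
    \<comment> \<open>Brackets of the even part with \<open>T\<close> are odd, so they lie in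
      \<open>B1\<close>.\<close>
    have "ubracket (0, w) (b, 0) \<in> B" "ubracket (b, 0) (0, w) \<in> B" for b using br aw(2) by blast+
    then have "L w b \<in> B1" "R w b \<in> B1" for b
      by (simp_all add: ubracket_pair LRM_simps B1_def)
    then show "x \<in> J" unfolding x J_iff using aw(1) B1R by blast
  qed
qed

text \<open>An ideal \<open>A\<close> need not be graded, but \<open>A \<inter> \<sigma> A\<close> and \<open>A + \<sigma> A\<close> are, and the mixed brackets of the
  latter lie in the former.\<close>

lemma abelian_ideal_J:
  assumes A: "U.ideal A" and ab: "\<And>x y. x \<in> A \<Longrightarrow> y \<in> A \<Longrightarrow> ubracket x y \<in> J"
  shows "A \<subseteq> J"
proof -
  define A' where "A' = {x. sigma x \<in> A}"
  have A': "U.ideal A'" unfolding A'_def by (rule ideal_sigma[OF A])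
  have ab': "ubracket x y \<in> J" if "x \<in> A'" "y \<in> A'" for x y
    using sigma_J[OF ab[of "sigma x" "sigma y"]] that by (simp add: A'_def sigma_ubracket)
  have inter: "A \<inter> A' \<subseteq> J"
  proof (rule graded_abelian_ideal)
    show "U.ideal (A \<inter> A')"
      by (rule U.idealI) (use U.idealD[OF A] U.idealD[OF A'] in \<open>auto intro: U.subspace_inter\<close>)
  qed (use ab in \<open>auto simp: A'_def\<close>)
  define S where "S = {x + y | x y. x \<in> A \<and> y \<in> A'}"
  have "S \<subseteq> J"
  proof (rule graded_abelian_ideal)
    have inS: "x + y \<in> S" if "x \<in> A" "y \<in> A'" for x y using that unfolding S_def by blast
    show "U.ideal S"
    proof (rule U.idealI)
      show "U.subspace S" unfolding S_def by (intro U.subspace_sums U.idealD(1) A A')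
      fix x z assume "x \<in> S"
      then obtain u v where uv: "x = u + v" "u \<in> A" "v \<in> A'" unfolding S_def by blast
      show "ubracket x z \<in> S" "ubracket z x \<in> S"
        unfolding uv(1) U.bracket_simps using uv U.idealD[OF A] U.idealD[OF A'] inS by blast+
    qed
    fix x assume "x \<in> S"
    then obtain u v where uv: "x = u + v" "u \<in> A" "v \<in> A'" unfolding S_def by blast
    then have "sigma v \<in> A" "sigma u \<in> A'" by (simp_all add: A'_def)
    from inS[OF this] show "sigma x \<in> S" unfolding uv(1) by (simp add: sigma_add add.commute)
    fix y assume "y \<in> S"
    then obtain u' v' where uv': "y = u' + v'" "u' \<in> A" "v' \<in> A'" unfolding S_def by blast
    have "ubracket u v' \<in> J" "ubracket v u' \<in> J"
      using inter uv uv' U.idealD[OF A] U.idealD[OF A'] by blast+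
    moreover have "ubracket u u' \<in> J" "ubracket v v' \<in> J" using ab ab' uv uv' by blast+
    ultimately show "ubracket x y \<in> J"
      unfolding uv(1) uv'(1) U.bracket_simps by (intro U.subspace_add[OF U.idealD(1)[OF ideal_J]])
  qed
  moreover have "A \<subseteq> S"
  proof
    fix x assume "x \<in> A"
    moreover have "0 \<in> A'" by (rule U.subspace_0[OF U.idealD(1)[OF A']])
    ultimately have "x + 0 \<in> S" unfolding S_def by blast
    then show "x \<in> S" by simp
  qed
  ultimately show ?thesis by blast
qed

section \<open>The ideal generated by the radical together with \<open>K(T)\<close>\<close>

definition IK :: "('v \<times> 'w) set" where
  "IK = {(a, w). a \<in> Rad \<and> w \<in> i_ideal Rad + K_kernel}"

lemma subspace_i: "W.subspace (i_ideal I)"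
  unfolding i_ideal_def by (intro subspace_W_sum subspace_tensor_prod)

lemma i_ideal_mem:
  "a \<in> I \<Longrightarrow> tensor a b \<in> i_ideal I" "b \<in> I \<Longrightarrow> tensor a b \<in> i_ideal I"
  "w \<in> tensor_prod I UNIV \<Longrightarrow> w \<in> i_ideal I"
proof -
  show 1: "w \<in> tensor_prod I UNIV \<Longrightarrow> w \<in> i_ideal I" for w
    unfolding i_ideal_def by (rule W_sum_mem(1)[OF subspace_tensor_prod subspace_tensor_prod])
  show "a \<in> I \<Longrightarrow> tensor a b \<in> i_ideal I" by (intro 1 tensor_prod_mem UNIV_I)
  show "b \<in> I \<Longrightarrow> tensor a b \<in> i_ideal I"
    unfolding i_ideal_def
    by (intro W_sum_mem(2)[OF subspace_tensor_prod subspace_tensor_prod] tensor_prod_mem UNIV_I)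
qed

lemma subspace_iK: "W.subspace (i_ideal I + K_kernel)"
  by (intro subspace_W_sum subspace_i subspace_K)

lemma iK_mem: "w \<in> i_ideal I \<Longrightarrow> w \<in> i_ideal I + K_kernel" "w \<in> K_kernel \<Longrightarrow> w \<in> i_ideal I + K_kernel"
  by (auto intro: W_sum_mem subspace_i subspace_K)

text \<open>For \<open>M w u\<close> the one-sided \<open>M_tensor_prod\<close> is enough. For
  \<open>M u w\<close> the derivation formula on pure tensors holds only up to
  \<open>M_tensor_defect\<close>, which brings in \<open>K_kernel\<close>.\<close>

lemma M_iK:
  assumes "\<And>b. L w b \<in> I" "\<And>b. R w b \<in> I"
  shows "M w u \<in> i_ideal I + K_kernel" "M u w \<in> i_ideal I + K_kernel"
proof -
  show "M w u \<in> i_ideal I + K_kernel"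
    by (intro iK_mem(1) i_ideal_mem(3) M_tensor_prod assms)
  show "M u w \<in> i_ideal I + K_kernel"
  proof (induction u rule: tensor_induct)
    case (tensor a b)
    have "M (tensor a b) w = (M (tensor a b) w - tensor (R w a) b - tensor a (R w b)) + (tensor (R w a) b + tensor a (R w b))"
      by simp
    also have "\<dots> \<in> i_ideal I + K_kernel"
      by (intro W.subspace_add[OF subspace_iK] iK_mem(2)[OF M_tensor_defect] iK_mem(1) i_ideal_mem(1,2) assms)
    finally show ?case .
  qed (simp add: LRM_simps W.subspace_add[OF subspace_iK])
qed

lemma IK_eq: "IK = I_envelope Rad + inTT ` K_kernel"
proof (intro equalityI subsetI)
  fix x assume "x \<in> IK"
  then obtain a u k where x: "x = (a, u + k)" "a \<in> Rad" "u \<in> i_ideal Rad" "k \<in> K_kernel"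
    unfolding IK_def set_plus_def by auto
  then have "(a, u) \<in> I_envelope Rad" "(0, k) \<in> inTT ` K_kernel"
    by (auto simp: I_envelope_iff inTT_iff)
  then have "(a, u) + (0, k) \<in> I_envelope Rad + inTT ` K_kernel" by (rule set_plus_intro)
  then show "x \<in> I_envelope Rad + inTT ` K_kernel" by (simp add: x(1))
next
  fix x assume "x \<in> I_envelope Rad + inTT ` K_kernel"
  then obtain y z where yz: "x = y + z" "y \<in> I_envelope Rad" "z \<in> inTT ` K_kernel"
    by (rule set_plus_elim)
  then obtain k where k: "z = (0, k)" "k \<in> K_kernel" unfolding inTT_iff by blast
  obtain a u where y: "y = (a, u)" by (metis surj_pair)
  have "a \<in> Rad" "u \<in> i_ideal Rad" using yz(2) unfolding y I_envelope_iff by auto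
  then show "x \<in> IK" using k(2) unfolding IK_def yz(1) y k(1) by (auto intro: set_plus_intro)
qed

lemma IK_subset_J: "IK \<subseteq> J"
proof -
  have j: "W.subspace {w. \<forall>b. L w b \<in> Rad \<and> R w b \<in> Rad}" (is "W.subspace ?j")
    by (rule W.subspaceI)
      (simp_all add: LRM_simps subspace_0[OF subspace_Rad] subspace_add[OF subspace_Rad] subspace_scale[OF subspace_Rad])
  note Ri = idealD(2-4)[OF ideal_radical] and Rd = subspace_diff[OF subspace_Rad]
  have "tensor_prod Rad UNIV \<subseteq> ?j"
    unfolding tensor_prod_def by (rule W.span_minimal[OF _ j]) (use Ri Rd in \<open>auto simp: LRM_tensor\<close>)
  moreover have "tensor_prod UNIV Rad \<subseteq> ?j"
    unfolding tensor_prod_def by (rule W.span_minimal[OF _ j]) (use Ri Rd in \<open>auto simp: LRM_tensor\<close>)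
  ultimately have i: "i_ideal Rad \<subseteq> ?j"
    unfolding i_ideal_def set_plus_def using W.subspace_add[OF j] by blast
  have "K_kernel \<subseteq> ?j" by (auto simp: K_kernel_iff subspace_0[OF subspace_Rad])
  then have "i_ideal Rad + K_kernel \<subseteq> ?j"
    using i unfolding set_plus_def using W.subspace_add[OF j] by blast
  then show ?thesis unfolding IK_def by (auto simp: J_iff)
qed

text \<open>A finite basis is given for \<open>T\<close> only; the dimension arguments need one for
  the envelope.\<close>

lemma ex_U_basis: "\<exists>B. finite_dimensional_vector_space uscale B"
proof -
  define S where "S = inT ` Basis \<union> inTT ` ((\<lambda>(a, b). tensor a b) ` (Basis \<times> Basis))"
  have fin: "finite S" unfolding S_def using finite_Basis by simp
  let ?Sp = "U.span S"
  have sub: "U.subspace ?Sp" by (rule U.subspace_span)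
  have sp: "span Basis = UNIV" by (rule span_Basis)
  have T: "(a, 0) \<in> ?Sp" for a
  proof -
    have "a \<in> span Basis" using sp by simp
    then show ?thesis
    proof (induction rule: span_induct_alt)
      case base show ?case using U.subspace_0[OF sub] by (simp add: zero_prod_def)
    next
      case (step c x y)
      have "inT x \<in> ?Sp" using step(1) by (intro U.span_base) (auto simp: S_def)
      then have "uscale c (x, 0) + (y, 0) \<in> ?Sp"
        using step U.subspace_add[OF sub U.subspace_scale[OF sub]] by (simp add: inT_def)
      then show ?case by (simp add: uscale_pair)
    qed
  qed
  have tt: "(0, tensor a b) \<in> ?Sp" for a b
  proof -
    have 1: "(0, tensor a b) \<in> ?Sp" if a: "a \<in> Basis" for a b
    proof -
      have "b \<in> span Basis" using sp by simp
      then show ?thesis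
      proof (induction rule: span_induct_alt)
        case base show ?case using U.subspace_0[OF sub] by (simp add: zero_prod_def LRM_simps)
      next
        case (step c x y)
        have "inTT (tensor a x) \<in> ?Sp" using step(1) a by (intro U.span_base) (auto simp: S_def)
        then have "uscale c (0, tensor a x) + (0, tensor a y) \<in> ?Sp"
          using step U.subspace_add[OF sub U.subspace_scale[OF sub]] by (simp add: inTT_def)
        then show ?case by (simp add: uscale_pair LRM_simps)
      qed
    qed
    have "a \<in> span Basis" using sp by simp
    then show ?thesis
    proof (induction rule: span_induct_alt)
      case base show ?case using U.subspace_0[OF sub] by (simp add: zero_prod_def LRM_simps)
    next
      case (step c x y)
      then have "uscale c (0, tensor x b) + (0, tensor y b) \<in> ?Sp"
        using 1 U.subspace_add[OF sub U.subspace_scale[OF sub]] by blast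
      then show ?case by (simp add: uscale_pair LRM_simps)
    qed
  qed
  have TT: "(0, w) \<in> ?Sp" for w
  proof (induction w rule: tensor_induct)
    case (add x y)
    then show ?case using U.subspace_add[OF sub, of "(0, x)" "(0, y)"] by simp
  qed (rule tt)
  have "(a, w) \<in> ?Sp" for a w using U.subspace_add[OF sub T[of a] TT[of w]] by simp
  then have "?Sp = UNIV" by auto
  then show ?thesis using U.ex_finite_dimensional[OF fin] by metis
qed

theorem radical_of_envelope:
  shows "U.solvable_radical = J" and "J = IK" and "inT ` Rad = J \<inter> range inT"
proof -
  obtain B where "finite_dimensional_vector_space uscale B" using ex_U_basis by blast
  then interpret B: finite_dimensional_vector_space uscale B .
  interpret E: leibniz_extension uscale ubracket B IK J
  proof (intro leibniz_extension.intro leibniz_extension_axioms.intro)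
    show "bracket_algebra uscale ubracket" by (rule U.bracket_algebra_axioms)
    show "finite_dimensional_vector_space uscale B" by (rule B.finite_dimensional_vector_space_axioms)
    show "U.subspace IK"
      by (rule U_subspaceI)
        (auto simp: IK_def subspace_0[OF subspace_Rad] subspace_add[OF subspace_Rad] subspace_scale[OF subspace_Rad]
          W.subspace_0[OF subspace_iK] W.subspace_add[OF subspace_iK] W.subspace_scale[OF subspace_iK])
    show "U.subspace J" by (rule U.idealD(1)[OF ideal_J])
    show "IK \<subseteq> J" by (rule IK_subset_J)
    show "ubracket (ubracket x y) z - ubracket (ubracket x z) y - ubracket x (ubracket y z) \<in> IK" for x y z
    proof -
      have "inTT ` K_kernel \<subseteq> IK"
        by (auto simp: IK_def inTT_def subspace_0[OF subspace_Rad] iK_mem)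
      then show ?thesis using ubracket_leibniz by blast
    qed
    show "V \<subseteq> J" if "U.ideal V" "\<And>x y. x \<in> V \<Longrightarrow> y \<in> V \<Longrightarrow> ubracket x y \<in> J" for V
      using that by (rule abelian_ideal_J)
    fix x y :: "'v \<times> 'w" assume x: "x \<in> J"
    obtain a w b w' where xy: "x = (a, w)" "y = (b, w')" by (metis surj_pair)
    have aw: "a \<in> Rad" "\<And>b. L w b \<in> Rad" "\<And>b. R w b \<in> Rad" using x by (simp_all add: xy J_iff)
    have t: "tensor a b \<in> i_ideal Rad + K_kernel" "tensor b a \<in> i_ideal Rad + K_kernel"
      by (intro iK_mem(1) i_ideal_mem aw(1))+
    show "ubracket x y \<in> IK" "ubracket y x \<in> IK"
      unfolding xy ubracket_pair IK_def using t M_iK[OF aw(2,3), of w'] aw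
      by (simp_all add: L_ideal[OF ideal_radical] R_ideal[OF ideal_radical] subspace_add[OF subspace_Rad]
          W.subspace_add[OF subspace_iK])
  qed
  show "U.solvable_radical = J"
    unfolding U.solvable_radical_def
  proof (rule Greatest_equality)
    show "U.ideal J \<and> U.solvable J"
      using ideal_J solvable_J_envelope[OF ideal_radical solvable_solvable_radical] by blast
    show "V \<subseteq> J" if "U.ideal V \<and> U.solvable V" for V
      using that E.solvable_ideal_subset_J by blast
  qed
  show "J = IK"
  proof (rule equalityI[OF _ IK_subset_J], rule subsetI)
    fix x assume "x \<in> J"
    obtain a w where x: "x = (a, w)" by (metis surj_pair)
    have a: "a \<in> Rad" and w: "(0, w) \<in> J"
      using \<open>x \<in> J\<close> unfolding x by (simp_all add: J_iff subspace_0[OF subspace_Rad])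
    \<comment> \<open>Every tensor is a sum of brackets of elements of \<open>T\<close>, so
      \<open>derived_inter_J\<close> reaches the whole tensor part of \<open>J\<close>.\<close>
    have "(0, w) \<in> U.span {ubracket x y | x y. True}"
    proof (induction w rule: tensor_induct)
      case (tensor p q)
      have "(0, tensor p q) = ubracket (p, 0) (q, 0)" by (simp add: ubracket_pair LRM_simps)
      then show ?case by (intro U.span_base) blast
    next
      case (add u v)
      then show ?case using U.span_add[of "(0, u)" _ "(0, v)"] by simp
    qed
    then have "(0, w) \<in> IK" using w by (rule E.derived_inter_J)
    then show "x \<in> IK" using a unfolding x IK_def by simp
  qed
  show "inT ` Rad = J \<inter> range inT"
    by (auto simp: inT_def J_iff LRM_simps subspace_0[OF subspace_Rad])
qed

end

theorem theorem4p10: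
  fixes scale :: "'k::field_char_0 \<Rightarrow> 'v::ab_group_add \<Rightarrow> 'v"
    and Basis :: "'v set"
    and triple :: "'v \<Rightarrow> 'v \<Rightarrow> 'v \<Rightarrow> 'v"
    and tscale :: "'k \<Rightarrow> 'w::ab_group_add \<Rightarrow> 'w"
    and tensor :: "'v \<Rightarrow> 'v \<Rightarrow> 'w"
  assumes "universal_leibniz_envelope scale Basis triple tscale tensor"
  shows
    "let R = leibniz_triple_system.solvable_radical scale triple;
         uscale = universal_leibniz_envelope.uscale scale tscale;
         ubracket = universal_leibniz_envelope.ubracket scale triple tscale tensor;
         RadU = bracket_algebra.solvable_radical uscale ubracket;
         inT = universal_leibniz_envelope.inT;
         inTT = universal_leibniz_envelope.inTT;
         I_envelope = universal_leibniz_envelope.I_envelope tscale tensor;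
         J_envelope = universal_leibniz_envelope.J_envelope scale triple tscale tensor;
         K = universal_leibniz_envelope.K_kernel scale triple tscale tensor
     in inT ` R = RadU \<inter> range inT \<and>
        RadU = I_envelope R + inTT ` K \<and>
        RadU = J_envelope R"
proof -
  interpret universal_leibniz_envelope scale Basis triple tscale tensor by (fact assms)
  show ?thesis
    unfolding Let_def using radical_of_envelope IK_eq by simp
qed

end
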